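(* There is an algorithm running in $O(m^3n^3)$ time that, given an instance of BQAP1, outputs a feasible solution, and whose domination number is $\Omega(m^{n-1}n^{m-1}+m^{n+1}n+mn^{m+1})$. Likewise, there is an $O(m^3n^3)$-time algorithm for BQAP2 with domination number $\Omega(m^{m-1}n^{n-1}+m^2n^n+m^mn^2)$.
   Context: $M=\{1,\dots,m\}$, $N=\{1,\dots,n\}$. BQAP1 (minimization): data $Q=(q_{ijk\ell})$ ($m\times n\times m\times n$ real array), real $m\times n$ matrices $c,d$; feasible solutions are pairs $(x,y)$ of $m\times n$ 0-1 matrices with $\sum_{j=1}^n x_{ij}=1$ for all $i\in M$ and $\sum_{i=1}^m y_{ij}=1$ for all $j\in N$; objective $f_1(x,y)=\sum_{i,k\in M}\sum_{j,\ell\in N} q_{ijk\ell}x_{ij}y_{k\ell}+\sum_{i\in M,j\in N}c_{ij}x_{ij}+\sum_{i\in M,j\in N}d_{ij}y_{ij}$. BQAP2 (minimization): data $Q$ ($m\times m\times n\times n$ real array), real $m\times m$ matrix $c$, real $n\times n$ matrix $d$; feasible solutions are pairs $(x,y)$ with $x$ an $m\times m$ 0-1 matrix with $\sum_{j=1}^m x_{ij}=1$ for all $i\in M$ and $y$ an $n\times n$ 0-1 matrix with $\sum_{i=1}^n y_{ij}=1$ for all $j\in N$; objective $f_2(x,y)=\sum_{i,j\in M}\sum_{k,\ell\in N} q_{ijk\ell}x_{ij}y_{k\ell}+\sum_{i,j\in M}c_{ij}x_{ij}+\sum_{i,j\in N}d_{ij}y_{ij}$. Domination number of an algorithm $\Gamma$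 outputting $(x^\Gamma,y^\Gamma)$: $\inf_I|\{(x,y)\in\mathcal{F}: f(x,y)\ge f(x^\Gamma,y^\Gamma)\}|$, the infimum over all instances $I$ with size parameters $m,n$, where $\mathcal{F}$ and $f$ are the feasible set and objective of $I$. *)

theory Defs
  imports Complex_Main
begin

text \<open>Integer registers (addressing, loop counters; only +, - and comparison)
and real registers (data; +, -, *, / and comparison). Real values influence the
computation only through comparisons (no real-to-integer conversion).
Every executed instruction costs one time unit.\<close>

datatype instr =
    IConst nat int
  | IAdd nat nat nat
  | ISub nat nat nat
  | ILoad nat nat
  | IStore nat nat
  | RConst nat int
  | RAdd nat nat nat
  | RSub nat nat nat
  | RMul nat nat nat
  | RDiv nat nat nat
  | RLoad nat nat
  | RStore nat nat
  | JmpILe nat nat nat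
  | JmpRLe nat nat nat
  | Jmp nat
  | Halt

record ram_state =
  pc :: nat
  imem :: "nat \<Rightarrow> int"
  rmem :: "nat \<Rightarrow> real"

definition halted :: "instr list \<Rightarrow> ram_state \<Rightarrow> bool" where
  "halted P s \<longleftrightarrow> pc s \<ge> length P \<or> P ! pc s = Halt"

fun exec_instr :: "instr \<Rightarrow> ram_state \<Rightarrow> ram_state" where
  "exec_instr (IConst a k) s = s\<lparr>pc := Suc (pc s), imem := (imem s)(a := k)\<rparr>"
| "exec_instr (IAdd a b c) s = s\<lparr>pc := Suc (pc s), imem := (imem s)(a := imem s b + imem s c)\<rparr>"
| "exec_instr (ISub a b c) s = s\<lparr>pc := Suc (pc s), imem := (imem s)(a := imem s b - imem s c)\<rparr>"
| "exec_instr (ILoad a b) s = s\<lparr>pc := Suc (pc s), imem := (imem s)(a := imem s (nat (imem s b)))\<rparr>"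
| "exec_instr (IStore a b) s = s\<lparr>pc := Suc (pc s), imem := (imem s)(nat (imem s a) := imem s b)\<rparr>"
| "exec_instr (RConst a k) s = s\<lparr>pc := Suc (pc s), rmem := (rmem s)(a := of_int k)\<rparr>"
| "exec_instr (RAdd a b c) s = s\<lparr>pc := Suc (pc s), rmem := (rmem s)(a := rmem s b + rmem s c)\<rparr>"
| "exec_instr (RSub a b c) s = s\<lparr>pc := Suc (pc s), rmem := (rmem s)(a := rmem s b - rmem s c)\<rparr>"
| "exec_instr (RMul a b c) s = s\<lparr>pc := Suc (pc s), rmem := (rmem s)(a := rmem s b * rmem s c)\<rparr>"
| "exec_instr (RDiv a b c) s = s\<lparr>pc := Suc (pc s), rmem := (rmem s)(a := rmem s b / rmem s c)\<rparr>"
| "exec_instr (RLoad a b) s = s\<lparr>pc := Suc (pc s), rmem := (rmem s)(a := rmem s (nat (imem s b)))\<rparr>"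
| "exec_instr (RStore a b) s = s\<lparr>pc := Suc (pc s), rmem := (rmem s)(nat (imem s a) := rmem s b)\<rparr>"
| "exec_instr (JmpILe a b t) s = s\<lparr>pc := (if imem s a \<le> imem s b then t else Suc (pc s))\<rparr>"
| "exec_instr (JmpRLe a b t) s = s\<lparr>pc := (if rmem s a \<le> rmem s b then t else Suc (pc s))\<rparr>"
| "exec_instr (Jmp t) s = s\<lparr>pc := t\<rparr>"
| "exec_instr Halt s = s"

definition step :: "instr list \<Rightarrow> ram_state \<Rightarrow> ram_state" where
  "step P s = (if halted P s then s else exec_instr (P ! pc s) s)"

fun exec :: "instr list \<Rightarrow> nat \<Rightarrow> ram_state \<Rightarrow> ram_state" where
  "exec P 0 s = s"
| "exec P (Suc t) s = exec P t (step P s)"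

definition halts :: "instr list \<Rightarrow> ram_state \<Rightarrow> bool" where
  "halts P s \<longleftrightarrow> (\<exists>t. halted P (exec P t s))"

definition run_time :: "instr list \<Rightarrow> ram_state \<Rightarrow> nat" where
  "run_time P s = (LEAST t. halted P (exec P t s))"

definition final :: "instr list \<Rightarrow> ram_state \<Rightarrow> ram_state" where
  "final P s = exec P (run_time P s) s"

text \<open>Matrices are functions on indices; 0-1 matrices are integer valued,
indices are 1-based as in the paper, entries outside the index range are 0.\<close>

definition feasible1 :: "nat \<Rightarrow> nat \<Rightarrow> (nat \<Rightarrow> nat \<Rightarrow> int) \<Rightarrow> (nat \<Rightarrow> nat \<Rightarrow> int) \<Rightarrow> bool" where
  "feasible1 m n x y \<longleftrightarrow>
     (\<forall>i j. x i j \<in> {0,1} \<and> y i j \<in> {0,1}) \<and>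
     (\<forall>i j. \<not> (i \<in> {1..m} \<and> j \<in> {1..n}) \<longrightarrow> x i j = 0 \<and> y i j = 0) \<and>
     (\<forall>i\<in>{1..m}. (\<Sum>j\<in>{1..n}. x i j) = 1) \<and>
     (\<forall>j\<in>{1..n}. (\<Sum>i\<in>{1..m}. y i j) = 1)"

definition f1 :: "nat \<Rightarrow> nat \<Rightarrow> (nat \<Rightarrow> nat \<Rightarrow> nat \<Rightarrow> nat \<Rightarrow> real) \<Rightarrow> (nat \<Rightarrow> nat \<Rightarrow> real)
   \<Rightarrow> (nat \<Rightarrow> nat \<Rightarrow> real) \<Rightarrow> (nat \<Rightarrow> nat \<Rightarrow> int) \<Rightarrow> (nat \<Rightarrow> nat \<Rightarrow> int) \<Rightarrow> real" where
  "f1 m n Q c d x y =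
     (\<Sum>i\<in>{1..m}. \<Sum>k\<in>{1..m}. \<Sum>j\<in>{1..n}. \<Sum>l\<in>{1..n}. Q i j k l * of_int (x i j) * of_int (y k l))
     + (\<Sum>i\<in>{1..m}. \<Sum>j\<in>{1..n}. c i j * of_int (x i j))
     + (\<Sum>i\<in>{1..m}. \<Sum>j\<in>{1..n}. d i j * of_int (y i j))"

text \<open>Input encoding: I 0 = m, I 1 = n; real memory holds Q (address
((i'*n+j')*m+k')*n+l' for 0-based i',j',k',l'), then c, then d (row-major).\<close>
definition init1 :: "nat \<Rightarrow> nat \<Rightarrow> (nat \<Rightarrow> nat \<Rightarrow> nat \<Rightarrow> nat \<Rightarrow> real) \<Rightarrow> (nat \<Rightarrow> nat \<Rightarrow> real)
   \<Rightarrow> (nat \<Rightarrow> nat \<Rightarrow> real) \<Rightarrow> ram_state" where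
  "init1 m n Q c d = \<lparr> pc = 0,
     imem = (\<lambda>a. if a = 0 then int m else if a = 1 then int n else 0),
     rmem = (\<lambda>a. if a < m*n*m*n then
                   Q (a div (n*m*n) + 1) (a div (m*n) mod n + 1) (a div n mod m + 1) (a mod n + 1)
                 else if a < m*n*m*n + m*n then
                   c ((a - m*n*m*n) div n + 1) ((a - m*n*m*n) mod n + 1)
                 else if a < m*n*m*n + 2*m*n then
                   d ((a - m*n*m*n - m*n) div n + 1) ((a - m*n*m*n - m*n) mod n + 1)
                 else 0) \<rparr>"

definition decode1 :: "nat \<Rightarrow> nat \<Rightarrow> ram_state \<Rightarrow> (nat \<Rightarrow> nat \<Rightarrow> int) \<times> (nat \<Rightarrow> nat \<Rightarrow> int)" where
  "decode1 m n s =
    ((\<lambda>i j. if i \<in> {1..m} \<and> j \<in> {1..n} then imem s (2 + (i-1)*n + (j-1)) else 0),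
     (\<lambda>i j. if i \<in> {1..m} \<and> j \<in> {1..n} then imem s (2 + m*n + (i-1)*n + (j-1)) else 0))"

definition out1 where
  "out1 P m n Q c d = decode1 m n (final P (init1 m n Q c d))"

definition dom_number1 :: "instr list \<Rightarrow> nat \<Rightarrow> nat \<Rightarrow> nat" where
  "dom_number1 P m n = Inf {card {(x,y). feasible1 m n x y \<and>
        f1 m n Q c d x y \<ge> f1 m n Q c d (fst (out1 P m n Q c d)) (snd (out1 P m n Q c d))}
      | Q c d. True}"

definition feasible2 :: "nat \<Rightarrow> nat \<Rightarrow> (nat \<Rightarrow> nat \<Rightarrow> int) \<Rightarrow> (nat \<Rightarrow> nat \<Rightarrow> int) \<Rightarrow> bool" where
  "feasible2 m n x y \<longleftrightarrow>
     (\<forall>i j. x i j \<in> {0,1} \<and> y i j \<in> {0,1}) \<and>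
     (\<forall>i j. \<not> (i \<in> {1..m} \<and> j \<in> {1..m}) \<longrightarrow> x i j = 0) \<and>
     (\<forall>i j. \<not> (i \<in> {1..n} \<and> j \<in> {1..n}) \<longrightarrow> y i j = 0) \<and>
     (\<forall>i\<in>{1..m}. (\<Sum>j\<in>{1..m}. x i j) = 1) \<and>
     (\<forall>j\<in>{1..n}. (\<Sum>i\<in>{1..n}. y i j) = 1)"

definition f2 :: "nat \<Rightarrow> nat \<Rightarrow> (nat \<Rightarrow> nat \<Rightarrow> nat \<Rightarrow> nat \<Rightarrow> real) \<Rightarrow> (nat \<Rightarrow> nat \<Rightarrow> real)
   \<Rightarrow> (nat \<Rightarrow> nat \<Rightarrow> real) \<Rightarrow> (nat \<Rightarrow> nat \<Rightarrow> int) \<Rightarrow> (nat \<Rightarrow> nat \<Rightarrow> int) \<Rightarrow> real" where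
  "f2 m n Q c d x y =
     (\<Sum>i\<in>{1..m}. \<Sum>j\<in>{1..m}. \<Sum>k\<in>{1..n}. \<Sum>l\<in>{1..n}. Q i j k l * of_int (x i j) * of_int (y k l))
     + (\<Sum>i\<in>{1..m}. \<Sum>j\<in>{1..m}. c i j * of_int (x i j))
     + (\<Sum>i\<in>{1..n}. \<Sum>j\<in>{1..n}. d i j * of_int (y i j))"

text \<open>Input encoding: I 0 = m, I 1 = n; real memory holds Q (address
((i'*m+j')*n+k')*n+l'), then c (m x m), then d (n x n), row-major.\<close>
definition init2 :: "nat \<Rightarrow> nat \<Rightarrow> (nat \<Rightarrow> nat \<Rightarrow> nat \<Rightarrow> nat \<Rightarrow> real) \<Rightarrow> (nat \<Rightarrow> nat \<Rightarrow> real)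
   \<Rightarrow> (nat \<Rightarrow> nat \<Rightarrow> real) \<Rightarrow> ram_state" where
  "init2 m n Q c d = \<lparr> pc = 0,
     imem = (\<lambda>a. if a = 0 then int m else if a = 1 then int n else 0),
     rmem = (\<lambda>a. if a < m*m*n*n then
                   Q (a div (m*n*n) + 1) (a div (n*n) mod m + 1) (a div n mod n + 1) (a mod n + 1)
                 else if a < m*m*n*n + m*m then
                   c ((a - m*m*n*n) div m + 1) ((a - m*m*n*n) mod m + 1)
                 else if a < m*m*n*n + m*m + n*n then
                   d ((a - m*m*n*n - m*m) div n + 1) ((a - m*m*n*n - m*m) mod n + 1)
                 else 0) \<rparr>"

definition decode2 :: "nat \<Rightarrow> nat \<Rightarrow> ram_state \<Rightarrow> (nat \<Rightarrow> nat \<Rightarrow> int) \<times> (nat \<Rightarrow> nat \<Rightarrow> int)" where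
  "decode2 m n s =
    ((\<lambda>i j. if i \<in> {1..m} \<and> j \<in> {1..m} then imem s (2 + (i-1)*m + (j-1)) else 0),
     (\<lambda>i j. if i \<in> {1..n} \<and> j \<in> {1..n} then imem s (2 + m*m + (i-1)*n + (j-1)) else 0))"

definition out2 where
  "out2 P m n Q c d = decode2 m n (final P (init2 m n Q c d))"

definition dom_number2 :: "instr list \<Rightarrow> nat \<Rightarrow> nat \<Rightarrow> nat" where
  "dom_number2 P m n = Inf {card {(x,y). feasible2 m n x y \<and>
        f2 m n Q c d x y \<ge> f2 m n Q c d (fst (out2 P m n Q c d)) (snd (out2 P m n Q c d))}
      | Q c d. True}"

end

theory Submission
  imports Defs "HOL-Library.FuncSet"
begin

text \<open>A solution of either problem is a pair of functions: one picks the column of the 1 in each row of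
\<open>x\<close>, the other the row of the 1 in each column of \<open>y\<close>. For a fixed outer function \<open>u : [p] \<rightarrow> [q]\<close> a best inner
function \<open>v : [r] \<rightarrow> [s]\<close> is found by minimizing separately at every argument. The algorithm does this for
the \<open>p q\<close> functions that equal \<open>t\<close> before \<open>i\<close> and \<open>0\<close> from \<open>i\<close> on, and returns the best pair. It thereby
dominates the \<open>p (q - 1) s\<^sup>r\<close> pairs with such a \<open>u\<close>, \<open>t > 0\<close>. The constant functions \<open>u\<close> are among those
tried, and the sum of the objective over all pairs of cyclic shifts of any \<open>(u, v)\<close> equals its sum over
all pairs of constant functions; so every class of \<open>q s\<close> shifted pairs contains a dominated one, which
gives \<open>q\<^bsup>p-1\<^esup> s\<^bsup>r-1\<^esup>\<close>. Letting \<open>y\<close> be the outer function when \<open>n \<le> m\<close> and \<open>x\<close> otherwise makes the first bound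
the larger of the two remaining terms, up to a constant factor.\<close>

subsection \<open>Structured programs\<close>

text \<open>The tried pairs must serve two bounds at once. Averaging needs the constant outer
  functions; the other bound needs about \<open>p q\<close> outer functions, each with all its inner
  ones. Step functions contain the constants at \<open>i = p\<close> and are still few. Evaluating
  one touches \<open>p r s\<close> entries of Q, so the search takes time of order
  \<open>p * (p q r s)\<close>, where \<open>p q r s = m^2 n^2\<close> in both problems and
  \<open>p\<close> is the smaller of \<open>m\<close> and \<open>n\<close>. The shift identity rests
  on the fact that a cyclic shift moves every argument through each value exactly once, just as the
  constants do. The choice of the outer function works because \<open>8 m^n \<le> 9 n^m\<close>
  (BQAP1) and \<open>m^2 n^n \<le> n^2 m^m\<close> (BQAP2) whenever
  \<open>2 \<le> n \<le> m\<close>. Much of the length is due to the machine: jumps are absolute,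
  integers cannot be multiplied, and the cells used as registers also hold input and output. Hence
  the small structured language with a timed logic, and the copying before and after the
  search.\<close>

type_synonym store = "(nat \<Rightarrow> int) \<times> (nat \<Rightarrow> real)"

datatype com =
    Block "instr list"
  | Seq com com (infixr ";;" 60)
  | IfI nat nat com com
  | IfR nat nat com com
  | WhileLt nat nat com

fun comp_len :: "com \<Rightarrow> nat" where
  "comp_len (Block is) = length is"
| "comp_len (c1 ;; c2) = comp_len c1 + comp_len c2"
| "comp_len (IfI a b c1 c2) = comp_len c1 + comp_len c2 + 2"
| "comp_len (IfR a b c1 c2) = comp_len c1 + comp_len c2 + 2"
| "comp_len (WhileLt a b c) = comp_len c + 2"

text \<open>Machine jumps are absolute, so the load address \<open>k\<close> is a parameter. The
  machine jumps on \<open>\<le>\<close>: the second branch therefore comes first in the code, and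
  \<open>WhileLt a b\<close> tests its exit condition \<open>b \<le> a\<close>.\<close>

fun compile :: "nat \<Rightarrow> com \<Rightarrow> instr list" where
  "compile k (Block is) = is"
| "compile k (c1 ;; c2) = compile k c1 @ compile (k + comp_len c1) c2"
| "compile k (IfI a b c1 c2) = JmpILe a b (k + comp_len c2 + 2) # compile (Suc k) c2
     @ Jmp (k + comp_len c2 + 2 + comp_len c1) # compile (k + comp_len c2 + 2) c1"
| "compile k (IfR a b c1 c2) = JmpRLe a b (k + comp_len c2 + 2) # compile (Suc k) c2
     @ Jmp (k + comp_len c2 + 2 + comp_len c1) # compile (k + comp_len c2 + 2) c1"
| "compile k (WhileLt a b c) = JmpILe b a (k + comp_len c + 2) # compile (Suc k) c @ [Jmp k]"

lemma length_compile [simp]: "length (compile k c) = comp_len c"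
  by (induction c arbitrary: k) auto

section \<open>Semantics and cost of structured programs\<close>

fun straight :: "instr \<Rightarrow> bool" where
  "straight (JmpILe a b t) = False"
| "straight (JmpRLe a b t) = False"
| "straight (Jmp t) = False"
| "straight Halt = False"
| "straight _ = True"

fun eff :: "instr \<Rightarrow> store \<Rightarrow> store" where
  "eff (IConst a k) (I, R) = (I(a := k), R)"
| "eff (IAdd a b c) (I, R) = (I(a := I b + I c), R)"
| "eff (ISub a b c) (I, R) = (I(a := I b - I c), R)"
| "eff (ILoad a b) (I, R) = (I(a := I (nat (I b))), R)"
| "eff (IStore a b) (I, R) = (I(nat (I a) := I b), R)"
| "eff (RConst a k) (I, R) = (I, R(a := of_int k))"
| "eff (RAdd a b c) (I, R) = (I, R(a := R b + R c))"
| "eff (RSub a b c) (I, R) = (I, R(a := R b - R c))"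
| "eff (RMul a b c) (I, R) = (I, R(a := R b * R c))"
| "eff (RDiv a b c) (I, R) = (I, R(a := R b / R c))"
| "eff (RLoad a b) (I, R) = (I, R(a := R (nat (I b))))"
| "eff (RStore a b) (I, R) = (I, R(nat (I a) := R b))"
| "eff _ s = s"

text \<open>The time index counts machine steps exactly: a branch reached by the jump costs 1 extra,
  one reached by falling through costs 2 because of its closing \<open>Jmp\<close>, and every loop
  round pays for the test and the jump back.\<close>

inductive big_step :: "com \<Rightarrow> store \<Rightarrow> nat \<Rightarrow> store \<Rightarrow> bool" where
  Block: "list_all straight is \<Longrightarrow> big_step (Block is) s (length is) (fold eff is s)"
| Seq: "big_step c1 s t1 s1 \<Longrightarrow> big_step c2 s1 t2 s2 \<Longrightarrow> big_step (c1 ;; c2) s (t1 + t2) s2"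
| IfI_le: "I a \<le> I b \<Longrightarrow> big_step c1 (I, R) t s \<Longrightarrow> big_step (IfI a b c1 c2) (I, R) (Suc t) s"
| IfI_gt: "\<not> I a \<le> I b \<Longrightarrow> big_step c2 (I, R) t s \<Longrightarrow> big_step (IfI a b c1 c2) (I, R) (t + 2) s"
| IfR_le: "R a \<le> R b \<Longrightarrow> big_step c1 (I, R) t s \<Longrightarrow> big_step (IfR a b c1 c2) (I, R) (Suc t) s"
| IfR_gt: "\<not> R a \<le> R b \<Longrightarrow> big_step c2 (I, R) t s \<Longrightarrow> big_step (IfR a b c1 c2) (I, R) (t + 2) s"
| While_done: "\<not> I a < I b \<Longrightarrow> big_step (WhileLt a b c) (I, R) 1 (I, R)"
| While_step: "I a < I b \<Longrightarrow> big_step c (I, R) t1 s1 \<Longrightarrow> big_step (WhileLt a b c) s1 t2 s2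
     \<Longrightarrow> big_step (WhileLt a b c) (I, R) (t1 + 2 + t2) s2"

definition at_pc :: "nat \<Rightarrow> store \<Rightarrow> ram_state" where
  "at_pc k s = \<lparr>pc = k, imem = fst s, rmem = snd s\<rparr>"

lemma exec_add: "exec P (t1 + t2) s = exec P t2 (exec P t1 s)"
  by (induction t1 arbitrary: s) auto

lemma exec_Suc_right: "exec P (Suc t) s = step P (exec P t s)"
  using exec_add[of P t 1 s] by simp

lemma exec_instr_straight:
  "straight i \<Longrightarrow> exec_instr i (at_pc k s) = at_pc (Suc k) (eff i s)"
  by (cases s; cases i) (auto simp: at_pc_def)

lemma step_nth:
  assumes "k < length P" "P ! k \<noteq> Halt"
  shows "step P (at_pc k s) = exec_instr (P ! k) (at_pc k s)"
  using assms by (simp add: step_def halted_def at_pc_def)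

lemma exec_straight:
  assumes "list_all straight is"
  shows "exec (pre @ is @ post) (length is) (at_pc (length pre) s)
     = at_pc (length pre + length is) (fold eff is s)"
  using assms
proof (induction "is" arbitrary: pre s)
  case (Cons i "is")
  have "i \<noteq> Halt" using Cons.prems by auto
  hence "step (pre @ (i # is) @ post) (at_pc (length pre) s) = at_pc (Suc (length pre)) (eff i s)"
    using Cons.prems by (subst step_nth) (auto simp: exec_instr_straight)
  then show ?case
    using Cons.IH[of "pre @ [i]" "eff i s"] Cons.prems by simp
qed auto

text \<open>The induction needs arbitrary surrounding code: a command inside a larger one runs with
  the instructions emitted before it moved into \<open>pre\<close> and those after it into
  \<open>post\<close>.\<close>

lemma exec_compile:
  assumes "big_step c s t s'"
  shows "exec (pre @ compile (length pre) c @ post) t (at_pc (length pre) s)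
     = at_pc (length pre + comp_len c) s'"
  using assms
proof (induction c s t s' arbitrary: pre post rule: big_step.induct)
  case (Block "is" s)
  then show ?case using exec_straight by simp
next
  case (Seq c1 s t1 s1 c2 t2 s2)
  have "exec (pre @ compile (length pre) c1 @ compile (length pre + comp_len c1) c2 @ post) t1 (at_pc (length pre) s)
      = at_pc (length pre + comp_len c1) s1"
    by (rule Seq.IH)
  moreover have "exec ((pre @ compile (length pre) c1) @ compile (length pre + comp_len c1) c2 @ post) t2
      (at_pc (length pre + comp_len c1) s1) = at_pc (length pre + comp_len c1 + comp_len c2) s2"
    using Seq.IH(2)[of "pre @ compile (length pre) c1"] by simp
  ultimately show ?case by (simp add: exec_add add.assoc)
next
  case (IfI_le I a b c1 R t s c2)
  let ?P = "pre @ compile (length pre) (IfI a b c1 c2) @ post"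
  have "step ?P (at_pc (length pre) (I, R)) = at_pc (length pre + comp_len c2 + 2) (I, R)"
    by (subst step_nth) (use IfI_le in \<open>auto simp: at_pc_def\<close>)
  then show ?case
    using IfI_le.IH[of "pre @ JmpILe a b (length pre + comp_len c2 + 2) # compile (Suc (length pre)) c2
      @ [Jmp (length pre + comp_len c2 + 2 + comp_len c1)]" post] by (simp add: algebra_simps)
next
  case (IfI_gt I a b c2 R t s c1)
  let ?P = "pre @ compile (length pre) (IfI a b c1 c2) @ post"
  have 1: "step ?P (at_pc (length pre) (I, R)) = at_pc (Suc (length pre)) (I, R)"
    by (subst step_nth) (use IfI_gt in \<open>auto simp: at_pc_def\<close>)
  have 2: "exec ?P t (at_pc (Suc (length pre)) (I, R)) = at_pc (Suc (length pre) + comp_len c2) s"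
    using IfI_gt.IH[of "pre @ [JmpILe a b (length pre + comp_len c2 + 2)]"] by simp
  have 3: "step ?P (at_pc (Suc (length pre) + comp_len c2) s)
      = at_pc (length pre + comp_len c2 + 2 + comp_len c1) s"
    by (subst step_nth) (auto simp: at_pc_def nth_append nth_Cons')
  \<comment> \<open>The test and the branch are unfolded from the front; the closing
    \<open>Jmp\<close> is the last of the \<open>t + 2\<close> steps, so
    \<open>exec_Suc_right\<close> splits it off at the end.\<close>
  have "exec ?P (Suc (Suc t)) (at_pc (length pre) (I, R)) = at_pc (length pre + comp_len c2 + 2 + comp_len c1) s"
    unfolding exec_Suc_right[of ?P "Suc t"] unfolding exec.simps 1 2 3 ..
  then show ?case by (simp add: ac_simps)
next
  case (IfR_le R a b c1 I t s c2)
  let ?P = "pre @ compile (length pre) (IfR a b c1 c2) @ post"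
  have "step ?P (at_pc (length pre) (I, R)) = at_pc (length pre + comp_len c2 + 2) (I, R)"
    by (subst step_nth) (use IfR_le in \<open>auto simp: at_pc_def\<close>)
  then show ?case
    using IfR_le.IH[of "pre @ JmpRLe a b (length pre + comp_len c2 + 2) # compile (Suc (length pre)) c2
      @ [Jmp (length pre + comp_len c2 + 2 + comp_len c1)]" post] by (simp add: algebra_simps)
next
  case (IfR_gt R a b c2 I t s c1)
  let ?P = "pre @ compile (length pre) (IfR a b c1 c2) @ post"
  have 1: "step ?P (at_pc (length pre) (I, R)) = at_pc (Suc (length pre)) (I, R)"
    by (subst step_nth) (use IfR_gt in \<open>auto simp: at_pc_def\<close>)
  have 2: "exec ?P t (at_pc (Suc (length pre)) (I, R)) = at_pc (Suc (length pre) + comp_len c2) s"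
    using IfR_gt.IH[of "pre @ [JmpRLe a b (length pre + comp_len c2 + 2)]"] by simp
  have 3: "step ?P (at_pc (Suc (length pre) + comp_len c2) s)
      = at_pc (length pre + comp_len c2 + 2 + comp_len c1) s"
    by (subst step_nth) (auto simp: at_pc_def nth_append nth_Cons')
  have "exec ?P (Suc (Suc t)) (at_pc (length pre) (I, R)) = at_pc (length pre + comp_len c2 + 2 + comp_len c1) s"
    unfolding exec_Suc_right[of ?P "Suc t"] unfolding exec.simps 1 2 3 ..
  then show ?case by (simp add: ac_simps)
next
  case (While_done I a b c R)
  let ?P = "pre @ compile (length pre) (WhileLt a b c) @ post"
  have "step ?P (at_pc (length pre) (I, R)) = at_pc (length pre + comp_len c + 2) (I, R)"
    by (subst step_nth) (use While_done in \<open>auto simp: at_pc_def\<close>)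
  then show ?case by simp
next
  case (While_step I a b c R t1 s1 t2 s2)
  let ?P = "pre @ compile (length pre) (WhileLt a b c) @ post"
  have 1: "step ?P (at_pc (length pre) (I, R)) = at_pc (Suc (length pre)) (I, R)"
    by (subst step_nth) (use While_step in \<open>auto simp: at_pc_def\<close>)
  have 2: "exec ?P t1 (at_pc (Suc (length pre)) (I, R)) = at_pc (Suc (length pre) + comp_len c) s1"
    using While_step.IH(1)[of "pre @ [JmpILe b a (length pre + comp_len c + 2)]"] by simp
  have 3: "step ?P (at_pc (Suc (length pre) + comp_len c) s1) = at_pc (length pre) s1"
    by (subst step_nth) (auto simp: at_pc_def nth_append nth_Cons')
  have "exec ?P (Suc (Suc t1)) (at_pc (length pre) (I, R)) = at_pc (length pre) s1"
    unfolding exec_Suc_right[of ?P "Suc t1"] unfolding exec.simps 1 2 3 ..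
  moreover have "t1 + 2 + t2 = Suc (Suc t1) + t2" by simp
  ultimately show ?case using While_step.IH(2)[of pre post] by (simp only: exec_add)
qed

section \<open>Time-bounded total correctness\<close>

definition ht :: "com \<Rightarrow> store \<Rightarrow> nat \<Rightarrow> (store \<Rightarrow> bool) \<Rightarrow> bool" where
  "ht c s T Q \<longleftrightarrow> (\<exists>t s'. big_step c s t s' \<and> t \<le> T \<and> Q s')"

lemma ht_conseq:
  assumes "ht c s T Q" "T \<le> T'" "\<And>s'. Q s' \<Longrightarrow> Q' s'"
  shows "ht c s T' Q'"
  using assms unfolding ht_def by (meson le_trans)

lemma ht_Block:
  assumes "list_all straight is" "length is \<le> T" "Q (fold eff is s)"
  shows "ht (Block is) s T Q"
  using assms big_step.Block unfolding ht_def by blast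

lemma ht_Seq:
  assumes "ht c1 s T1 R" "\<And>s'. R s' \<Longrightarrow> ht c2 s' T2 Q" "T1 + T2 \<le> T"
  shows "ht (c1 ;; c2) s T Q"
proof -
  obtain t1 s1 where 1: "big_step c1 s t1 s1" "t1 \<le> T1" "R s1" using assms(1) ht_def by auto
  obtain t2 s2 where 2: "big_step c2 s1 t2 s2" "t2 \<le> T2" "Q s2" using assms(2) 1(3) ht_def by metis
  have "t1 + t2 \<le> T" using 1(2) 2(2) assms(3) by linarith
  then show ?thesis unfolding ht_def using big_step.Seq[OF 1(1) 2(1)] 2(3) by blast
qed

lemma ht_Block_Seq:
  assumes "list_all straight is" "ht c (fold eff is s) T Q" "length is + T \<le> T'"
  shows "ht (Block is ;; c) s T' Q"
  by (rule ht_Seq[where R = "\<lambda>s'. s' = fold eff is s"]) (use assms in \<open>auto intro: ht_Block\<close>)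

lemma ht_IfI:
  assumes "fst s a \<le> fst s b \<Longrightarrow> ht c1 s T Q" "\<not> fst s a \<le> fst s b \<Longrightarrow> ht c2 s T Q" "T + 2 \<le> T'"
  shows "ht (IfI a b c1 c2) s T' Q"
proof (cases s)
  case (Pair I R)
  show ?thesis
  proof (cases "I a \<le> I b")
    case True
    then obtain t s' where *: "big_step c1 (I, R) t s'" "t \<le> T" "Q s'"
      using assms(1) Pair unfolding ht_def by auto
    have "Suc t \<le> T'" using *(2) assms(3) by simp
    with *(3) big_step.IfI_le[of I a b c1 R t s' c2, OF True *(1)] show ?thesis
      unfolding ht_def Pair by blast
  next
    case False
    then obtain t s' where *: "big_step c2 (I, R) t s'" "t \<le> T" "Q s'"
      using assms(2) Pair unfolding ht_def by auto
    have "t + 2 \<le> T'" using *(2) assms(3) by simp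
    with *(3) big_step.IfI_gt[of I a b c2 R t s' c1, OF False *(1)] show ?thesis
      unfolding ht_def Pair by blast
  qed
qed

lemma ht_IfR:
  assumes "snd s a \<le> snd s b \<Longrightarrow> ht c1 s T Q" "\<not> snd s a \<le> snd s b \<Longrightarrow> ht c2 s T Q" "T + 2 \<le> T'"
  shows "ht (IfR a b c1 c2) s T' Q"
proof (cases s)
  case (Pair I R)
  show ?thesis
  proof (cases "R a \<le> R b")
    case True
    then obtain t s' where *: "big_step c1 (I, R) t s'" "t \<le> T" "Q s'"
      using assms(1) Pair unfolding ht_def by auto
    have "Suc t \<le> T'" using *(2) assms(3) by simp
    with *(3) big_step.IfR_le[of R a b c1 I t s' c2, OF True *(1)] show ?thesis
      unfolding ht_def Pair by blast
  next
    case False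
    then obtain t s' where *: "big_step c2 (I, R) t s'" "t \<le> T" "Q s'"
      using assms(2) Pair unfolding ht_def by auto
    have "t + 2 \<le> T'" using *(2) assms(3) by simp
    with *(3) big_step.IfR_gt[of R a b c2 I t s' c1, OF False *(1)] show ?thesis
      unfolding ht_def Pair by blast
  qed
qed

text \<open>All loops of the program count up to a known bound, so the invariant is indexed by the
  number of completed rounds, and that index also yields termination and the time bound.\<close>

lemma ht_While:
  assumes inv: "Inv 0 s"
    and body: "\<And>k s. k < N \<Longrightarrow> Inv k s \<Longrightarrow> fst s a < fst s b \<and> ht c s T (Inv (Suc k))"
    and exit: "\<And>s. Inv N s \<Longrightarrow> \<not> fst s a < fst s b"
    and time: "N * (T + 2) + 1 \<le> T'"
  shows "ht (WhileLt a b c) s T' (Inv N)"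
proof -
  \<comment> \<open>Induction on the number \<open>d\<close> of rounds still to come, since
    \<open>big_step\<close> unfolds a loop at its first round.\<close>
  have "ht (WhileLt a b c) s (d * (T + 2) + 1) (Inv N)" if "k \<le> N" "d = N - k" "Inv k s" for k d s
    using that
  proof (induction d arbitrary: k s)
    case 0
    then have "\<not> fst s a < fst s b" using exit by simp
    then show ?case using 0 big_step.While_done[of "fst s" a b c "snd s"] unfolding ht_def
      by (intro exI[of _ "1::nat"] exI[of _ s]) auto
  next
    case (Suc d)
    then have k: "k < N" by simp
    with body Suc.prems obtain t1 s1 where 1: "fst s a < fst s b" "big_step c s t1 s1" "t1 \<le> T" "Inv (Suc k) s1"
      unfolding ht_def by metis
    have "ht (WhileLt a b c) s1 (d * (T + 2) + 1) (Inv N)"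
      by (rule Suc.IH[of "Suc k"]) (use k Suc.prems 1 in auto)
    then obtain t2 s2 where 2: "big_step (WhileLt a b c) s1 t2 s2" "t2 \<le> d * (T + 2) + 1" "Inv N s2"
      unfolding ht_def by blast
    have "big_step (WhileLt a b c) s (t1 + 2 + t2) s2"
      using big_step.While_step[of "fst s" a b c "snd s"] 1 2 by simp
    moreover have "t1 + 2 + t2 \<le> Suc d * (T + 2) + 1" using 1(3) 2(2) by simp
    ultimately show ?case unfolding ht_def using 2(3) by blast
  qed
  from this[of 0 N s] show ?thesis using inv time by (auto intro: ht_conseq)
qed

lemma halted_stable: "halted P s \<Longrightarrow> exec P t s = s"
  by (induction t) (auto simp: step_def)

text \<open>Execution ends by running past the last instruction. \<open>run_time\<close> is the
  least halting time; since halted states are fixed by \<open>step\<close>, the state at the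
  big-step time, which is not earlier, is the final one.\<close>

lemma ht_program:
  assumes "ht c s T Q"
  shows "halts (compile 0 c) (at_pc 0 s)" "run_time (compile 0 c) (at_pc 0 s) \<le> T"
    "\<exists>s'. Q s' \<and> imem (final (compile 0 c) (at_pc 0 s)) = fst s'"
proof -
  let ?P = "compile 0 c"
  obtain t s' where *: "big_step c s t s'" "t \<le> T" "Q s'" using assms ht_def by auto
  have ex: "exec ?P t (at_pc 0 s) = at_pc (comp_len c) s'"
    using exec_compile[OF *(1), of "[]" "[]"] by simp
  have h: "halted ?P (exec ?P t (at_pc 0 s))" unfolding ex by (simp add: halted_def at_pc_def)
  then show "halts ?P (at_pc 0 s)" unfolding halts_def by blast
  have le: "run_time ?P (at_pc 0 s) \<le> t" unfolding run_time_def by (rule Least_le) (rule h)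
  then show "run_time ?P (at_pc 0 s) \<le> T" using *(2) by simp
  have "halted ?P (exec ?P (run_time ?P (at_pc 0 s)) (at_pc 0 s))"
    unfolding run_time_def by (rule LeastI) (rule h)
  then have "exec ?P t (at_pc 0 s) = final ?P (at_pc 0 s)"
    using halted_stable exec_add[of ?P "run_time ?P (at_pc 0 s)" "t - run_time ?P (at_pc 0 s)"] le
    by (simp add: final_def)
  then show "\<exists>s'. Q s' \<and> imem (final ?P (at_pc 0 s)) = fst s'"
    using *(3) ex by (intro exI[of _ s']) (simp add: at_pc_def)
qed

subsection \<open>Counting dominated solutions\<close>

definition Fobj :: "nat \<Rightarrow> nat \<Rightarrow> (nat \<Rightarrow> nat \<Rightarrow> nat \<Rightarrow> nat \<Rightarrow> real) \<Rightarrow> (nat \<Rightarrow> nat \<Rightarrow> real)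
   \<Rightarrow> (nat \<Rightarrow> nat \<Rightarrow> real) \<Rightarrow> (nat \<Rightarrow> nat) \<Rightarrow> (nat \<Rightarrow> nat) \<Rightarrow> real" where
  "Fobj p r w c d u v = (\<Sum>a<p. \<Sum>b<r. w a (u a) b (v b)) + (\<Sum>a<p. c a (u a)) + (\<Sum>b<r. d b (v b))"

lemma Fobj_cong:
  assumes "\<And>a b. a < p \<Longrightarrow> b < r \<Longrightarrow> w a (u a) b (v b) = w' a (u a) b (v b)"
    "\<And>a. a < p \<Longrightarrow> c a (u a) = c' a (u a)" "\<And>b. b < r \<Longrightarrow> d b (v b) = d' b (v b)"
  shows "Fobj p r w c d u v = Fobj p r w' c' d' u v"
  using assms by (simp add: Fobj_def)

text \<open>Exchanges outer and inner function, so that one search and one counting argument serve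
  both choices of the outer function.\<close>

lemma Fobj_swap: "Fobj r p (\<lambda>b k a j. w a j b k) d c v u = Fobj p r w c d u v"
  unfolding Fobj_def by (subst sum.swap) simp

definition step_fun :: "nat \<Rightarrow> nat \<Rightarrow> nat \<Rightarrow> nat" where
  "step_fun i t a = (if a < i then t else 0)"

text \<open>Extensional functions, so that functions agreeing on the domain are counted
  once.\<close>

definition funs :: "nat \<Rightarrow> nat \<Rightarrow> (nat \<Rightarrow> nat) set" where
  "funs p q = {..<p} \<rightarrow>\<^sub>E {..<q}"

lemma card_funs: "card (funs p q) = q ^ p"
  by (simp add: funs_def card_PiE)

lemma finite_funs [simp]: "finite (funs p q)"
  by (simp add: funs_def finite_PiE)

section \<open>Cyclic shifts and averaging\<close>

lemma add_mod_cancel: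
  fixes a b :: nat
  assumes "a < q" "b < q" "(a + t) mod q = (b + t) mod q"
  shows "a = b"
proof -
  have "x = y" if "x \<le> y" "y < q" "(x + t) mod q = (y + t) mod q" for x y
  proof -
    have "q dvd (y + t) - (x + t)" using that by (subst mod_eq_dvd_iff_nat[symmetric]) auto
    then have "q dvd y - x" by simp
    then show ?thesis using that by (meson dvd_imp_le le_less_trans diff_le_self not_le zero_less_diff le_antisym)
  qed
  from this[of a b] this[of b a] show ?thesis using assms by (cases "a \<le> b") auto
qed

definition shift :: "nat \<Rightarrow> nat \<Rightarrow> nat \<Rightarrow> (nat \<Rightarrow> nat) \<Rightarrow> nat \<Rightarrow> nat" where
  "shift p q t u = (\<lambda>a\<in>{..<p}. (u a + t) mod q)"

lemma shift_in_funs: "q > 0 \<Longrightarrow> shift p q t u \<in> funs p q"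
  by (auto simp: shift_def funs_def)

lemma inj_on_shift: "inj_on (shift p q t) (funs p q)"
proof (rule inj_onI)
  fix u v assume u: "u \<in> funs p q" and v: "v \<in> funs p q" and eq: "shift p q t u = shift p q t v"
  show "u = v"
  proof (rule PiE_ext)
    show "u \<in> {..<p} \<rightarrow>\<^sub>E {..<q}" "v \<in> {..<p} \<rightarrow>\<^sub>E {..<q}" using u v by (auto simp: funs_def)
    fix a assume a: "a \<in> {..<p}"
    have "u a < q" "v a < q" using u v a by (auto simp: funs_def)
    moreover have "(u a + t) mod q = (v a + t) mod q" using fun_cong[OF eq, of a] a by (simp add: shift_def)
    ultimately show "u a = v a" by (rule add_mod_cancel)
  qed
qed

lemma sum_shift:
  fixes g :: "nat \<Rightarrow> real"
  assumes "q > 0"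
  shows "(\<Sum>t<q. g ((k + t) mod q)) = (\<Sum>t<q. g t)"
proof -
  have "bij_betw (\<lambda>t. (k + t) mod q) {..<q} {..<q}"
    unfolding bij_betw_def
  proof
    show "inj_on (\<lambda>t. (k + t) mod q) {..<q}"
      by (rule inj_onI) (auto simp: add.commute[of k] dest: add_mod_cancel)
    then show "(\<lambda>t. (k + t) mod q) ` {..<q} = {..<q}"
      using assms by (intro endo_inj_surj) auto
  qed
  then show ?thesis by (rule sum.reindex_bij_betw)
qed

text \<open>For fixed \<open>a\<close> and \<open>b\<close> the values
  \<open>(u a + \<alpha>) mod q\<close> and \<open>(v b + \<beta>) mod s\<close> run independently
  through their whole ranges, exactly as those of the constant functions do. Thus every single cost
  term, the quadratic ones included, has the same sum on both sides.\<close>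

lemma sum_Fobj_shift:
  assumes q: "q > 0" and s: "s > 0"
  shows "(\<Sum>\<alpha><q. \<Sum>\<beta><s. Fobj p r w c d (shift p q \<alpha> u) (shift r s \<beta> v))
       = (\<Sum>\<alpha><q. \<Sum>\<beta><s. Fobj p r w c d (\<lambda>_. \<alpha>) (\<lambda>_. \<beta>))"
proof -
  \<comment> \<open>Stated for arbitrary families \<open>f\<close> and \<open>g\<close>, so that it
    rewrites both sides: the shifts are summed innermost, where \<open>sum_shift\<close> applies
    term by term.\<close>
  have 1: "(\<Sum>\<alpha><q. \<Sum>\<beta><s. Fobj p r w c d (f \<alpha>) (g \<beta>))
      = (\<Sum>a<p. \<Sum>b<r. \<Sum>\<alpha><q. \<Sum>\<beta><s. w a (f \<alpha> a) b (g \<beta> b)) + s * (\<Sum>a<p. \<Sum>\<alpha><q. c a (f \<alpha> a))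
        + q * (\<Sum>b<r. \<Sum>\<beta><s. d b (g \<beta> b))" for f g
  proof -
    have "(\<Sum>\<alpha><q. \<Sum>\<beta><s. \<Sum>a<p. \<Sum>b<r. w a (f \<alpha> a) b (g \<beta> b))
      = (\<Sum>a<p. \<Sum>b<r. \<Sum>\<alpha><q. \<Sum>\<beta><s. w a (f \<alpha> a) b (g \<beta> b))"
      apply (subst (2) sum.swap, subst (1) sum.swap, rule sum.cong[OF refl])
      apply (subst (2) sum.swap, subst (1) sum.swap, rule refl)
      done
    moreover have "(\<Sum>\<alpha><q. \<Sum>a<p. c a (f \<alpha> a)) = (\<Sum>a<p. \<Sum>\<alpha><q. c a (f \<alpha> a))" by (rule sum.swap)
    moreover have "(\<Sum>\<beta><s. \<Sum>b<r. d b (g \<beta> b)) = (\<Sum>b<r. \<Sum>\<beta><s. d b (g \<beta> b))" by (rule sum.swap)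
    ultimately show ?thesis
      by (simp add: Fobj_def sum.distrib sum_distrib_left[symmetric])
  qed
  have 2: "(\<Sum>\<alpha><q. \<Sum>\<beta><s. w a (shift p q \<alpha> u a) b (shift r s \<beta> v b)) = (\<Sum>\<alpha><q. \<Sum>\<beta><s. w a \<alpha> b \<beta>)"
    if "a < p" "b < r" for a b
    using that sum_shift[OF q, of "\<lambda>t. \<Sum>\<beta><s. w a t b \<beta>" "u a"]
      sum_shift[OF s, of "\<lambda>t. w a _ b t" "v b"] by (simp add: shift_def)
  have 3: "(\<Sum>\<alpha><q. c a (shift p q \<alpha> u a)) = (\<Sum>\<alpha><q. c a \<alpha>)" if "a < p" for a
    using that sum_shift[OF q, of "c a" "u a"] by (simp add: shift_def)
  have 4: "(\<Sum>\<beta><s. d b (shift r s \<beta> v b)) = (\<Sum>\<beta><s. d b \<beta>)" if "b < r" for b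
    using that sum_shift[OF s, of "d b" "v b"] by (simp add: shift_def)
  show ?thesis unfolding 1 using 2 3 4 by simp
qed

text \<open>The value at 0 recovers \<open>t\<close>, and the first zero, if any, recovers
  \<open>i\<close>. For \<open>t = 0\<close> all these functions coincide, hence the range
  \<open>{1..<q}\<close> and the factor \<open>q - 1\<close> in the count.\<close>

lemma step_fun_inj: "inj_on (\<lambda>(i, t). restrict (step_fun i t) {..<p}) ({1..p} \<times> {1..<q})"
proof (rule inj_onI, clarify)
  fix i t j t'
  assume i: "i \<in> {1..p}" "j \<in> {1..p}" and t: "t \<in> {1..<q}" "t' \<in> {1..<q}"
    and eq: "restrict (step_fun i t) {..<p} = restrict (step_fun j t') {..<p}"
  have *: "step_fun i t a = step_fun j t' a" if "a < p" for a
    using fun_cong[OF eq, of a] that by simp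
  have "t = t'" using *[of 0] i by (auto simp: step_fun_def)
  moreover have "j \<le> i" using *[of i] i t by (cases "i < j") (auto simp: step_fun_def)
  moreover have "i \<le> j" using *[of j] i t by (cases "j < i") (auto simp: step_fun_def)
  ultimately show "i = j \<and> t = t'" by simp
qed

lemma domination_count:
  fixes z :: real
  assumes q: "q > 0" and s: "s > 0" and p: "p > 0" and r: "r > 0"
    and best: "\<And>i t v. i \<in> {1..p} \<Longrightarrow> t < q \<Longrightarrow> v \<in> {..<r} \<rightarrow> {..<s} \<Longrightarrow> z \<le> Fobj p r w c d (step_fun i t) v"
  defines "A \<equiv> {(u, v). u \<in> funs p q \<and> v \<in> funs r s \<and> z \<le> Fobj p r w c d u v}"
  shows "p * (q - 1) * s ^ r \<le> card A" "q ^ (p - 1) * s ^ (r - 1) \<le> card A"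
proof -
  have fin: "finite A" by (rule finite_subset[of _ "funs p q \<times> funs r s"]) (auto simp: A_def)
  have Fr: "Fobj p r w c d (restrict u {..<p}) v = Fobj p r w c d u v" for u v
    by (simp add: Fobj_def)
  let ?N = "(\<lambda>(i, t). restrict (step_fun i t) {..<p}) ` ({1..p} \<times> {1..<q})"
  have "?N \<times> funs r s \<subseteq> A"
    using best by (auto simp: A_def Fr funs_def PiE_def) (auto simp: step_fun_def)
  from card_mono[OF fin this] show "p * (q - 1) * s ^ r \<le> card A"
    by (simp only: card_cartesian_product card_image[OF step_fun_inj] card_funs)
      (simp only: card_atLeastAtMost card_atLeastLessThan diff_Suc_1)
  \<comment> \<open>Taking \<open>i = p\<close> makes the step function constant on the whole
    domain.\<close>
  have const: "z \<le> Fobj p r w c d (\<lambda>_. \<alpha>) (\<lambda>_. \<beta>)" if "\<alpha> < q" "\<beta> < s" for \<alpha> \<beta>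
  proof -
    have "Fobj p r w c d (step_fun p \<alpha>) (\<lambda>_. \<beta>) = Fobj p r w c d (\<lambda>_. \<alpha>) (\<lambda>_. \<beta>)"
      by (simp add: Fobj_def step_fun_def)
    then show ?thesis using best[of p \<alpha> "\<lambda>_. \<beta>"] that p by auto
  qed
  \<comment> \<open>In place of orbits: \<open>pre (\<alpha>, \<beta>)\<close> collects the pairs
    that this shift sends into \<open>A\<close>. Shifts are injective, so each of the
    \<open>q * s\<close> sets has at most \<open>card A\<close> elements, while averaging shows that
    together they cover all pairs.\<close>
  define pre where "pre = (\<lambda>(\<alpha>, \<beta>). {(u, v) \<in> funs p q \<times> funs r s. (shift p q \<alpha> u, shift r s \<beta> v) \<in> A})"
  have cover: "funs p q \<times> funs r s \<subseteq> (\<Union>ab \<in> {..<q} \<times> {..<s}. pre ab)"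
  proof clarify
    fix u v assume uv: "u \<in> funs p q" "v \<in> funs r s"
    have "\<exists>\<alpha><q. \<exists>\<beta><s. z \<le> Fobj p r w c d (shift p q \<alpha> u) (shift r s \<beta> v)"
    proof (rule ccontr)
      assume "\<not> ?thesis"
      then have "\<And>\<alpha> \<beta>. \<alpha> < q \<Longrightarrow> \<beta> < s \<Longrightarrow> Fobj p r w c d (shift p q \<alpha> u) (shift r s \<beta> v) < z"
        by fastforce
      \<comment> \<open>If every shift were below \<open>z\<close>, so would be their average, which
        equals the average over the constant pairs; but these are all at least
        \<open>z\<close>.\<close>
      then have "(\<Sum>\<alpha><q. \<Sum>\<beta><s. Fobj p r w c d (shift p q \<alpha> u) (shift r s \<beta> v)) < (\<Sum>\<alpha><q. \<Sum>\<beta><s. z)"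
        using q s by (intro sum_strict_mono) auto
      also have "\<dots> \<le> (\<Sum>\<alpha><q. \<Sum>\<beta><s. Fobj p r w c d (\<lambda>_. \<alpha>) (\<lambda>_. \<beta>))"
        by (intro sum_mono const) auto
      finally show False using sum_Fobj_shift[OF q s, of p r w c d u v] by simp
    qed
    then show "(u, v) \<in> (\<Union>ab \<in> {..<q} \<times> {..<s}. pre ab)"
      using uv q s by (auto simp: pre_def A_def shift_in_funs)
  qed
  have card_pre: "card (pre ab) \<le> card A" for ab
  proof -
    obtain \<alpha> \<beta> where ab: "ab = (\<alpha>, \<beta>)" by fastforce
    show ?thesis
    proof (rule card_inj_on_le[OF _ _ fin])
      show "inj_on (map_prod (shift p q \<alpha>) (shift r s \<beta>)) (pre ab)"
        by (rule inj_on_subset[OF map_prod_inj_on[OF inj_on_shift inj_on_shift]]) (auto simp: pre_def ab)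
      show "map_prod (shift p q \<alpha>) (shift r s \<beta>) ` pre ab \<subseteq> A" by (auto simp: pre_def ab)
    qed
  qed
  have fin_pre: "finite (pre ab)" for ab
    by (rule finite_subset[of _ "funs p q \<times> funs r s"]) (auto simp: pre_def split: prod.splits)
  have "q ^ p * s ^ r = card (funs p q \<times> funs r s)" by (simp add: card_cartesian_product card_funs)
  also have "\<dots> \<le> card (\<Union>ab \<in> {..<q} \<times> {..<s}. pre ab)"
    by (rule card_mono[OF _ cover]) (simp add: fin_pre)
  also have "\<dots> \<le> (\<Sum>ab \<in> {..<q} \<times> {..<s}. card (pre ab))" by (rule card_UN_le) auto
  also have "\<dots> \<le> (\<Sum>ab \<in> {..<q} \<times> {..<s}. card A)" by (intro sum_mono card_pre)
  also have "\<dots> = (q * s) * card A" by (simp add: card_cartesian_product)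
  finally have le: "q ^ p * s ^ r \<le> (q * s) * card A" .
  have "q ^ p = q * q ^ (p - 1)" using p by (cases p) simp_all
  moreover have "s ^ r = s * s ^ (r - 1)" using r by (cases r) simp_all
  ultimately have "(q * s) * (q ^ (p - 1) * s ^ (r - 1)) \<le> (q * s) * card A"
    using le by (metis mult.assoc mult.left_commute)
  then show "q ^ (p - 1) * s ^ (r - 1) \<le> card A" using q s by simp
qed

text \<open>Induction on \<open>m\<close> from \<open>m = n\<close>. Passing from \<open>k\<close>
  to \<open>k + 1\<close> multiplies the right side by \<open>n\<close> and the left by
  \<open>(1 + 1/k)^n \<le> exp (n/k) \<le> exp 1\<close>, which settles \<open>n \<ge> 3\<close>.
  The factor 9/8 is forced by \<open>n = 2\<close>, \<open>m = 3\<close>, where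
  \<open>m^n = 9\<close> and \<open>n^m = 8\<close>.\<close>

lemma power_swap_le:
  assumes "2 \<le> n" "n \<le> m"
  shows "8 * real m ^ n \<le> 9 * real n ^ m"
  using assms(2)
proof (induction m rule: dec_induct)
  case base
  then show ?case by simp
next
  case (step k)
  show ?case
  proof (cases "n = 2")
    case True
    show ?thesis
    proof (cases "k = 2")
      case True
      then show ?thesis using \<open>n = 2\<close> by simp
    next
      case False
      then have k: "3 \<le> real k" using step \<open>n = 2\<close> by simp
      have "(real k + 1)\<^sup>2 \<le> 2 * (real k)\<^sup>2"
      proof -
        have "3 * real k \<le> real k * real k" using k by (intro mult_right_mono) auto
        then have "1 + real k * 2 \<le> real k * real k" using k by linarith
        then show ?thesis by (simp add: power2_eq_square algebra_simps)
      qed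
      then show ?thesis using step \<open>n = 2\<close> by (simp add: add.commute)
    qed
  next
    case False
    then have n: "n \<ge> 3" using assms by simp
    have kp: "real k > 0" using step n by simp
    have "(1 + 1 / real k) ^ n \<le> exp (1 / real k) ^ n"
      by (intro power_mono exp_ge_add_one_self) auto
    also have "\<dots> = exp (real n / real k)" by (simp add: exp_of_nat_mult[symmetric])
    also have "\<dots> \<le> exp 1" using kp step by simp
    also have "\<dots> \<le> real n" using exp_le n by linarith
    finally have 1: "(1 + 1 / real k) ^ n \<le> real n" .
    have "real (Suc k) = real k * (1 + 1 / real k)" using kp by (simp add: field_simps)
    then have "8 * real (Suc k) ^ n = 8 * real k ^ n * (1 + 1 / real k) ^ n"
      by (simp add: power_mult_distrib)
    also have "\<dots> \<le> (9 * real n ^ k) * real n" by (intro mult_mono step.IH 1) auto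
    finally show ?thesis by (simp add: mult.commute)
  qed
qed

subsection \<open>The search program\<close>

text \<open>Integer cells below 64 and real cells below 5 serve as registers. They overlap the output area and the
input data, so the data is first shifted up to address \<open>vL\<close>, and the output is assembled there, each
0-1 entry in the integer cell whose address is that of the corresponding entry of \<open>c\<close> or \<open>d\<close>.\<close>

abbreviation (input) "vM \<equiv> 0 :: nat"
abbreviation (input) "vN \<equiv> Suc 0"
abbreviation (input) "vG \<equiv> 2 :: nat"
abbreviation (input) "vH \<equiv> 3 :: nat"
abbreviation (input) "vZero \<equiv> 4 :: nat"
abbreviation (input) "vOne \<equiv> 5 :: nat"
abbreviation (input) "vHN \<equiv> 6 :: nat"
abbreviation (input) "vGHN \<equiv> 7 :: nat"
abbreviation (input) "vQS \<equiv> 8 :: nat"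
abbreviation (input) "vMG \<equiv> 9 :: nat"
abbreviation (input) "vL \<equiv> 10 :: nat"
abbreviation (input) "vP \<equiv> 11 :: nat"
abbreviation (input) "vQ \<equiv> 12 :: nat"
abbreviation (input) "vSA \<equiv> 13 :: nat"
abbreviation (input) "vSB \<equiv> 14 :: nat"
abbreviation (input) "vCA \<equiv> 15 :: nat"
abbreviation (input) "vCJ \<equiv> 16 :: nat"
abbreviation (input) "vCB \<equiv> 17 :: nat"
abbreviation (input) "vR \<equiv> 18 :: nat"
abbreviation (input) "vS \<equiv> 19 :: nat"
abbreviation (input) "vSC \<equiv> 20 :: nat"
abbreviation (input) "vSD \<equiv> 21 :: nat"
abbreviation (input) "vDS \<equiv> 22 :: nat"
abbreviation (input) "vDV \<equiv> 23 :: nat"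
abbreviation (input) "vDB \<equiv> 24 :: nat"
abbreviation (input) "vI \<equiv> 25 :: nat"
abbreviation (input) "vT \<equiv> 26 :: nat"
abbreviation (input) "vTQ \<equiv> 27 :: nat"
abbreviation (input) "vTC \<equiv> 28 :: nat"
abbreviation (input) "vA \<equiv> 29 :: nat"
abbreviation (input) "vPtr \<equiv> 30 :: nat"
abbreviation (input) "vQA \<equiv> 31 :: nat"
abbreviation (input) "vB \<equiv> 32 :: nat"
abbreviation (input) "vQB \<equiv> 33 :: nat"
abbreviation (input) "vD \<equiv> 34 :: nat"
abbreviation (input) "vV \<equiv> 35 :: nat"
abbreviation (input) "vQV \<equiv> 36 :: nat"
abbreviation (input) "vDP \<equiv> 37 :: nat"
abbreviation (input) "vArg \<equiv> 38 :: nat"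
abbreviation (input) "vFlag \<equiv> 39 :: nat"
abbreviation (input) "vBestI \<equiv> 40 :: nat"
abbreviation (input) "vBestTQ \<equiv> 41 :: nat"
abbreviation (input) "vBestTC \<equiv> 42 :: nat"
abbreviation (input) "vTmp \<equiv> 43 :: nat"
abbreviation (input) "rTot \<equiv> 0 :: nat"
abbreviation (input) "rAcc \<equiv> Suc 0"
abbreviation (input) "rMin \<equiv> 2 :: nat"
abbreviation (input) "rTmp \<equiv> 3 :: nat"
abbreviation (input) "rBest \<equiv> 4 :: nat"

text \<open>With \<open>off\<close> equal to \<open>t\<close> times the stride of the value, the
  loop visits the entries of a cost array selected by \<open>step_fun i t\<close>: the branch adds
  \<open>off\<close> exactly while \<open>a < i\<close>. The flag \<open>w\<close> makes it also
  write \<open>vFlag\<close> at the visited addresses, which is how the outer function is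
  output.\<close>

definition row_sum :: "bool \<Rightarrow> nat \<Rightarrow> nat \<Rightarrow> nat \<Rightarrow> com" where
  "row_sum w str off acc =
     Block [IConst vA 0] ;;
     WhileLt vA vP
       (IfI vI vA (Block [IAdd vPtr vQA vZero]) (Block [IAdd vPtr vQA off]) ;;
        Block ([RLoad rTmp vPtr, RAdd acc acc rTmp] @ (if w then [IStore vPtr vFlag] else [])
          @ [IAdd vQA vQA str, IAdd vA vA vOne]))"

definition row_addr :: "nat \<Rightarrow> nat \<Rightarrow> nat \<Rightarrow> nat \<Rightarrow> nat \<Rightarrow> nat" where
  "row_addr base st off i a = base + a * st + (if a < i then off else 0)"

text \<open>Cells 29, 30 and 31 are \<open>vA\<close>, \<open>vPtr\<close> and \<open>vQA\<close>,
  the only integer registers changed; real cell 3 is \<open>rTmp\<close>.\<close>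

definition row_sum_post :: "bool \<Rightarrow> nat \<Rightarrow> nat \<Rightarrow> nat \<Rightarrow> nat \<Rightarrow> nat \<Rightarrow> nat \<Rightarrow> store \<Rightarrow> store \<Rightarrow> bool" where
  "row_sum_post w p i base st os acc = (\<lambda>(I, R) (I', R').
     (\<forall>x<64. x \<notin> {29, 30, 31} \<longrightarrow> I' x = I x) \<and>
     (\<forall>x\<ge>64. I' x = (if w \<and> (\<exists>a<p. x = row_addr base st os i a) then I vFlag else I x)) \<and>
     R' acc = R acc + (\<Sum>a<p. R (row_addr base st os i a)) \<and>
     (\<forall>x. x \<noteq> 3 \<longrightarrow> x \<noteq> acc \<longrightarrow> R' x = R x))"

lemma row_sum_correct:
  assumes "I vP = int p" "I vI = int i" "I vQA = int base" "I vZero = 0" "I vOne = 1"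
    and "I str = int st" "I off = int os" "str < 64" "off < 64" "str \<notin> {29, 30, 31}" "off \<notin> {29, 30, 31}"
    and "64 \<le> base" "acc \<noteq> 3" "acc < 5"
  shows "ht (row_sum w str off acc) (I, R) (10 * p + 2) (row_sum_post w p i base st os acc (I, R))"
proof -
  define Inv where "Inv = (\<lambda>k (I', R').
     (\<forall>x<64. x \<notin> {29, 30, 31} \<longrightarrow> I' x = I x) \<and>
     (\<forall>x\<ge>64. I' x = (if w \<and> (\<exists>a<k. x = row_addr base st os i a) then I vFlag else I x)) \<and>
     R' acc = R acc + (\<Sum>a<k. R (row_addr base st os i a)) \<and>
     (\<forall>x. x \<noteq> 3 \<longrightarrow> x \<noteq> acc \<longrightarrow> R' x = R x) \<and>
     I' vA = int k \<and> I' vQA = int (base + k * st))"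
  have "ht (row_sum w str off acc) (I, R) (10 * p + 2) (Inv p)"
    unfolding row_sum_def
  proof (rule ht_Block_Seq)
    show "ht (WhileLt vA vP
       (IfI vI vA (Block [IAdd vPtr vQA vZero]) (Block [IAdd vPtr vQA off]) ;;
        Block ([RLoad rTmp vPtr, RAdd acc acc rTmp] @ (if w then [IStore vPtr vFlag] else [])
          @ [IAdd vQA vQA str, IAdd vA vA vOne]))) (fold eff [IConst vA 0] (I, R)) (10 * p + 1) (Inv p)"
    \<comment> \<open>One round takes at most 3 steps for the branch and 5 for the block; with the
      loop overhead of 2 this gives 10 per entry.\<close>
    proof (rule ht_While[where T = 8])
      show "Inv 0 (fold eff [IConst vA 0] (I, R))"
        using assms(3) by (simp add: Inv_def)
    next
      fix k s assume k: "k < p" and inv: "Inv k s"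
      obtain I1 R1 where s: "s = (I1, R1)" by fastforce
      have inv': "\<forall>x<64. x \<notin> {29, 30, 31} \<longrightarrow> I1 x = I x"
        "\<forall>x\<ge>64. I1 x = (if w \<and> (\<exists>a<k. x = row_addr base st os i a) then I vFlag else I x)"
        "R1 acc = R acc + (\<Sum>a<k. R (row_addr base st os i a))"
        "\<forall>x. x \<noteq> 3 \<longrightarrow> x \<noteq> acc \<longrightarrow> R1 x = R x"
        "I1 vA = int k" "I1 vQA = int (base + k * st)"
        using inv unfolding Inv_def s prod.case by blast+
      let ?a = "row_addr base st os i k"
      \<comment> \<open>Data addresses start at 64, so storing the flag cannot hit a register, and
        the loaded value is not one of the scratch reals.\<close>
      have a: "?a \<ge> 64" using assms(12) by (simp add: row_addr_def)
      have Ra: "R1 ?a = R ?a" using inv'(4) a assms(14) by simp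
      have regs: "I1 vZero = 0" "I1 vOne = 1" "I1 str = int st" "I1 off = int os" "I1 vI = int i"
        "I1 vP = int p" "I1 vFlag = I vFlag"
        using inv'(1) assms(1,2,4-11) by simp_all
      have neq: "str \<noteq> ?a" "str \<noteq> 30" "str \<noteq> 31" "str \<noteq> 29" "?a \<noteq> 29" "?a \<noteq> 30" "?a \<noteq> 31" "?a \<noteq> 5"
        using assms(8-11) a by auto
      have "ht (IfI vI vA (Block [IAdd vPtr vQA vZero]) (Block [IAdd vPtr vQA off]) ;;
        Block ([RLoad rTmp vPtr, RAdd acc acc rTmp] @ (if w then [IStore vPtr vFlag] else [])
          @ [IAdd vQA vQA str, IAdd vA vA vOne])) s 8 (Inv (Suc k))"
      proof (rule ht_Seq[where R = "\<lambda>s'. s' = (I1(vPtr := int ?a), R1)" and ?T1.0 = 3 and ?T2.0 = 5])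
        show "ht (IfI vI vA (Block [IAdd vPtr vQA vZero]) (Block [IAdd vPtr vQA off])) s 3
          (\<lambda>s'. s' = (I1(vPtr := int ?a), R1))"
          unfolding s using inv'(5,6) regs
          by (intro ht_IfI[where T = 1] ht_Block) (simp_all add: row_addr_def)
      next
        fix s' assume s': "s' = (I1(vPtr := int ?a), R1)"
        show "ht (Block ([RLoad rTmp vPtr, RAdd acc acc rTmp] @ (if w then [IStore vPtr vFlag] else [])
          @ [IAdd vQA vQA str, IAdd vA vA vOne])) s' 5 (Inv (Suc k))"
        proof (rule ht_Block)
          define J where "J = (if w then I1(vPtr := int ?a, ?a := I vFlag) else I1(vPtr := int ?a))"
          have "fold eff ([RLoad rTmp vPtr, RAdd acc acc rTmp] @ (if w then [IStore vPtr vFlag] else [])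
              @ [IAdd vQA vQA str, IAdd vA vA vOne]) s'
            = (J(vQA := int (base + Suc k * st), vA := int (Suc k)), R1(rTmp := R ?a, acc := R1 acc + R ?a))"
            unfolding s' J_def using regs neq Ra inv'(5,6) assms(13) by (cases w) (simp_all add: algebra_simps)
          moreover have "\<forall>x<64. x \<notin> {29, 30, 31} \<longrightarrow> J x = I x"
            using inv'(1) a by (simp add: J_def)
          moreover have "\<forall>x\<ge>64. J x = (if w \<and> (\<exists>a<Suc k. x = row_addr base st os i a) then I vFlag else I x)"
            using inv'(2) a unfolding J_def less_Suc_eq by (cases w) auto
          moreover have "R1 acc + R ?a = R acc + (\<Sum>a<Suc k. R (row_addr base st os i a))"
            using inv'(3) by simp
          ultimately show "Inv (Suc k) (fold eff ([RLoad rTmp vPtr, RAdd acc acc rTmp]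
              @ (if w then [IStore vPtr vFlag] else []) @ [IAdd vQA vQA str, IAdd vA vA vOne]) s')"
            using inv'(4) assms(13) unfolding Inv_def by simp
        qed simp_all
      qed simp
      then show "fst s vA < fst s vP \<and> ht (IfI vI vA (Block [IAdd vPtr vQA vZero]) (Block [IAdd vPtr vQA off]) ;;
        Block ([RLoad rTmp vPtr, RAdd acc acc rTmp] @ (if w then [IStore vPtr vFlag] else [])
          @ [IAdd vQA vQA str, IAdd vA vA vOne])) s 8 (Inv (Suc k))"
        using k inv'(5) regs(6) by (simp add: s)
    next
      fix s assume "Inv p s"
      then show "\<not> fst s vA < fst s vP" using assms(1) by (cases s) (simp add: Inv_def)
    qed simp
  qed auto
  then show ?thesis
  proof (rule ht_conseq)
    fix s' assume "Inv p s'"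
    then show "row_sum_post w p i base st os acc (I, R) s'"
      unfolding Inv_def row_sum_post_def by (cases s') (simp only: prod.case, blast)
  qed simp
qed

text \<open>Pointers are never 0, so \<open>vArg = 0\<close> marks that no candidate has been seen.
\<open>RLoad rMin vOne\<close> copies \<open>rAcc\<close>, which is real cell 1.\<close>

definition min_step :: com where
  "min_step =
     Block [IConst vArg 0, IAdd vQV vQB vZero, IAdd vDP vD vZero, IConst vV 0] ;;
     WhileLt vV vS
       (Block [RLoad rAcc vDP, IAdd vQA vQV vZero] ;;
        row_sum False vSA vTQ rAcc ;;
        IfI vArg vZero (Block [RLoad rMin vOne]) (Block []) ;;
        IfR rAcc rMin (Block [RLoad rMin vOne, IAdd vArg vDP vZero]) (Block []) ;;
        Block [IAdd vQV vQV vSD, IAdd vDP vDP vDV, IAdd vV vV vOne])"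

text \<open>The 1s of the current pair are written as \<open>vFlag\<close>: with \<open>vFlag = 0\<close> this leaves the zeroed output
cells intact during the search, with \<open>vFlag = 1\<close> it writes the solution.\<close>

definition eval_step :: com where
  "eval_step =
     Block [RConst rTot 0, IAdd vQA vCB vZero] ;;
     row_sum True vCA vTC rTot ;;
     Block [IAdd vQB vL vZero, IAdd vD vDB vZero, IConst vB 0] ;;
     WhileLt vB vR
       (min_step ;;
        Block [RAdd rTot rTot rMin, IStore vArg vFlag, IAdd vQB vQB vSC, IAdd vD vD vDS, IAdd vB vB vOne])"

text \<open>Since \<open>i\<close> runs from 1, \<open>vBestI = 0\<close> marks that there is no
  incumbent yet. The value of the first candidate is then copied to \<open>rBest\<close>, so that
  the comparison which follows accepts it. \<open>RLoad rBest vZero\<close> reads real cell 0, which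
  is \<open>rTot\<close>.\<close>

definition search_step :: com where
  "search_step =
     eval_step ;;
     IfI vBestI vZero (Block [RLoad rBest vZero]) (Block []) ;;
     IfR rTot rBest
       (Block [RLoad rBest vZero, IAdd vBestI vI vZero, IAdd vBestTQ vTQ vZero, IAdd vBestTC vTC vZero])
       (Block []) ;;
     Block [IAdd vTQ vTQ vSB, IAdd vTC vTC vCJ, IAdd vT vT vOne]"

text \<open>Only the outer function of the incumbent is kept, as \<open>i\<close> and two address
  offsets; its best reply is computed again at the end.\<close>

definition search :: com where
  "search =
     Block [IConst vBestI 0, IConst vFlag 0, IConst vI 0] ;;
     WhileLt vI vP
       (Block [IAdd vI vI vOne, IConst vT 0, IConst vTQ 0, IConst vTC 0] ;;
        WhileLt vT vQ search_step) ;;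
     Block [IAdd vI vBestI vZero, IAdd vTQ vBestTQ vZero, IAdd vTC vBestTC vZero, IConst vFlag 1] ;;
     eval_step"

text \<open>The outer function maps \<open>[p]\<close> to \<open>[q]\<close>, the inner one \<open>[r]\<close> to \<open>[s]\<close>. The entry of \<open>Q\<close> for \<open>(a, j, b, k)\<close>
is at \<open>L + a SA + j SB + b SC + k SD\<close>, the linear costs at \<open>CB + a CA + j CJ\<close> and \<open>DB + b DS + k DV\<close>.\<close>

locale layout =
  fixes p q r s SA SB CA CJ CB SC SD DS DV DB L :: nat
  assumes pos: "0 < p" "0 < q" "0 < r" "0 < s"
    and bounds: "64 \<le> L" "64 \<le> CB" "64 \<le> DB"
begin

definition regs :: "(nat \<Rightarrow> int) \<Rightarrow> bool" where
  "regs I \<longleftrightarrow> I vZero = 0 \<and> I vOne = 1 \<and> I vL = int L \<and> I vP = int p \<and> I vQ = int q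
     \<and> I vSA = int SA \<and> I vSB = int SB \<and> I vCA = int CA \<and> I vCJ = int CJ \<and> I vCB = int CB
     \<and> I vR = int r \<and> I vS = int s \<and> I vSC = int SC \<and> I vSD = int SD
     \<and> I vDS = int DS \<and> I vDV = int DV \<and> I vDB = int DB"

definition c_addr :: "nat \<Rightarrow> nat \<Rightarrow> nat \<Rightarrow> nat" where
  "c_addr i oc a = row_addr CB CA oc i a"

definition d_addr :: "nat \<Rightarrow> nat \<Rightarrow> nat" where
  "d_addr b v = DB + b * DS + v * DV"

definition c_part :: "(nat \<Rightarrow> real) \<Rightarrow> nat \<Rightarrow> nat \<Rightarrow> real" where
  "c_part R i oc = (\<Sum>a<p. R (c_addr i oc a))"

text \<open>All of the objective that depends on the value \<open>v\<close> at the inner argument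
  \<open>b\<close>. Given the outer function, the objective is \<open>c_part\<close> plus one such
  term for every \<open>b\<close>, which is why the arguments can be minimized separately.\<close>

definition d_part :: "(nat \<Rightarrow> real) \<Rightarrow> nat \<Rightarrow> nat \<Rightarrow> nat \<Rightarrow> nat \<Rightarrow> real" where
  "d_part R i oq b v = R (d_addr b v) + (\<Sum>a<p. R (row_addr (L + b * SC + v * SD) SA oq i a))"

lemma addr_ge: "64 \<le> c_addr i oc a" "64 \<le> d_addr b v"
  "64 \<le> row_addr (L + x + y) st os i a"
  using bounds by (simp_all add: c_addr_def d_addr_def row_addr_def)

lemma part_cong:
  assumes "\<And>x. 64 \<le> x \<Longrightarrow> R' x = R x"
  shows "c_part R' = c_part R" "d_part R' = d_part R"
  using assms addr_ge by (simp_all add: c_part_def d_part_def fun_eq_iff)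

section \<open>Minimization at one inner argument\<close>

definition best_reply :: "(nat \<Rightarrow> real) \<Rightarrow> nat \<Rightarrow> nat \<Rightarrow> nat \<Rightarrow> (nat \<Rightarrow> nat) \<Rightarrow> bool" where
  "best_reply R i oq k w \<longleftrightarrow>
     (\<forall>b<k. w b < s \<and> (\<forall>v<s. d_part R i oq b (w b) \<le> d_part R i oq b v))"

text \<open>Besides the registers of \<open>row_sum\<close>, cells 35 to 38 (\<open>vV\<close>,
  \<open>vQV\<close>, \<open>vDP\<close>, \<open>vArg\<close>) and the real cells 1 to 3 are
  scratch. The minimizer is recorded only by the address of its linear cost, which is also where its
  1 is to be written.\<close>

definition min_post :: "nat \<Rightarrow> nat \<Rightarrow> nat \<Rightarrow> store \<Rightarrow> store \<Rightarrow> bool" where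
  "min_post i oq b = (\<lambda>(I, R) (I', R').
     (\<forall>x<64. x \<notin> {29, 30, 31, 35, 36, 37, 38} \<longrightarrow> I' x = I x) \<and>
     (\<forall>x\<ge>64. I' x = I x) \<and> (\<forall>x. x \<notin> {1, 2, 3} \<longrightarrow> R' x = R x) \<and>
     (\<exists>w<s. I' vArg = int (d_addr b w) \<and> R' rMin = d_part R i oq b w \<and>
        (\<forall>v<s. d_part R i oq b w \<le> d_part R i oq b v)))"

lemma min_step_correct:
  assumes I: "regs I" "I vI = int i" "I vTQ = int oq"
    "I vQB = int (L + b * SC)" "I vD = int (d_addr b 0)"
  shows "ht min_step (I, R) (s * (10 * p + 16) + 5) (min_post i oq b (I, R))"
proof -
  \<comment> \<open>Before the first candidate only the mark \<open>vArg = 0\<close> is known and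
    \<open>rMin\<close> is arbitrary, hence the separate case \<open>k = 0\<close>.\<close>
  define Inv where "Inv = (\<lambda>k (I', R').
     (\<forall>x<64. x \<notin> {29, 30, 31, 35, 36, 37, 38} \<longrightarrow> I' x = I x) \<and>
     (\<forall>x\<ge>64. I' x = I x) \<and> (\<forall>x. x \<notin> {1, 2, 3} \<longrightarrow> R' x = R x) \<and>
     I' vV = int k \<and> I' vQV = int (L + b * SC + k * SD) \<and> I' vDP = int (d_addr b k) \<and>
     (if k = 0 then I' vArg = 0 else
        \<exists>w<k. I' vArg = int (d_addr b w) \<and> R' rMin = d_part R i oq b w \<and>
           (\<forall>v<k. d_part R i oq b w \<le> d_part R i oq b v)))"
  note r = I[unfolded regs_def]
  let ?body = "Block [RLoad rAcc vDP, IAdd vQA vQV vZero] ;;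
           row_sum False vSA vTQ rAcc ;;
           IfI vArg vZero (Block [RLoad rMin vOne]) (Block []) ;;
           IfR rAcc rMin (Block [RLoad rMin vOne, IAdd vArg vDP vZero]) (Block []) ;;
           Block [IAdd vQV vQV vSD, IAdd vDP vDP vDV, IAdd vV vV vOne]"
  have step: "ht ?body (I1, R1) (10 * p + 14) (Inv (Suc k))" if k: "k < s" and inv: "Inv k (I1, R1)" for k I1 R1
  proof (rule ht_Block_Seq)
    have inv': "\<forall>x<64. x \<notin> {29, 30, 31, 35, 36, 37, 38} \<longrightarrow> I1 x = I x"
      "\<forall>x\<ge>64. I1 x = I x" "\<forall>x. x \<notin> {1, 2, 3} \<longrightarrow> R1 x = R x"
      "I1 vV = int k" "I1 vQV = int (L + b * SC + k * SD)" "I1 vDP = int (d_addr b k)"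
      using inv by (simp_all add: Inv_def)
    have arg: "if k = 0 then I1 vArg = 0 else
        \<exists>w<k. I1 vArg = int (d_addr b w) \<and> R1 rMin = d_part R i oq b w \<and>
           (\<forall>v<k. d_part R i oq b w \<le> d_part R i oq b v)"
      using inv unfolding Inv_def prod.case by (elim conjE)
    have R1: "R1 x = R x" if "64 \<le> x" for x using inv'(3) that by simp
    have r1: "I1 vZero = 0" "I1 vOne = 1" "I1 vP = int p" "I1 vI = int i" "I1 vSA = int SA" "I1 vTQ = int oq"
      "I1 vSD = int SD" "I1 vDV = int DV" "I1 vS = int s"
      using inv'(1) r by simp_all
    define I2 where "I2 = I1(vQA := int (L + b * SC + k * SD))"
    define R2 where "R2 = R1(rAcc := R (d_addr b k))"
    let ?rest = "IfI vArg vZero (Block [RLoad rMin vOne]) (Block []) ;;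
           IfR rAcc rMin (Block [RLoad rMin vOne, IAdd vArg vDP vZero]) (Block []) ;;
           Block [IAdd vQV vQV vSD, IAdd vDP vDP vDV, IAdd vV vV vOne]"
    have eq: "fold eff [RLoad rAcc vDP, IAdd vQA vQV vZero] (I1, R1) = (I2, R2)"
      using inv'(5,6) r1 R1 addr_ge(2) by (simp add: I2_def R2_def)
    show "ht (row_sum False vSA vTQ rAcc ;; ?rest) (fold eff [RLoad rAcc vDP, IAdd vQA vQV vZero] (I1, R1))
       (10 * p + 12) (Inv (Suc k))"
      unfolding eq
    proof (rule ht_Seq)
      show "ht (row_sum False vSA vTQ rAcc) (I2, R2) (10 * p + 2)
          (row_sum_post False p i (L + b * SC + k * SD) SA oq rAcc (I2, R2))"
        by (rule row_sum_correct) (use r1 bounds in \<open>simp_all add: I2_def\<close>)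
    next
      fix s' assume post: "row_sum_post False p i (L + b * SC + k * SD) SA oq rAcc (I2, R2) s'"
      obtain I3 R3 where s': "s' = (I3, R3)" by fastforce
      have 3: "\<forall>x<64. x \<notin> {29, 30, 31} \<longrightarrow> I3 x = I2 x" "\<forall>x\<ge>64. I3 x = I2 x"
        "R3 rAcc = R2 rAcc + (\<Sum>a<p. R2 (row_addr (L + b * SC + k * SD) SA oq i a))"
        "\<forall>x. x \<noteq> 3 \<longrightarrow> x \<noteq> rAcc \<longrightarrow> R3 x = R2 x"
        using post by (simp_all add: row_sum_post_def s')
      have acc: "R3 rAcc = d_part R i oq b k"
      proof -
        have "R2 (row_addr (L + b * SC + k * SD) SA oq i a) = R (row_addr (L + b * SC + k * SD) SA oq i a)" for a
          using R1[OF addr_ge(3)] addr_ge(3)[of "b * SC" "k * SD" SA oq i a] by (auto simp: R2_def)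
        then show ?thesis unfolding 3(3) by (simp add: d_part_def R2_def)
      qed
      have I3: "\<forall>x<64. x \<notin> {29, 30, 31, 35, 36, 37, 38} \<longrightarrow> I3 x = I x" "\<forall>x\<ge>64. I3 x = I x"
        "I3 vV = int k" "I3 vQV = int (L + b * SC + k * SD)" "I3 vDP = int (d_addr b k)" "I3 vArg = I1 vArg"
        using 3(1,2) inv' by (simp_all add: I2_def)
      have R3: "\<forall>x. x \<notin> {1, 2, 3} \<longrightarrow> R3 x = R x" "R3 rMin = R1 rMin"
        using 3(4) inv'(3) by (simp_all add: R2_def)
      have r3: "I3 vZero = 0" "I3 vOne = 1" "I3 vSD = int SD" "I3 vDV = int DV"
        using I3(1) r by simp_all
      have d_pos: "d_addr b v \<noteq> 0" for v using addr_ge(2)[of b v] by linarith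
      have d_Suc: "d_addr b k + DV = d_addr b (Suc k)" by (simp add: d_addr_def)
      show "ht ?rest s' 10 (Inv (Suc k))"
      proof (rule ht_Seq[where ?T1.0 = 3 and ?T2.0 = 7 and
            R = "\<lambda>s'. s' = (I3, if k = 0 then R3(rMin := d_part R i oq b k) else R3)"])
        show "ht (IfI vArg vZero (Block [RLoad rMin vOne]) (Block [])) s' 3
          (\<lambda>s'. s' = (I3, if k = 0 then R3(rMin := d_part R i oq b k) else R3))"
          unfolding s'
        proof (rule ht_IfI[where T = 1])
          assume le: "fst (I3, R3) vArg \<le> fst (I3, R3) vZero"
          have "k = 0"
          proof (rule ccontr)
            assume "k \<noteq> 0"
            then obtain w where "I1 vArg = int (d_addr b w)" using arg by auto
            then show False using le r3(1) I3(6) d_pos[of w] by simp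
          qed
          then show "ht (Block [RLoad rMin vOne]) (I3, R3) 1 (\<lambda>s'. s' = (I3, if k = 0 then R3(rMin := d_part R i oq b k) else R3))"
            using r3 acc by (intro ht_Block) auto
        next
          assume "\<not> fst (I3, R3) vArg \<le> fst (I3, R3) vZero"
          then have "k \<noteq> 0" using arg r3(1) by (auto simp: I3(6) split: if_splits)
          then show "ht (Block []) (I3, R3) 1 (\<lambda>s'. s' = (I3, if k = 0 then R3(rMin := d_part R i oq b k) else R3))"
            by (intro ht_Block) auto
        qed simp
      next
        fix s' assume s': "s' = (I3, if k = 0 then R3(rMin := d_part R i oq b k) else R3)"
        \<comment> \<open>On the first candidate \<open>rMin\<close> is made equal to
          \<open>rAcc\<close>; the comparison then succeeds and sets \<open>vArg\<close>, so the
          general update also does the initialization.\<close>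
        define R4 where "R4 = (if k = 0 then R3(rMin := d_part R i oq b k) else R3)"
        have R4: "\<forall>x. x \<notin> {1, 2, 3} \<longrightarrow> R4 x = R x" "R4 rAcc = d_part R i oq b k"
          using R3 acc by (simp_all add: R4_def)
        have R4_min: "if k = 0 then R4 rMin = d_part R i oq b k else
            \<exists>w<k. I3 vArg = int (d_addr b w) \<and> R4 rMin = d_part R i oq b w \<and>
               (\<forall>v<k. d_part R i oq b w \<le> d_part R i oq b v)"
          using arg by (simp add: R4_def I3(6) R3(2))
        define Post where "Post = (\<lambda>(I', R').
          (\<forall>x<64. x \<notin> {29, 30, 31, 35, 36, 37, 38} \<longrightarrow> I' x = I x) \<and> (\<forall>x\<ge>64. I' x = I x) \<and>
          (\<forall>x. x \<notin> {1, 2, 3} \<longrightarrow> R' x = R x) \<and>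
          I' vV = int k \<and> I' vQV = int (L + b * SC + k * SD) \<and> I' vDP = int (d_addr b k) \<and>
          (\<exists>w<Suc k. I' vArg = int (d_addr b w) \<and> R' rMin = d_part R i oq b w \<and>
            (\<forall>v<Suc k. d_part R i oq b w \<le> d_part R i oq b v)))"
        show "ht (IfR rAcc rMin (Block [RLoad rMin vOne, IAdd vArg vDP vZero]) (Block []) ;;
           Block [IAdd vQV vQV vSD, IAdd vDP vDP vDV, IAdd vV vV vOne]) s' 7 (Inv (Suc k))"
          unfolding s' R4_def[symmetric]
        proof (rule ht_Seq[where ?T1.0 = 4 and ?T2.0 = 3 and R = Post])
          show "ht (IfR rAcc rMin (Block [RLoad rMin vOne, IAdd vArg vDP vZero]) (Block [])) (I3, R4) 4 Post"
          proof (rule ht_IfR[where T = 2])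
            assume le: "snd (I3, R4) rAcc \<le> snd (I3, R4) rMin"
            have "fold eff [RLoad rMin vOne, IAdd vArg vDP vZero] (I3, R4) =
              (I3(vArg := int (d_addr b k)), R4(rMin := d_part R i oq b k))"
              using r3 I3 R4 by simp
            moreover have "\<forall>v<Suc k. d_part R i oq b k \<le> d_part R i oq b v"
              using le R4_min R4(2) by (auto simp: less_Suc_eq split: if_splits intro: order_trans)
            ultimately show "ht (Block [RLoad rMin vOne, IAdd vArg vDP vZero]) (I3, R4) 2 Post"
              using I3 R4 by (intro ht_Block) (simp, simp, simp add: Post_def, blast)
          next
            assume le: "\<not> snd (I3, R4) rAcc \<le> snd (I3, R4) rMin"
            then have "k \<noteq> 0" using R4_min R4(2) by (cases "k = 0") auto
            then obtain w where "w < k" "I3 vArg = int (d_addr b w)" "R4 rMin = d_part R i oq b w"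
               "\<forall>v<k. d_part R i oq b w \<le> d_part R i oq b v" using R4_min by auto
            then have "\<exists>w<Suc k. I3 vArg = int (d_addr b w) \<and> R4 rMin = d_part R i oq b w \<and>
               (\<forall>v<Suc k. d_part R i oq b w \<le> d_part R i oq b v)"
              using le R4(2) by (intro exI[of _ w]) (auto simp: less_Suc_eq)
            then show "ht (Block []) (I3, R4) 2 Post"
              using I3 R4 by (intro ht_Block) (simp, simp, simp add: Post_def)
          qed simp
        next
          fix s' assume "Post s'"
          then obtain I5 R5 where s': "s' = (I5, R5)" and 5:
            "\<forall>x<64. x \<notin> {29, 30, 31, 35, 36, 37, 38} \<longrightarrow> I5 x = I x" "\<forall>x\<ge>64. I5 x = I x"
            "\<forall>x. x \<notin> {1, 2, 3} \<longrightarrow> R5 x = R x"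
            "I5 vV = int k" "I5 vQV = int (L + b * SC + k * SD)" "I5 vDP = int (d_addr b k)"
            "\<exists>w<Suc k. I5 vArg = int (d_addr b w) \<and> R5 rMin = d_part R i oq b w \<and>
              (\<forall>v<Suc k. d_part R i oq b w \<le> d_part R i oq b v)"
            by (cases s') (auto simp: Post_def)
          have r5: "I5 vSD = int SD" "I5 vDV = int DV" "I5 vOne = 1" using 5(1) r by simp_all
          have "fold eff [IAdd vQV vQV vSD, IAdd vDP vDP vDV, IAdd vV vV vOne] (I5, R5) =
            (I5(vQV := int (L + b * SC + Suc k * SD), vDP := int (d_addr b (Suc k)), vV := int (Suc k)), R5)"
            using 5(4-6) r5 by (simp add: d_Suc[symmetric] algebra_simps)
          then show "ht (Block [IAdd vQV vQV vSD, IAdd vDP vDP vDV, IAdd vV vV vOne]) s' 3 (Inv (Suc k))"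
            unfolding s' using 5 by (intro ht_Block) (simp, simp, simp add: Inv_def algebra_simps)
        qed simp
      qed simp
    qed simp
  qed simp_all
  show ?thesis
    unfolding min_step_def
  proof (rule ht_Block_Seq)
    show "ht (WhileLt vV vS ?body) (fold eff [IConst vArg 0, IAdd vQV vQB vZero, IAdd vDP vD vZero, IConst vV 0] (I, R))
      (s * (10 * p + 16) + 1) (min_post i oq b (I, R))"
    proof (rule ht_conseq[OF ht_While[where Inv = Inv and N = s and T = "10 * p + 14" and T' = "s * (10 * p + 16) + 1"]])
      show "Inv 0 (fold eff [IConst vArg 0, IAdd vQV vQB vZero, IAdd vDP vD vZero, IConst vV 0] (I, R))"
        using I r by (simp add: Inv_def)
    next
      fix k st assume k: "k < s" and inv: "Inv k st"
      then show "fst st vV < fst st vS \<and> ht ?body st (10 * p + 14) (Inv (Suc k))"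
        using step[of k "fst st" "snd st"] r by (cases st) (simp add: Inv_def)
    next
      fix st assume "Inv s st"
      then show "\<not> fst st vV < fst st vS" using r by (cases st) (simp add: Inv_def)
    next
      fix st assume "Inv s st"
      \<comment> \<open>Since \<open>s > 0\<close>, the invariant after the last round is in its
        second case and supplies a minimizer.\<close>
      then show "min_post i oq b (I, R) st" using pos by (cases st) (simp add: Inv_def min_post_def)
    qed simp_all
  qed simp_all
qed

section \<open>Evaluation of one outer function\<close>

definition eval_post :: "nat \<Rightarrow> nat \<Rightarrow> nat \<Rightarrow> store \<Rightarrow> store \<Rightarrow> bool" where
  "eval_post i oq oc = (\<lambda>(I, R) (I', R').
     (\<forall>x<64. x < 29 \<or> 38 < x \<longrightarrow> I' x = I x) \<and> (\<forall>x\<ge>4. R' x = R x) \<and>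
     (\<exists>w. best_reply R i oq r w \<and> R' rTot = c_part R i oc + (\<Sum>b<r. d_part R i oq b (w b)) \<and>
        (\<forall>x\<ge>64. I' x = (if (\<exists>a<p. x = c_addr i oc a) \<or> (\<exists>b<r. x = d_addr b (w b))
           then I vFlag else I x))))"

text \<open>Each of the \<open>r\<close> rounds costs \<open>s * (10 * p + 16) + 5\<close> for the
  minimization, 5 for the update and 2 for the loop. The witness \<open>w\<close> is extended in
  each round by the minimizer found.\<close>

lemma eval_step_correct:
  assumes I: "regs I" "I vI = int i" "I vTQ = int oq" "I vTC = int oc"
  shows "ht eval_step (I, R) (10 * p + r * (s * (10 * p + 16) + 12) + 8) (eval_post i oq oc (I, R))"
proof -
  define Inv where "Inv = (\<lambda>k (I', R').
     (\<forall>x<64. x < 29 \<or> 38 < x \<longrightarrow> I' x = I x) \<and> (\<forall>x\<ge>4. R' x = R x) \<and>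
     I' vB = int k \<and> I' vQB = int (L + k * SC) \<and> I' vD = int (d_addr k 0) \<and>
     (\<exists>w. best_reply R i oq k w \<and> R' rTot = c_part R i oc + (\<Sum>b<k. d_part R i oq b (w b)) \<and>
        (\<forall>x\<ge>64. I' x = (if (\<exists>a<p. x = c_addr i oc a) \<or> (\<exists>b<k. x = d_addr b (w b))
           then I vFlag else I x))))"
  note r = I[unfolded regs_def]
  let ?upd = "[RAdd rTot rTot rMin, IStore vArg vFlag, IAdd vQB vQB vSC, IAdd vD vD vDS, IAdd vB vB vOne]"
  have step: "ht (min_step ;; Block ?upd) (I1, R1) (s * (10 * p + 16) + 10) (Inv (Suc k))"
    if k: "k < r" and inv: "Inv k (I1, R1)" for k I1 R1
  proof (rule ht_Seq)
    have inv': "\<forall>x<64. x < 29 \<or> 38 < x \<longrightarrow> I1 x = I x" "\<forall>x\<ge>4. R1 x = R x"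
      "I1 vB = int k" "I1 vQB = int (L + k * SC)" "I1 vD = int (d_addr k 0)"
      using inv unfolding Inv_def prod.case by blast+
    obtain w where w: "best_reply R i oq k w" "R1 rTot = c_part R i oc + (\<Sum>b<k. d_part R i oq b (w b))"
      "\<forall>x\<ge>64. I1 x = (if (\<exists>a<p. x = c_addr i oc a) \<or> (\<exists>b<k. x = d_addr b (w b)) then I vFlag else I x)"
      using inv unfolding Inv_def prod.case by (elim conjE exE)
    have regs1: "regs I1" using I(1) inv'(1) by (simp add: regs_def)
    have R1: "c_part R1 = c_part R" "d_part R1 = d_part R"
      using inv'(2) by (intro part_cong; simp)+
    show "ht min_step (I1, R1) (s * (10 * p + 16) + 5) (min_post i oq k (I1, R1))"
      by (rule min_step_correct) (use regs1 inv' r in simp_all)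
    fix s' assume post: "min_post i oq k (I1, R1) s'"
    obtain I2 R2 where s': "s' = (I2, R2)" by fastforce
    have 2: "\<forall>x<64. x \<notin> {29, 30, 31, 35, 36, 37, 38} \<longrightarrow> I2 x = I1 x" "\<forall>x\<ge>64. I2 x = I1 x"
      "\<forall>x. x \<notin> {1, 2, 3} \<longrightarrow> R2 x = R1 x"
      using post unfolding min_post_def prod.case s' by blast+
    obtain v where v: "v < s" "I2 vArg = int (d_addr k v)" "R2 rMin = d_part R i oq k v"
      "\<forall>u<s. d_part R i oq k v \<le> d_part R i oq k u"
      using post unfolding min_post_def prod.case s' R1 by (elim conjE exE)
    have r2: "I2 vFlag = I vFlag" "I2 vSC = int SC" "I2 vDS = int DS" "I2 vOne = 1"
      "I2 vB = int k" "I2 vQB = int (L + k * SC)" "I2 vD = int (d_addr k 0)"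
      using 2(1) inv' r by simp_all
    define w' where "w' = w(k := v)"
    have ge: "64 \<le> d_addr k v" by (rule addr_ge)
    have d_Suc: "d_addr k 0 + DS = d_addr (Suc k) 0" by (simp add: d_addr_def)
    define I3 where "I3 = I2(d_addr k v := I vFlag)"
    have upd: "fold eff ?upd (I2, R2) = (I3(vQB := int (L + Suc k * SC), vD := int (d_addr (Suc k) 0), vB := int (Suc k)),
       R2(rTot := R1 rTot + d_part R i oq k v))"
      using r2 v(2,3) spec[OF 2(3), of rTot] ge by (simp add: I3_def d_Suc[symmetric] algebra_simps)
    have br: "best_reply R i oq (Suc k) w'"
      using w(1) v(1,4) by (simp add: best_reply_def w'_def less_Suc_eq)
    have tot: "R1 rTot + d_part R i oq k v = c_part R i oc + (\<Sum>b<Suc k. d_part R i oq b (w' b))"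
      using w(2) by (simp add: w'_def)
    have mem: "I3 x = (if (\<exists>a<p. x = c_addr i oc a) \<or> (\<exists>b<Suc k. x = d_addr b (w' b)) then I vFlag else I x)"
      if x: "64 \<le> x" for x
    proof -
      have "(\<exists>b<Suc k. x = d_addr b (w' b)) \<longleftrightarrow> x = d_addr k v \<or> (\<exists>b<k. x = d_addr b (w b))"
        by (auto simp: w'_def less_Suc_eq)
      then show ?thesis
        using spec[OF 2(2), of x] spec[OF w(3), of x] x by (cases "x = d_addr k v") (simp_all add: I3_def)
    qed
    have low: "I3 x = I x" if "x < 64" "x < 29 \<or> 38 < x" for x
      using spec[OF 2(1), of x] spec[OF inv'(1), of x] ge that by (auto simp: I3_def)
    have high: "R2 x = R x" if "4 \<le> x" for x
      using spec[OF 2(3), of x] spec[OF inv'(2), of x] that by simp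
    have "Inv (Suc k) (fold eff ?upd s')"
      unfolding s' upd Inv_def prod.case
      by (intro conjI exI[of _ w'] allI impI br) (use tot mem low high in auto)
    then show "ht (Block ?upd) s' 5 (Inv (Suc k))" by (intro ht_Block) simp_all
  qed simp
  define I0 where "I0 = I(vQA := int CB)"
  define R0 where "R0 = R(rTot := 0)"
  have eq0: "fold eff [RConst rTot 0, IAdd vQA vCB vZero] (I, R) = (I0, R0)"
    using r by (simp add: I0_def R0_def)
  show ?thesis
    unfolding eval_step_def
  proof (rule ht_Block_Seq)
    show "ht (row_sum True vCA vTC rTot ;; Block [IAdd vQB vL vZero, IAdd vD vDB vZero, IConst vB 0] ;;
       WhileLt vB vR (min_step ;; Block ?upd)) (fold eff [RConst rTot 0, IAdd vQA vCB vZero] (I, R))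
      (10 * p + r * (s * (10 * p + 16) + 12) + 6) (eval_post i oq oc (I, R))"
      unfolding eq0
    proof (rule ht_Seq)
      show "ht (row_sum True vCA vTC rTot) (I0, R0) (10 * p + 2) (row_sum_post True p i CB CA oc rTot (I0, R0))"
        by (rule row_sum_correct) (use r bounds in \<open>simp_all add: I0_def\<close>)
      fix s' assume post: "row_sum_post True p i CB CA oc rTot (I0, R0) s'"
      obtain I1 R1 where s': "s' = (I1, R1)" by fastforce
      have 1: "\<forall>x<64. x \<notin> {29, 30, 31} \<longrightarrow> I1 x = I0 x"
        "\<forall>x\<ge>64. I1 x = (if True \<and> (\<exists>a<p. x = row_addr CB CA oc i a) then I0 vFlag else I0 x)"
        "R1 rTot = R0 rTot + (\<Sum>a<p. R0 (row_addr CB CA oc i a))"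
        "\<forall>x. x \<noteq> 3 \<longrightarrow> x \<noteq> rTot \<longrightarrow> R1 x = R0 x"
        using post unfolding row_sum_post_def prod.case s' by blast+
      have c: "R1 rTot = c_part R i oc"
      proof -
        have "R0 (row_addr CB CA oc i a) = R (row_addr CB CA oc i a)" for a
          using addr_ge(1)[of i oc a] by (simp add: R0_def c_addr_def)
        then show ?thesis using 1(3) by (simp add: c_part_def c_addr_def R0_def)
      qed
      have fr: "\<forall>x<64. x < 29 \<or> 38 < x \<longrightarrow> I1 x = I x" "\<forall>x\<ge>4. R1 x = R x"
        using 1(1,4) by (simp_all add: I0_def R0_def)
      have mem: "I1 x = (if \<exists>a<p. x = c_addr i oc a then I vFlag else I x)" if "64 \<le> x" for x
        using spec[OF 1(2), of x] that
        by (cases "\<exists>a<p. x = row_addr CB CA oc i a") (auto simp: I0_def c_addr_def)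
      show "ht (Block [IAdd vQB vL vZero, IAdd vD vDB vZero, IConst vB 0] ;;
         WhileLt vB vR (min_step ;; Block ?upd)) s' (r * (s * (10 * p + 16) + 12) + 4) (eval_post i oq oc (I, R))"
        unfolding s'
      proof (rule ht_Block_Seq)
        let ?s = "fold eff [IAdd vQB vL vZero, IAdd vD vDB vZero, IConst vB 0] (I1, R1)"
        have eq1: "?s = (I1(vQB := int L, vD := int DB, vB := 0), R1)"
          using fr(1) r by simp
        \<comment> \<open>No inner argument has been treated yet, so any function serves as
          witness.\<close>
        have inv0: "Inv 0 ?s"
          unfolding eq1 Inv_def prod.case
          by (intro conjI exI[of _ "\<lambda>_. 0"] allI impI)
            (use fr mem c in \<open>auto simp: best_reply_def d_addr_def\<close>)
        show "ht (WhileLt vB vR (min_step ;; Block ?upd)) ?s (r * (s * (10 * p + 16) + 12) + 1) (eval_post i oq oc (I, R))"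
        proof (rule ht_conseq[OF ht_While[where Inv = Inv and N = r and T = "s * (10 * p + 16) + 10" and T' = "r * (s * (10 * p + 16) + 12) + 1", OF inv0]])
          fix k st assume k: "k < r" and inv: "Inv k st"
          obtain I' R' where st: "st = (I', R')" by fastforce
          have "I' vB = int k" "I' vR = int r" using inv r by (simp_all add: Inv_def st)
          then show "fst st vB < fst st vR \<and> ht (min_step ;; Block ?upd) st (s * (10 * p + 16) + 10) (Inv (Suc k))"
            using step[of k I' R'] inv k by (simp add: st)
        next
          fix st assume inv: "Inv r st"
          obtain I' R' where st: "st = (I', R')" by fastforce
          have "I' vB = int r" "I' vR = int r" using inv r by (simp_all add: Inv_def st)
          then show "\<not> fst st vB < fst st vR" by (simp add: st)
        next
          fix st assume "Inv r st"
          then show "eval_post i oq oc (I, R) st"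
            unfolding Inv_def eval_post_def by (cases st) (simp only: prod.case, blast)
        qed simp_all
      qed simp_all
    qed simp
  qed simp_all
qed

section \<open>Search over the step functions\<close>

definition opt :: "(nat \<Rightarrow> real) \<Rightarrow> nat \<Rightarrow> nat \<Rightarrow> real" where
  "opt R i t = c_part R i (t * CJ) + (\<Sum>b<r. Min (d_part R i (t * SB) b ` {..<s}))"

text \<open>A best reply need not be unique, but its total is always the sum of the minima. So the
  final evaluation attains the recorded value whichever minimizers it picks.\<close>

lemma best_reply_opt:
  assumes "best_reply R i (t * SB) r w"
  shows "c_part R i (t * CJ) + (\<Sum>b<r. d_part R i (t * SB) b (w b)) = opt R i t"
proof -
  have "d_part R i (t * SB) b (w b) = Min (d_part R i (t * SB) b ` {..<s})" if "b < r" for b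
    using assms that by (intro Min_eqI[symmetric]) (auto simp: best_reply_def)
  then show ?thesis by (simp add: opt_def)
qed

lemma opt_le:
  assumes "\<And>b. b < r \<Longrightarrow> v b < s"
  shows "opt R i t \<le> c_part R i (t * CJ) + (\<Sum>b<r. d_part R i (t * SB) b (v b))"
  unfolding opt_def using assms by (intro add_left_mono sum_mono Min_le) auto

lemma opt_cong:
  assumes "\<And>x. 64 \<le> x \<Longrightarrow> R' x = R x"
  shows "opt R' = opt R" "best_reply R' = best_reply R"
  using part_cong[OF assms] by (simp_all add: opt_def best_reply_def fun_eq_iff)

text \<open>\<open>V\<close> is the set of pairs \<open>(i, t)\<close> evaluated so far.\<close>

definition incumbent :: "(nat \<Rightarrow> real) \<Rightarrow> (nat \<times> nat) set \<Rightarrow> store \<Rightarrow> bool" where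
  "incumbent R V = (\<lambda>(I', R').
     if V = {} then I' vBestI = 0 else \<exists>i t. (i, t) \<in> V \<and> I' vBestI = int i \<and>
       I' vBestTQ = int (t * SB) \<and> I' vBestTC = int (t * CJ) \<and> R' rBest = opt R i t \<and>
       (\<forall>(i', t') \<in> V. opt R i t \<le> opt R i' t'))"

lemma incumbent_cong:
  assumes "I' vBestI = I1 vBestI" "I' vBestTQ = I1 vBestTQ" "I' vBestTC = I1 vBestTC" "R' rBest = R1 rBest"
  shows "incumbent R V (I', R') = incumbent R V (I1, R1)"
  using assms by (simp only: incumbent_def prod.case)

text \<open>Integer cells below 25 hold the layout parameters and real cells from 5 on include all
  the data; both survive the search.\<close>

definition search_inv :: "store \<Rightarrow> (nat \<times> nat) set \<Rightarrow> store \<Rightarrow> bool" where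
  "search_inv = (\<lambda>(I, R) V (I', R').
     V \<subseteq> {1..p} \<times> {..<q} \<and> (\<forall>x<25. I' x = I x) \<and> (\<forall>x\<ge>64. I' x = 0) \<and> (\<forall>x\<ge>5. R' x = R x) \<and>
     I' vFlag = 0 \<and> incumbent R V (I', R'))"

definition at_pair :: "nat \<Rightarrow> nat \<Rightarrow> store \<Rightarrow> bool" where
  "at_pair i t = (\<lambda>(I', R'). I' vI = int i \<and> I' vT = int t \<and> I' vTQ = int (t * SB) \<and> I' vTC = int (t * CJ))"

definition eval_time :: nat where
  "eval_time = 10 * p + r * (s * (10 * p + 16) + 12) + 8"

lemma search_step_correct:
  assumes I: "regs I" and inv: "search_inv (I, R) V st" and at: "at_pair i t st"
    and i: "i \<in> {1..p}" and t: "t < q"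
  shows "ht search_step st (eval_time + 12)
     (\<lambda>st'. search_inv (I, R) (insert (i, t) V) st' \<and> at_pair i (Suc t) st')"
proof -
  obtain I1 R1 where st: "st = (I1, R1)" by fastforce
  have inv': "V \<subseteq> {1..p} \<times> {..<q}" "\<forall>x<25. I1 x = I x" "\<forall>x\<ge>64. I1 x = 0" "\<forall>x\<ge>5. R1 x = R x"
    "I1 vFlag = 0" "incumbent R V (I1, R1)"
    using inv unfolding search_inv_def prod.case st by blast+
  have at': "I1 vI = int i" "I1 vT = int t" "I1 vTQ = int (t * SB)" "I1 vTC = int (t * CJ)"
    using at by (simp_all add: at_pair_def st)
  have regs1: "regs I1" using I inv'(2) by (simp add: regs_def)
  have R1: "opt R1 = opt R" "best_reply R1 = best_reply R" "c_part R1 = c_part R" "d_part R1 = d_part R"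
    using inv'(4) by (intro opt_cong part_cong; simp)+
  let ?up = "[RLoad rBest vZero, IAdd vBestI vI vZero, IAdd vBestTQ vTQ vZero, IAdd vBestTC vTC vZero]"
  let ?inc = "[IAdd vTQ vTQ vSB, IAdd vTC vTC vCJ, IAdd vT vT vOne]"
  show ?thesis
    unfolding search_step_def
  proof (rule ht_Seq)
    show "ht eval_step st eval_time (eval_post i (t * SB) (t * CJ) (I1, R1))"
      unfolding st eval_time_def by (rule eval_step_correct) (use regs1 at' in auto)
    fix s' assume post: "eval_post i (t * SB) (t * CJ) (I1, R1) s'"
    obtain I2 R2 where s': "s' = (I2, R2)" by fastforce
    have 2: "\<forall>x<64. x < 29 \<or> 38 < x \<longrightarrow> I2 x = I1 x" "\<forall>x\<ge>4. R2 x = R1 x"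
      using post unfolding eval_post_def prod.case s' by blast+
    obtain w where w: "best_reply R i (t * SB) r w"
      "R2 rTot = c_part R i (t * CJ) + (\<Sum>b<r. d_part R i (t * SB) b (w b))"
      "\<forall>x\<ge>64. I2 x = (if (\<exists>a<p. x = c_addr i (t * CJ) a) \<or> (\<exists>b<r. x = d_addr b (w b))
           then I1 vFlag else I1 x)"
      using post unfolding eval_post_def prod.case s' R1 by blast
    have tot: "R2 rTot = opt R i t" using w(1,2) best_reply_opt by simp
    have high: "\<forall>x\<ge>64. I2 x = 0"
    proof (intro allI impI)
      fix x :: nat assume "64 \<le> x"
      then show "I2 x = 0" using spec[OF w(3), of x] spec[OF inv'(3), of x] inv'(5) by (simp split: if_splits)
    qed
    have low: "\<forall>x<25. I2 x = I x" using 2(1) inv'(2) by simp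
    have r2: "I2 vZero = 0" "I2 vOne = 1" "I2 vSB = int SB" "I2 vCJ = int CJ"
      using low I by (simp_all add: regs_def)
    have R2: "\<forall>x\<ge>5. R2 x = R x" "R2 rBest = R1 rBest" using 2(2) inv'(4) by simp_all
    have vars: "I2 vBestI = I1 vBestI" "I2 vBestTQ = I1 vBestTQ" "I2 vBestTC = I1 vBestTC" "I2 vFlag = 0"
      "I2 vI = int i" "I2 vT = int t" "I2 vTQ = int (t * SB)" "I2 vTC = int (t * CJ)"
      using 2(1) inv'(5) at' by simp_all
    have inc2: "incumbent R V (I2, R2)" using inv'(6) by (simp only: incumbent_def prod.case R2(2) vars)
    \<comment> \<open>Evaluated pairs have \<open>i \<ge> 1\<close>, so a nonempty \<open>V\<close>
      forces \<open>vBestI > 0\<close>.\<close>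
    have pos_iff: "I2 vBestI \<le> I2 vZero \<longleftrightarrow> V = {}"
      using inc2 inv'(1) r2(1) by (auto simp: incumbent_def split: if_splits)
    define R3 where "R3 = (if V = {} then R2(rBest := opt R i t) else R2)"
    define Post where "Post = (\<lambda>(I', R'). (\<forall>x<25. I' x = I x) \<and> (\<forall>x\<ge>64. I' x = 0) \<and> (\<forall>x\<ge>5. R' x = R x) \<and>
       I' vFlag = 0 \<and> incumbent R (insert (i, t) V) (I', R') \<and> I' vI = int i \<and> I' vT = int t \<and>
       I' vTQ = int (t * SB) \<and> I' vTC = int (t * CJ))"
    show "ht (IfI vBestI vZero (Block [RLoad rBest vZero]) (Block []) ;;
       IfR rTot rBest (Block ?up) (Block []) ;; Block ?inc) s' 12
       (\<lambda>st'. search_inv (I, R) (insert (i, t) V) st' \<and> at_pair i (Suc t) st')"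
      unfolding s'
    proof (rule ht_Seq[where ?T1.0 = 3 and ?T2.0 = 9 and R = "\<lambda>s'. s' = (I2, R3)"])
      show "ht (IfI vBestI vZero (Block [RLoad rBest vZero]) (Block [])) (I2, R2) 3 (\<lambda>s'. s' = (I2, R3))"
        by (rule ht_IfI[where T = 1]; (rule ht_Block)?)
          (use pos_iff r2(1) tot in \<open>simp_all add: R3_def\<close>)
      fix s' assume s': "s' = (I2, R3)"
      show "ht (IfR rTot rBest (Block ?up) (Block []) ;; Block ?inc) s' 9
         (\<lambda>st'. search_inv (I, R) (insert (i, t) V) st' \<and> at_pair i (Suc t) st')"
        unfolding s'
      proof (rule ht_Seq[where ?T1.0 = 6 and ?T2.0 = 3 and R = Post])
        have R3: "\<forall>x\<ge>5. R3 x = R x" "R3 rTot = opt R i t" using R2(1) tot by (simp_all add: R3_def)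
        show "ht (IfR rTot rBest (Block ?up) (Block [])) (I2, R3) 6 Post"
        proof (rule ht_IfR[where T = 4])
          assume le: "snd (I2, R3) rTot \<le> snd (I2, R3) rBest"
          define I3 where "I3 = I2(vBestI := int i, vBestTQ := int (t * SB), vBestTC := int (t * CJ))"
          have up: "fold eff ?up (I2, R3) = (I3, R3(rBest := opt R i t))"
            using r2(1) R3(2) vars by (simp add: I3_def)
          have "opt R i t \<le> opt R i' t'" if "(i', t') \<in> V" for i' t'
          proof -
            have V: "V \<noteq> {}" using that by auto
            then obtain j u where "R2 rBest = opt R j u" "\<forall>(i', t') \<in> V. opt R j u \<le> opt R i' t'"
              using inc2 by (simp only: incumbent_def prod.case if_False) blast
            with V show ?thesis using le R3(2) that by (force simp: R3_def)
          qed
          then have "incumbent R (insert (i, t) V) (I3, R3(rBest := opt R i t))"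
            unfolding incumbent_def prod.case
            by (simp only: insert_not_empty if_False, intro exI[of _ i] exI[of _ t]) (auto simp: I3_def)
          then have "Post (fold eff ?up (I2, R3))"
            unfolding up using low high R3(1) vars by (simp add: Post_def I3_def)
          then show "ht (Block ?up) (I2, R3) 4 Post" by (intro ht_Block) simp_all
        next
          assume le: "\<not> snd (I2, R3) rTot \<le> snd (I2, R3) rBest"
          then have V: "V \<noteq> {}" using R3(2) by (auto simp: R3_def)
          then obtain j u where "(j, u) \<in> V" "I2 vBestI = int j" "I2 vBestTQ = int (u * SB)"
            "I2 vBestTC = int (u * CJ)" "R2 rBest = opt R j u" "\<forall>(i', t') \<in> V. opt R j u \<le> opt R i' t'"
            using inc2 by (simp only: incumbent_def prod.case if_False) blast
          moreover have "R3 = R2" using V by (simp add: R3_def)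
          ultimately have "incumbent R (insert (i, t) V) (I2, R3)"
            using le R3(2) unfolding incumbent_def prod.case
            by (simp only: insert_not_empty if_False, intro exI[of _ j] exI[of _ u]) auto
          then have "Post (I2, R3)" using low high R3(1) vars by (simp add: Post_def)
          then show "ht (Block []) (I2, R3) 4 Post" by (intro ht_Block) simp_all
        qed simp
        fix s' assume P: "Post s'"
        obtain I4 R4 where s': "s' = (I4, R4)" by fastforce
        have 4: "\<forall>x<25. I4 x = I x" "\<forall>x\<ge>64. I4 x = 0" "\<forall>x\<ge>5. R4 x = R x" "I4 vFlag = 0"
          "incumbent R (insert (i, t) V) (I4, R4)" "I4 vI = int i" "I4 vT = int t"
          "I4 vTQ = int (t * SB)" "I4 vTC = int (t * CJ)"
          using P unfolding Post_def prod.case s' by blast+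
        have r4: "I4 vSB = int SB" "I4 vCJ = int CJ" "I4 vOne = 1" using 4(1) I by (simp_all add: regs_def)
        define I5 where "I5 = I4(vTQ := int (Suc t * SB), vTC := int (Suc t * CJ), vT := int (Suc t))"
        have e: "fold eff ?inc s' = (I5, R4)"
          unfolding s' using r4 4(7-9) by (simp add: I5_def algebra_simps)
        have "incumbent R (insert (i, t) V) (I5, R4)" 
          using 4(5) by (subst incumbent_cong[of _ I4 _ R4]) (simp_all add: I5_def)
        then have "search_inv (I, R) (insert (i, t) V) (I5, R4) \<and> at_pair i (Suc t) (I5, R4)"
          using 4(1-4,6) inv'(1) i t by (simp add: search_inv_def at_pair_def I5_def)
        then show "ht (Block ?inc) s' 3 (\<lambda>st'. search_inv (I, R) (insert (i, t) V) st' \<and> at_pair i (Suc t) st')"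
          by (intro ht_Block) (simp_all only: e, simp_all)
      qed simp
    qed simp
  qed simp
qed

definition search_post :: "store \<Rightarrow> store \<Rightarrow> bool" where
  "search_post = (\<lambda>(I, R) (I', R'). (\<forall>x<25. I' x = I x) \<and>
     (\<exists>i t w. i \<in> {1..p} \<and> t < q \<and> best_reply R i (t * SB) r w \<and>
        (\<forall>i'\<in>{1..p}. \<forall>t'<q. opt R i t \<le> opt R i' t') \<and>
        (\<forall>x\<ge>64. I' x = (if (\<exists>a<p. x = c_addr i (t * CJ) a) \<or> (\<exists>b<r. x = d_addr b (w b)) then 1 else 0))))"

text \<open>The second \<open>eval_time\<close> pays for the final evaluation, which writes the
  solution.\<close>

definition search_time :: nat where
  "search_time = p * (q * (eval_time + 14) + 7) + eval_time + 8"

lemma search_correct: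
  assumes I: "regs I" and zero: "\<forall>x\<ge>64. I x = 0"
  shows "ht search (I, R) search_time (search_post (I, R))"
proof -
  \<comment> \<open>\<open>vI\<close> is raised before the inner loop, so round \<open>k\<close> of
    the outer loop treats \<open>i = Suc k\<close>: \<open>visited k j\<close> consists of the
    finished rows and the first \<open>j\<close> pairs of that row.\<close>
  define visited where "visited k j = ({1..k} \<times> {..<q}) \<union> ({Suc k} \<times> {..<j})" for k j
  have visited: "visited k (Suc j) = insert (Suc k, j) (visited k j)" "visited k 0 = {1..k} \<times> {..<q}"
    "visited k q = {1..Suc k} \<times> {..<q}" for k j
    by (auto simp: visited_def le_Suc_eq)
  let ?fin = "[IAdd vI vBestI vZero, IAdd vTQ vBestTQ vZero, IAdd vTC vBestTC vZero, IConst vFlag 1]"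
  let ?row = "[IAdd vI vI vOne, IConst vT 0, IConst vTQ 0, IConst vTC 0]"
  define Out where "Out k st \<longleftrightarrow> search_inv (I, R) ({1..k} \<times> {..<q}) st \<and> fst st vI = int k" for k st
  define Inn where "Inn k j st \<longleftrightarrow> search_inv (I, R) (visited k j) st \<and> at_pair (Suc k) j st" for k j st
  note r = I[unfolded regs_def]
  have regs: "fst st vZero = 0" "fst st vOne = 1" "fst st vP = int p" "fst st vQ = int q" "regs (fst st)"
    if "search_inv (I, R) V st" for V st
  proof -
    have "\<forall>x<25. fst st x = I x" using that by (cases st) (simp add: search_inv_def)
    then show "fst st vZero = 0" "fst st vOne = 1" "fst st vP = int p" "fst st vQ = int q" "regs (fst st)"
      using I by (simp_all add: regs_def)
  qed
  have row: "ht (Block ?row ;; WhileLt vT vQ search_step) st (q * (eval_time + 14) + 5) (Out (Suc k))"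
    if k: "k < p" and out: "Out k st" for k st
  proof (rule ht_Block_Seq)
    obtain I1 R1 where st: "st = (I1, R1)" by fastforce
    have e: "fold eff ?row st = (I1(vI := int (Suc k), vT := 0, vTQ := 0, vTC := 0), R1)"
      using regs(2)[of "{1..k} \<times> {..<q}" st] out unfolding Out_def st by (simp add: add.commute)
    have inv: "search_inv (I, R) ({1..k} \<times> {..<q}) (I1, R1)" using out by (simp add: Out_def st)
    have "search_inv (I, R) ({1..k} \<times> {..<q}) (I1(vI := int (Suc k), vT := 0, vTQ := 0, vTC := 0), R1)"
      using inv unfolding search_inv_def prod.case by (subst incumbent_cong[of _ I1 _ R1]) simp_all
    then have inn: "Inn k 0 (fold eff ?row st)"
      unfolding e Inn_def visited by (simp add: at_pair_def)
    show "ht (WhileLt vT vQ search_step) (fold eff ?row st) (q * (eval_time + 14) + 1) (Out (Suc k))"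
    proof (rule ht_conseq[OF ht_While[where Inv = "Inn k" and N = q and T = "eval_time + 12"
            and T' = "q * (eval_time + 14) + 1", OF inn]])
      fix j st assume j: "j < q" and inn: "Inn k j st"
      then have "fst st vT = int j" by (cases st) (simp add: Inn_def at_pair_def)
      moreover have "ht search_step st (eval_time + 12) (Inn k (Suc j))"
        using search_step_correct[OF I, of R "visited k j" st "Suc k" j] inn j k
        unfolding Inn_def visited by simp
      ultimately show "fst st vT < fst st vQ \<and> ht search_step st (eval_time + 12) (Inn k (Suc j))"
        using regs(4)[of "visited k j" st] inn j by (simp add: Inn_def)
    next
      fix st assume inn: "Inn k q st"
      then have "fst st vT = int q" by (cases st) (simp add: Inn_def at_pair_def)
      then show "\<not> fst st vT < fst st vQ" using regs(4)[of "visited k q" st] inn by (simp add: Inn_def)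
    next
      fix st assume "Inn k q st"
      then show "Out (Suc k) st"
        unfolding Inn_def Out_def visited by (cases st) (simp add: at_pair_def)
    qed simp_all
  qed simp_all
  have fin: "ht (Block ?fin ;; eval_step) st (eval_time + 4) (search_post (I, R))" if out: "Out p st" for st
  proof (rule ht_Block_Seq)
    obtain I1 R1 where st: "st = (I1, R1)" by fastforce
    have inv: "\<forall>x<25. I1 x = I x" "\<forall>x\<ge>64. I1 x = 0" "\<forall>x\<ge>5. R1 x = R x"
      "incumbent R ({1..p} \<times> {..<q}) (I1, R1)"
      using out unfolding Out_def search_inv_def prod.case st by blast+
    have R1: "opt R1 = opt R" "best_reply R1 = best_reply R"
      using inv(3) by (intro opt_cong; simp)+
    \<comment> \<open>Positive sizes enter here: a search over no pairs would leave no
      incumbent.\<close>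
    have ne: "{1..p} \<times> {..<q} \<noteq> {}" using pos by auto
    obtain i t where it: "i \<in> {1..p}" "t < q" "I1 vBestI = int i" "I1 vBestTQ = int (t * SB)"
       "I1 vBestTC = int (t * CJ)" "\<forall>i'\<in>{1..p}. \<forall>t'<q. opt R i t \<le> opt R i' t'"
      using inv(4) ne unfolding incumbent_def prod.case by (auto split: if_splits)
    define I2 where "I2 = I1(vI := int i, vTQ := int (t * SB), vTC := int (t * CJ), vFlag := 1)"
    have e: "fold eff ?fin st = (I2, R1)"
      using regs(1)[of "{1..p} \<times> {..<q}" st] out it unfolding Out_def st by (simp add: I2_def)
    have low: "\<forall>x<25. I2 x = I x" using inv(1) by (simp add: I2_def)
    show "ht eval_step (fold eff ?fin st) eval_time (search_post (I, R))"
      unfolding e eval_time_def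
    proof (rule ht_conseq[OF eval_step_correct[where i = i and oq = "t * SB" and oc = "t * CJ"]])
      show "regs I2" using low I by (simp add: regs_def)
      show "I2 vI = int i" "I2 vTQ = int (t * SB)" "I2 vTC = int (t * CJ)" by (simp_all add: I2_def)
      fix s' assume post: "eval_post i (t * SB) (t * CJ) (I2, R1) s'"
      obtain I3 R3 where s': "s' = (I3, R3)" by fastforce
      have 3: "\<forall>x<64. x < 29 \<or> 38 < x \<longrightarrow> I3 x = I2 x"
        using post unfolding eval_post_def prod.case s' by blast
      obtain w where w: "best_reply R i (t * SB) r w"
        "\<forall>x\<ge>64. I3 x = (if (\<exists>a<p. x = c_addr i (t * CJ) a) \<or> (\<exists>b<r. x = d_addr b (w b))
             then I2 vFlag else I2 x)"
        using post unfolding eval_post_def prod.case s' R1 by blast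
      have "I3 x = (if (\<exists>a<p. x = c_addr i (t * CJ) a) \<or> (\<exists>b<r. x = d_addr b (w b)) then 1 else 0)"
        if "64 \<le> x" for x
      proof -
        have "I2 vFlag = 1" "I2 x = 0" using that inv(2) by (simp_all add: I2_def)
        then show ?thesis using spec[OF w(2), of x] that by metis
      qed
      moreover have "\<forall>x<25. I3 x = I x" using 3 low by simp
      ultimately show "search_post (I, R) s'"
        unfolding search_post_def prod.case s' using it(1,2,6) w(1) by blast
    qed simp_all
  qed simp_all
  define I0 where "I0 = I(vBestI := 0, vFlag := 0, vI := 0)"
  have e0: "fold eff [IConst vBestI 0, IConst vFlag 0, IConst vI 0] (I, R) = (I0, R)"
    by (simp add: I0_def)
  have out0: "Out 0 (I0, R)"
    using zero unfolding Out_def search_inv_def prod.case by (simp add: I0_def incumbent_def)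
  show ?thesis
    unfolding search_def
  proof (rule ht_Block_Seq)
    show "ht (WhileLt vI vP (Block ?row ;; WhileLt vT vQ search_step) ;; Block ?fin ;; eval_step)
      (fold eff [IConst vBestI 0, IConst vFlag 0, IConst vI 0] (I, R))
      (p * (q * (eval_time + 14) + 7) + eval_time + 5) (search_post (I, R))"
      unfolding e0
    proof (rule ht_Seq[OF ht_While[where Inv = Out and N = p and T = "q * (eval_time + 14) + 5"
            and T' = "p * (q * (eval_time + 14) + 7) + 1", OF out0]])
      fix k st assume k: "k < p" and out: "Out k st"
      then show "fst st vI < fst st vP \<and> ht (Block ?row ;; WhileLt vT vQ search_step) st
        (q * (eval_time + 14) + 5) (Out (Suc k))"
        using row[OF k out] regs(3)[of "{1..k} \<times> {..<q}" st] by (simp add: Out_def)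
    next
      fix st assume "Out p st"
      then show "\<not> fst st vI < fst st vP" using regs(3)[of "{1..p} \<times> {..<q}" st] by (simp add: Out_def)
    next
      fix st assume "Out p st"
      then show "ht (Block ?fin ;; eval_step) st (eval_time + 4) (search_post (I, R))" by (rule fin)
    qed simp_all
  qed (simp_all add: search_time_def)
qed

end

subsection \<open>Data movement\<close>

text \<open>The machine has no integer multiplication, and real values cannot become addresses;
  products of the sizes are formed by repeated addition, in time linear in the second
  factor.\<close>

definition multiply :: "nat \<Rightarrow> nat \<Rightarrow> nat \<Rightarrow> com" where
  "multiply d a b = Block [IConst d 0, IConst vA 0] ;;
     WhileLt vA b (Block [IAdd d d a, IAdd vA vA vOne])"

lemma multiply_correct:
  assumes "I a = int x" "I b = int y" "I vOne = 1"
    and "d \<noteq> a" "d \<noteq> b" "d \<noteq> vA" "d \<noteq> vOne" "a \<noteq> vA" "b \<noteq> vA"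
  shows "ht (multiply d a b) (I, R) (4 * y + 3) (\<lambda>st. st = (I(d := int (x * y), vA := int y), R))"
  unfolding multiply_def
proof (rule ht_Block_Seq)
  let ?Inv = "\<lambda>k st. st = (I(d := int (x * k), vA := int k), R)"
  show "ht (WhileLt vA b (Block [IAdd d d a, IAdd vA vA vOne])) (fold eff [IConst d 0, IConst vA 0] (I, R))
     (4 * y + 1) (?Inv y)"
  proof (rule ht_While[where T = 2])
    fix k st assume k: "k < y" and st: "?Inv k st"
    have "ht (Block [IAdd d d a, IAdd vA vA vOne]) st 2 (?Inv (Suc k))"
      using assms st by (intro ht_Block) (auto simp: algebra_simps fun_upd_twist)
    then show "fst st vA < fst st b \<and> ht (Block [IAdd d d a, IAdd vA vA vOne]) st 2 (?Inv (Suc k))"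
      using k assms st by simp
  qed (use assms in \<open>auto simp: fun_upd_twist\<close>)
qed simp_all

text \<open>The loop needs a real register as buffer, so the five cells that serve as registers are
  saved first by direct stores. The lowest \<open>L\<close> cells move up by \<open>L\<close>, so no
  target cell is a source.\<close>

definition shift_data :: com where
  "shift_data =
     Block [IAdd vPtr vL vZero, RStore vPtr 0, IAdd vPtr vPtr vOne, RStore vPtr 1, IAdd vPtr vPtr vOne,
       RStore vPtr 2, IAdd vPtr vPtr vOne, RStore vPtr 3, IAdd vPtr vPtr vOne, RStore vPtr 4,
       IAdd vPtr vPtr vOne, IConst vA 5] ;;
     WhileLt vA vL (Block [RLoad rTot vA, RStore vPtr rTot, IAdd vPtr vPtr vOne, IAdd vA vA vOne])"

lemma shift_data_correct:
  assumes "I vL = int L" "I vZero = 0" "I vOne = 1" "64 \<le> L"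
  shows "ht shift_data (I, R) (6 * L + 13) (\<lambda>(I', R').
     (\<forall>x. x \<noteq> vA \<longrightarrow> x \<noteq> vPtr \<longrightarrow> I' x = I x) \<and> (\<forall>x<L. R' (L + x) = R x))"
proof -
  let ?pre = "[IAdd vPtr vL vZero, RStore vPtr 0, IAdd vPtr vPtr vOne, RStore vPtr 1, IAdd vPtr vPtr vOne,
       RStore vPtr 2, IAdd vPtr vPtr vOne, RStore vPtr 3, IAdd vPtr vPtr vOne, RStore vPtr 4,
       IAdd vPtr vPtr vOne, IConst vA 5]"
  let ?body = "[RLoad rTot vA, RStore vPtr rTot, IAdd vPtr vPtr vOne, IAdd vA vA vOne]"
  define Inv where "Inv k st \<longleftrightarrow> fst st = I(vPtr := int (L + 5 + k), vA := int (5 + k)) \<and>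
     (\<forall>x<5 + k. snd st (L + x) = R x) \<and> (\<forall>x. 5 \<le> x \<longrightarrow> x < L \<longrightarrow> snd st x = R x)" for k st
  have e: "fold eff ?pre (I, R) = (I(vPtr := 5 + int L, vA := 5),
     R(L := R 0, Suc L := R (Suc 0), Suc (Suc L) := R 2, 3 + L := R 3, 4 + L := R 4))"
    using assms by (simp add: nat_add_distrib add.commute)
  have small: "x = 0 \<or> x = Suc 0 \<or> x = 2 \<or> x = 3 \<or> x = 4" if "x < 5" for x :: nat
    using that by linarith
  have inv0: "Inv 0 (fold eff ?pre (I, R))"
    unfolding e Inv_def using assms(4) by (auto dest!: small simp: add.commute)
  show ?thesis
    unfolding shift_data_def
  proof (rule ht_Block_Seq)
    show "ht (WhileLt vA vL (Block ?body)) (fold eff ?pre (I, R)) (6 * L + 1)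
      (\<lambda>(I', R'). (\<forall>x. x \<noteq> vA \<longrightarrow> x \<noteq> vPtr \<longrightarrow> I' x = I x) \<and> (\<forall>x<L. R' (L + x) = R x))"
    proof (rule ht_conseq[OF ht_While[where Inv = Inv and N = "L - 5" and T = 4 and T' = "6 * L + 1", OF inv0]])
      fix k st assume k: "k < L - 5" and inv: "Inv k st"
      obtain I1 R1 where st: "st = (I1, R1)" by fastforce
      have 1: "I1 = I(vPtr := int (L + 5 + k), vA := int (5 + k))" "\<forall>x<5 + k. R1 (L + x) = R x"
        "\<forall>x. 5 \<le> x \<longrightarrow> x < L \<longrightarrow> R1 x = R x"
        using inv by (simp_all add: Inv_def st)
      have e: "fold eff ?body st = (I(vPtr := int (L + 5 + Suc k), vA := int (5 + Suc k)),
          R1(rTot := R (5 + k), L + (5 + k) := R (5 + k)))"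
        using 1(3) k assms(3) by (simp add: st 1(1) fun_upd_twist nat_add_distrib algebra_simps)
      have "Inv (Suc k) (fold eff ?body st)"
        unfolding e Inv_def using 1(2,3) k assms(4) by (auto simp: less_Suc_eq)
      then have "ht (Block ?body) st 4 (Inv (Suc k))" by (intro ht_Block) simp_all
      then show "fst st vA < fst st vL \<and> ht (Block ?body) st 4 (Inv (Suc k))"
        using k assms by (simp add: st 1(1))
    next
      fix st assume "Inv (L - 5) st"
      then show "\<not> fst st vA < fst st vL" using assms by (simp add: Inv_def)
    next
      fix st assume "Inv (L - 5) st"
      then show "case st of (I', R') \<Rightarrow> (\<forall>x. x \<noteq> vA \<longrightarrow> x \<noteq> vPtr \<longrightarrow> I' x = I x) \<and> (\<forall>x<L. R' (L + x) = R x)"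
        using assms(4) by (cases st) (simp add: Inv_def)
    qed simp_all
  qed simp_all
qed

text \<open>Unrolled because cells 2 to 63 belong to the output: only registers 0 and 1 are free while
they are being filled.\<close>

definition fetch_low :: "nat \<Rightarrow> nat \<Rightarrow> instr list" where
  "fetch_low a b = concat (map (\<lambda>k. [ILoad k 0, IAdd 0 0 1]) [a..<b])"

text \<open>Cell \<open>x\<close> is read from \<open>base + x\<close>, and by then only register 0
  and cells below \<open>x\<close> have been overwritten, so the load still finds the original
  value.\<close>

lemma fetch_low_correct:
  assumes "2 \<le> a" "a \<le> b" "J 0 = int (base + a)" "J 1 = 1"
  shows "\<exists>J'. fold eff (fetch_low a b) (J, R) = (J', R) \<and> (\<forall>x. a \<le> x \<longrightarrow> x < b \<longrightarrow> J' x = J (base + x))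
    \<and> (\<forall>x. 2 \<le> x \<longrightarrow> x < a \<or> b \<le> x \<longrightarrow> J' x = J x)"
  using assms
proof (induction "b - a" arbitrary: a J)
  case 0
  then have "fetch_low a b = []" by (simp add: fetch_low_def)
  then show ?case using 0 by (intro exI[of _ J]) simp
next
  case (Suc d)
  then have ab: "a < b" by simp
  define J1 where "J1 = J(a := J (base + a), 0 := int (base + Suc a))"
  have "fetch_low a b = [ILoad a 0, IAdd 0 0 1] @ fetch_low (Suc a) b"
    using ab by (simp add: fetch_low_def upt_conv_Cons)
  then have e: "fold eff (fetch_low a b) (J, R) = fold eff (fetch_low (Suc a) b) (J1, R)"
    using Suc.prems by (simp add: J1_def nat_int_add add.commute)
  have "\<exists>J'. fold eff (fetch_low (Suc a) b) (J1, R) = (J', R) \<and>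
    (\<forall>x. Suc a \<le> x \<longrightarrow> x < b \<longrightarrow> J' x = J1 (base + x)) \<and> (\<forall>x. 2 \<le> x \<longrightarrow> x < Suc a \<or> b \<le> x \<longrightarrow> J' x = J1 x)"
    by (rule Suc.hyps(1)) (use Suc.hyps(2) Suc.prems ab in \<open>simp_all add: J1_def\<close>)
  then obtain J' where J': "fold eff (fetch_low (Suc a) b) (J1, R) = (J', R)"
    "\<forall>x. Suc a \<le> x \<longrightarrow> x < b \<longrightarrow> J' x = J1 (base + x)" "\<forall>x. 2 \<le> x \<longrightarrow> x < Suc a \<or> b \<le> x \<longrightarrow> J' x = J1 x"
    by blast
  have "J' x = J (base + x)" if "a \<le> x" "x < b" for x
    using that J'(2) J'(3) Suc.prems by (cases "x = a") (auto simp: J1_def)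
  moreover have "J' x = J x" if "2 \<le> x" "x < a \<or> b \<le> x" for x
    using that J'(3) ab by (auto simp: J1_def)
  ultimately show ?case using e J'(1) by (intro exI[of _ J']) simp
qed

text \<open>The output area begins at cell 2, so cell \<open>x\<close> is taken from
  \<open>L + QS + (x - 2)\<close>, and the loop, starting at cell 64, reads from offset 62. It
  precedes the filling of the low cells because it still needs the registers there.\<close>

definition copy_output :: com where
  "copy_output =
     Block [IConst vA 64, IAdd vPtr vL vQS, IConst vTmp 62, IAdd vPtr vPtr vTmp] ;;
     WhileLt vA vL (Block [ILoad vTmp vPtr, IStore vA vTmp, IAdd vPtr vPtr vOne, IAdd vA vA vOne]) ;;
     Block ([IAdd 0 vL vQS, IConst 1 1] @ fetch_low 2 64)"

lemma copy_output_correct: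
  assumes "I vL = int L" "I vQS = int QS" "I vOne = 1" "64 \<le> L" "0 < QS"
  shows "ht copy_output (I, R) (6 * L + 131) (\<lambda>(I', R'). \<forall>x. 2 \<le> x \<longrightarrow> x < L \<longrightarrow> I' x = I (L + QS + (x - 2)))"
proof -
  let ?pre = "[IConst vA 64, IAdd vPtr vL vQS, IConst vTmp 62, IAdd vPtr vPtr vTmp]"
  let ?body = "[ILoad vTmp vPtr, IStore vA vTmp, IAdd vPtr vPtr vOne, IAdd vA vA vOne]"
  define Inv where "Inv k st \<longleftrightarrow> (\<forall>x<64. x \<noteq> 29 \<longrightarrow> x \<noteq> 30 \<longrightarrow> x \<noteq> 43 \<longrightarrow> fst st x = I x) \<and>
     fst st vA = int (64 + k) \<and> fst st vPtr = int (L + QS + 62 + k) \<and>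
     (\<forall>x. 64 \<le> x \<longrightarrow> x < 64 + k \<longrightarrow> fst st x = I (L + QS + (x - 2))) \<and>
     (\<forall>x\<ge>64 + k. fst st x = I x)" for k and st :: store
  have inv0: "Inv 0 (fold eff ?pre (I, R))"
    using assms by (simp add: Inv_def)
  show ?thesis
    unfolding copy_output_def
  proof (rule ht_Block_Seq)
    show "ht (WhileLt vA vL (Block ?body) ;; Block ([IAdd 0 vL vQS, IConst 1 1] @ fetch_low 2 64))
      (fold eff ?pre (I, R)) (6 * L + 127) (\<lambda>(I', R'). \<forall>x. 2 \<le> x \<longrightarrow> x < L \<longrightarrow> I' x = I (L + QS + (x - 2)))"
    proof (rule ht_Seq[OF ht_While[where Inv = Inv and N = "L - 64" and T = 4 and T' = "6 * L + 1", OF inv0]])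
      fix k st assume k: "k < L - 64" and inv: "Inv k st"
      obtain I1 R1 where st: "st = (I1, R1)" by fastforce
      have 1: "\<forall>x<64. x \<noteq> 29 \<longrightarrow> x \<noteq> 30 \<longrightarrow> x \<noteq> 43 \<longrightarrow> I1 x = I x"
        "I1 vA = int (64 + k)" "I1 vPtr = int (L + QS + 62 + k)"
        "\<forall>x. 64 \<le> x \<longrightarrow> x < 64 + k \<longrightarrow> I1 x = I (L + QS + (x - 2))" "\<forall>x\<ge>64 + k. I1 x = I x"
        using inv unfolding Inv_def st fst_conv by blast+
      have r1: "I1 vOne = 1" "I1 vL = int L" using 1(1) assms by simp_all
      define w where "w = I (L + QS + (64 + k - 2))"
      have w: "I1 (L + QS + 62 + k) = w"
        using spec[OF 1(5), of "L + QS + 62 + k"] assms(4) by (simp add: w_def add.assoc)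
      have e: "fold eff ?body st = (I1(vTmp := w, 64 + k := w, vPtr := int (L + QS + 62 + Suc k), vA := int (64 + Suc k)), R1)"
      proof -
        have "nat (I1 30) = L + QS + 62 + k" "nat (I1 29) = 64 + k" using 1(2,3) by simp_all
        then show ?thesis using w 1(2,3) r1 by (simp add: st)
      qed
      have "Inv (Suc k) (fold eff ?body st)"
        unfolding e Inv_def fst_conv using 1(1,4,5) by (auto simp: w_def less_Suc_eq ac_simps)
      then have "ht (Block ?body) st 4 (Inv (Suc k))" by (intro ht_Block) simp_all
      then show "fst st vA < fst st vL \<and> ht (Block ?body) st 4 (Inv (Suc k))"
        using k r1 1(2) by (simp add: st)
    next
      fix st assume "Inv (L - 64) st"
      then have "fst st vA = int L" "fst st vL = int L"
        using assms(1,4) unfolding Inv_def by auto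
      then show "\<not> fst st vA < fst st vL" by simp
    next
      fix st assume inv: "Inv (L - 64) st"
      obtain I1 R1 where st: "st = (I1, R1)" by fastforce
      have 1: "\<forall>x<64. x \<noteq> 29 \<longrightarrow> x \<noteq> 30 \<longrightarrow> x \<noteq> 43 \<longrightarrow> I1 x = I x"
        "\<forall>x. 64 \<le> x \<longrightarrow> x < L \<longrightarrow> I1 x = I (L + QS + (x - 2))" "\<forall>x\<ge>L. I1 x = I x"
        using inv assms(4) unfolding Inv_def st fst_conv by auto
      define J where "J = I1(0 := int (L + QS), 1 := 1)"
      have e: "fold eff ([IAdd 0 vL vQS, IConst 1 1] @ fetch_low 2 64) st = fold eff (fetch_low 2 64) (J, R1)"
        using 1(1) assms(1,2) by (simp add: st J_def)
      \<comment> \<open>\<open>base\<close> is \<open>L + QS - 2\<close>, so that cell 2 is fetched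
        from \<open>L + QS\<close>; the subtraction is exact because
        \<open>64 \<le> L\<close>.\<close>
      have "\<exists>J'. fold eff (fetch_low 2 64) (J, R1) = (J', R1) \<and>
        (\<forall>x. 2 \<le> x \<longrightarrow> x < 64 \<longrightarrow> J' x = J (L + QS - 2 + x)) \<and> (\<forall>x. 2 \<le> x \<longrightarrow> x < 2 \<or> 64 \<le> x \<longrightarrow> J' x = J x)"
        by (rule fetch_low_correct) (use assms(4) in \<open>simp_all add: J_def\<close>)
      then obtain J' where J': "fold eff (fetch_low 2 64) (J, R1) = (J', R1)"
        "\<forall>x. 2 \<le> x \<longrightarrow> x < 64 \<longrightarrow> J' x = J (L + QS - 2 + x)" "\<forall>x. 2 \<le> x \<longrightarrow> x < 2 \<or> 64 \<le> x \<longrightarrow> J' x = J x"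
        by blast
      have "J' x = I (L + QS + (x - 2))" if "2 \<le> x" "x < L" for x
      proof (cases "x < 64")
        case True
        have idx: "L + QS - 2 + x = L + QS + (x - 2)" using that assms(4) by simp
        have "J (L + QS + (x - 2)) = I (L + QS + (x - 2))"
          using spec[OF 1(3), of "L + QS + (x - 2)"] assms(4) by (simp add: J_def)
        then show ?thesis using J'(2) that True idx by simp
      next
        case False
        then show ?thesis using J'(3) 1(2) that by (simp add: J_def)
      qed
      moreover have "list_all straight (fetch_low a b)" for a b
        by (simp add: fetch_low_def list_all_iff) 
      moreover have "length (fetch_low 2 64) = 124"
        by (simp add: fetch_low_def length_concat o_def sum_list_triv)
      ultimately show "ht (Block ([IAdd 0 vL vQS, IConst 1 1] @ fetch_low 2 64)) st 126
          (\<lambda>(I', R'). \<forall>x. 2 \<le> x \<longrightarrow> x < L \<longrightarrow> I' x = I (L + QS + (x - 2)))"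
        by (intro ht_Block) (simp_all only: e J'(1), simp_all)
    qed simp_all
  qed simp_all
qed

definition solve_layout :: com where
  "solve_layout = shift_data ;; search ;; copy_output"

section \<open>Correctness and running time for one layout\<close>

context layout begin

definition obj :: "(nat \<Rightarrow> real) \<Rightarrow> (nat \<Rightarrow> nat) \<Rightarrow> (nat \<Rightarrow> nat) \<Rightarrow> real" where
  "obj R = Fobj p r (\<lambda>a j b l. R (L + a * SA + j * SB + b * SC + l * SD))
     (\<lambda>a j. R (CB + a * CA + j * CJ)) (\<lambda>b l. R (DB + b * DS + l * DV))"

text \<open>Exchanging the two sums collects the quadratic costs by inner argument, which is the
  order in which the program adds them. The offset in \<open>row_addr\<close> is
  \<open>step_fun i t a\<close> times the stride.\<close>

lemma obj_step_fun:
  "obj R (step_fun i t) v = c_part R i (t * CJ) + (\<Sum>b<r. d_part R i (t * SB) b (v b))"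
proof -
  have row: "row_addr base st (t * J) i a = base + a * st + step_fun i t a * J" for base st J a
    by (simp add: row_addr_def step_fun_def)
  have "(\<Sum>a<p. \<Sum>b<r. R (L + a * SA + step_fun i t a * SB + b * SC + v b * SD))
      = (\<Sum>b<r. \<Sum>a<p. R (row_addr (L + b * SC + v b * SD) SA (t * SB) i a))"
    unfolding row by (subst sum.swap) (simp add: ac_simps)
  then show ?thesis
    by (simp add: obj_def Fobj_def c_part_def d_part_def sum.distrib c_addr_def row d_addr_def)
qed

text \<open>\<open>R1\<close> stands for the real memory after \<open>shift_data\<close>, of which
  only the copied block is specified. \<open>QS\<close> is to be the number of quadratic costs, so
  that the copied linear costs begin at \<open>L + QS\<close>.\<close>

definition solve_post :: "nat \<Rightarrow> (nat \<Rightarrow> real) \<Rightarrow> store \<Rightarrow> bool" where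
  "solve_post QS R = (\<lambda>(I', R').
     \<exists>R1 u w. (\<forall>x<L. R1 (L + x) = R x) \<and> (\<forall>a<p. u a < q) \<and> (\<forall>b<r. w b < s) \<and>
       (\<forall>i\<in>{1..p}. \<forall>t<q. \<forall>v\<in>{..<r} \<rightarrow> {..<s}. obj R1 u w \<le> obj R1 (step_fun i t) v) \<and>
       (\<forall>x. x + 2 < L \<longrightarrow> I' (x + 2) = (if (\<exists>a<p. L + QS + x = CB + a * CA + u a * CJ) \<or>
          (\<exists>b<r. L + QS + x = DB + b * DS + w b * DV) then 1 else 0)))"

lemma solve_layout_correct:
  assumes I: "regs I" "I vQS = int QS" "0 < QS" and zero: "\<forall>x\<ge>64. I x = 0"
  shows "ht solve_layout (I, R) (search_time + 12 * L + 144) (solve_post QS R)"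
  unfolding solve_layout_def
proof (rule ht_Seq)
  note r = I(1)[unfolded regs_def]
  show "ht shift_data (I, R) (6 * L + 13) (\<lambda>(I', R').
     (\<forall>x. x \<noteq> vA \<longrightarrow> x \<noteq> vPtr \<longrightarrow> I' x = I x) \<and> (\<forall>x<L. R' (L + x) = R x))"
    by (rule shift_data_correct) (use r bounds in auto)
  fix s1 assume "case s1 of (I', R') \<Rightarrow>
     (\<forall>x. x \<noteq> vA \<longrightarrow> x \<noteq> vPtr \<longrightarrow> I' x = I x) \<and> (\<forall>x<L. R' (L + x) = R x)"
  then obtain I1 R1 where s1: "s1 = (I1, R1)" and
    1: "\<forall>x. x \<noteq> vA \<longrightarrow> x \<noteq> vPtr \<longrightarrow> I1 x = I x" "\<forall>x<L. R1 (L + x) = R x"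
    by (cases s1) blast
  have regs1: "regs I1" using 1(1) I(1) by (simp add: regs_def)
  have zero1: "\<forall>x\<ge>64. I1 x = 0" using 1(1) zero by simp
  show "ht (search ;; copy_output) s1 (search_time + 6 * L + 131) (solve_post QS R)"
    unfolding s1
  proof (rule ht_Seq[OF search_correct[OF regs1 zero1]])
    fix s2 assume post: "search_post (I1, R1) s2"
    obtain I2 R2 where s2: "s2 = (I2, R2)" by fastforce
    have low: "\<forall>x<25. I2 x = I1 x" using post unfolding search_post_def prod.case s2 by blast
    obtain i t w where w: "i \<in> {1..p}" "t < q" "best_reply R1 i (t * SB) r w"
        "\<forall>i'\<in>{1..p}. \<forall>t'<q. opt R1 i t \<le> opt R1 i' t'"
        "\<forall>x\<ge>64. I2 x = (if (\<exists>a<p. x = c_addr i (t * CJ) a) \<or> (\<exists>b<r. x = d_addr b (w b)) then 1 else 0)"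
      using post unfolding search_post_def prod.case s2 by blast
    have val: "obj R1 (step_fun i t) w = opt R1 i t"
      using best_reply_opt[OF w(3)] obj_step_fun by simp
    have best: "obj R1 (step_fun i t) w \<le> obj R1 (step_fun i' t') v"
      if "i' \<in> {1..p}" "t' < q" "v \<in> {..<r} \<rightarrow> {..<s}" for i' t' v
    proof -
      have "opt R1 i t \<le> opt R1 i' t'" using w(4) that by blast
      also have "\<dots> \<le> obj R1 (step_fun i' t') v"
        unfolding obj_step_fun by (rule opt_le) (use that in auto)
      finally show ?thesis using val by simp
    qed
    have u: "\<forall>a<p. step_fun i t a < q" using w(2) by (simp add: step_fun_def)
    have wv: "\<forall>b<r. w b < s" using w(3) by (simp add: best_reply_def)
    have r2: "I2 vL = int L" "I2 vQS = int QS" "I2 vOne = 1"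
      using low 1(1) r I(2) by simp_all
    show "ht copy_output s2 (6 * L + 131) (solve_post QS R)"
      unfolding s2
    proof (rule ht_conseq[OF copy_output_correct[OF r2 bounds(1) I(3)]])
      fix s3 :: store assume "case s3 of (I', R') \<Rightarrow> \<forall>x. 2 \<le> x \<longrightarrow> x < L \<longrightarrow> I' x = I2 (L + QS + (x - 2))"
      then obtain I3 R3 where s3: "s3 = (I3, R3)" and
        3: "\<forall>x. 2 \<le> x \<longrightarrow> x < L \<longrightarrow> I3 x = I2 (L + QS + (x - 2))" by (cases s3) blast
      have "I3 (x + 2) = (if (\<exists>a<p. L + QS + x = CB + a * CA + step_fun i t a * CJ) \<or>
          (\<exists>b<r. L + QS + x = DB + b * DS + w b * DV) then 1 else 0)" if x: "x + 2 < L" for x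
      proof -
        have "I3 (x + 2) = I2 (L + QS + x)" using 3 x by simp
        moreover have "c_addr i (t * CJ) a = CB + a * CA + step_fun i t a * CJ" for a
          by (simp add: c_addr_def row_addr_def step_fun_def)
        ultimately show ?thesis
          using spec[OF w(5), of "L + QS + x"] bounds(1) unfolding d_addr_def by simp
      qed
      then show "solve_post QS R s3"
        unfolding solve_post_def prod.case s3
        using 1(2) u wv best by blast
    qed simp
  qed simp
qed simp

text \<open>All sizes are at least 1, so every monomial is bounded by the leading one. The
  coefficients add up to 10 + 10 + 16 + 12 + 8 = 56 for one evaluation and to 56 + 14 + 7 + 56 + 8 =
  141 for the search.\<close>

lemma search_time_le: "search_time \<le> 141 * (p * (p * q * r * s))"
proof -
  define X where "X = p * r * s"
  have le: "p \<le> X" "r * s * p = X" "r * s \<le> X" "r \<le> X" "1 \<le> X"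
    using pos by (simp_all add: X_def)
  have "eval_time = 10 * p + 10 * (r * s * p) + 16 * (r * s) + 12 * r + 8"
    by (simp add: eval_time_def algebra_simps)
  also have "\<dots> \<le> 56 * X" using le by linarith
  finally have ev: "eval_time \<le> 56 * X" .
  define Y where "Y = p * q * X"
  have Y: "p * q \<le> Y" "p \<le> Y" "X \<le> Y" "1 \<le> Y"
    using pos le(5) by (simp_all add: Y_def)
  have "search_time = p * q * eval_time + 14 * (p * q) + 7 * p + eval_time + 8"
    by (simp add: search_time_def algebra_simps)
  also have "\<dots> \<le> p * q * (56 * X) + 14 * (p * q) + 7 * p + 56 * X + 8"
    using ev by (intro add_mono mult_left_mono) auto
  also have "p * q * (56 * X) = 56 * Y" by (simp add: Y_def)
  also have "56 * Y + 14 * (p * q) + 7 * p + 56 * X + 8 \<le> 141 * Y" using Y by linarith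
  also have "\<dots> = 141 * (p * (p * q * r * s))" by (simp add: X_def Y_def algebra_simps)
  finally show ?thesis .
qed

end

subsection \<open>Choice of the layout\<close>

lemma pair_index_less:
  fixes a j m g :: nat
  assumes "a < m" "j < g"
  shows "a * g + j < m * g"
proof -
  have "a * g + j < Suc a * g" using assms(2) by simp
  also have "\<dots> \<le> m * g" using assms(1) by (intro mult_le_mono1) simp
  finally show ?thesis .
qed

lemma pair_index_inj:
  fixes a j a' j' g :: nat
  assumes "j < g" "j' < g" "a * g + j = a' * g + j'"
  shows "a = a'" "j = j'"
proof -
  have "a = (a * g + j) div g" "j = (a * g + j) mod g" using assms(1) by simp_all
  then show "a = a'" "j = j'" using assms by simp_all
qed

lemma ht_multiply_Seq:
  assumes "I a = int x" "I b = int y" "I vOne = 1"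
    and "d \<noteq> a" "d \<noteq> b" "d \<noteq> vA" "d \<noteq> vOne" "a \<noteq> vA" "b \<noteq> vA"
    and "ht c (I(d := int (x * y), vA := int y), R) T Q" "4 * y + 3 + T \<le> T'"
  shows "ht (multiply d a b ;; c) (I, R) T' Q"
  using ht_Seq[OF multiply_correct[OF assms(1-9)] _ assms(11)] assms(10) by simp

text \<open>Six doublings give \<open>L = 64 * QS\<close>, which is at least 64 and exceeds the at
  most \<open>3 * QS\<close> input cells. The two branches assign the same strides with the roles of
  \<open>x\<close> and \<open>y\<close> exchanged.\<close>

definition choose_layout :: com where
  "choose_layout =
     Block [IAdd vL vQS vQS, IAdd vL vL vL, IAdd vL vL vL, IAdd vL vL vL, IAdd vL vL vL, IAdd vL vL vL] ;;
     IfI vN vM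
       (Block [IAdd vP vN vZero, IAdd vQ vH vZero, IAdd vSA vOne vZero, IAdd vSB vN vZero,
          IAdd vCA vOne vZero, IAdd vCJ vN vZero, IAdd vDB vL vQS, IAdd vR vM vZero, IAdd vS vG vZero,
          IAdd vSC vGHN vZero, IAdd vSD vHN vZero, IAdd vDS vG vZero, IAdd vDV vOne vZero, IAdd vCB vDB vMG])
       (Block [IAdd vP vM vZero, IAdd vQ vG vZero, IAdd vSA vGHN vZero, IAdd vSB vHN vZero,
          IAdd vCA vG vZero, IAdd vCJ vOne vZero, IAdd vCB vL vQS, IAdd vR vN vZero, IAdd vS vH vZero,
          IAdd vSC vOne vZero, IAdd vSD vN vZero, IAdd vDS vOne vZero, IAdd vDV vN vZero, IAdd vDB vCB vMG])"

definition prepare :: com where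
  "prepare = Block [IConst vOne 1] ;;
     multiply vHN vH vN ;; multiply vGHN vHN vG ;; multiply vQS vGHN vM ;; multiply vMG vM vG ;;
     choose_layout"

definition dims_mem :: "nat \<Rightarrow> nat \<Rightarrow> nat \<Rightarrow> nat \<Rightarrow> nat \<Rightarrow> int" where
  "dims_mem m g h n = (\<lambda>_. 0)(vM := int m, vN := int n, vG := int g, vH := int h)"

text \<open>Both problems are the case \<open>x : [m] \<rightarrow> [g]\<close>, \<open>y : [n] \<rightarrow> [h]\<close>: BQAP1 with \<open>g = n\<close>, \<open>h = m\<close>, and BQAP2
with \<open>g = m\<close>, \<open>h = n\<close>. Layout \<open>X\<close> has \<open>x\<close> as the outer function, layout \<open>Y\<close> has \<open>y\<close>.\<close>

locale instance_dims =
  fixes m g h n :: nat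
  assumes dims: "0 < m" "0 < g" "0 < h" "0 < n"
begin

definition QS :: nat where "QS = m * g * h * n"

lemma QS_ge: "1 \<le> QS" "m \<le> QS" "n \<le> QS" "g \<le> QS" "m * g \<le> QS" "h * n \<le> QS"
proof -
  have "QS = (m * g) * (h * n)" by (simp add: QS_def mult.assoc)
  then show "m * g \<le> QS" "h * n \<le> QS" using dims by simp_all
  have "m \<le> m * g" "g \<le> m * g" "n \<le> h * n" "1 \<le> m * g" using dims by simp_all
  then show "1 \<le> QS" "m \<le> QS" "n \<le> QS" "g \<le> QS" using \<open>m * g \<le> QS\<close> \<open>h * n \<le> QS\<close> by linarith+
qed

text \<open>Q is stored at \<open>((a * g + j) * h + k) * n + l\<close>, which gives the strides
  \<open>g * (h * n)\<close>, \<open>h * n\<close>, \<open>n\<close>, 1 of \<open>a\<close>,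
  \<open>j\<close>, \<open>k\<close>, \<open>l\<close>. The argument of \<open>y\<close> is its
  column \<open>l\<close> and the value its row \<open>k\<close>; so here the inner argument has
  stride 1 and its value stride \<open>n\<close>.\<close>

sublocale X: layout m g n h "g * (h * n)" "h * n" g 1 "64 * QS + QS" 1 n 1 n "64 * QS + QS + m * g" "64 * QS"
  using dims QS_ge(1) by unfold_locales auto

sublocale Y: layout n h m g 1 n 1 n "64 * QS + QS + m * g" "g * (h * n)" "h * n" g 1 "64 * QS + QS" "64 * QS"
  using dims QS_ge(1) by unfold_locales auto

definition prepared :: "(nat \<Rightarrow> real) \<Rightarrow> store \<Rightarrow> bool" where
  "prepared R = (\<lambda>(I', R'). R' = R \<and> (if n \<le> m then Y.regs I' else X.regs I') \<and>
     I' vQS = int QS \<and> (\<forall>x\<ge>64. I' x = 0))"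

lemma choose_layout_correct:
  assumes I: "I vM = int m" "I vN = int n" "I vG = int g" "I vH = int h" "I vZero = 0" "I vOne = 1"
    "I vHN = int (h * n)" "I vGHN = int (g * (h * n))" "I vQS = int QS" "I vMG = int (m * g)"
    and zero: "\<forall>x\<ge>64. I x = 0"
  shows "ht choose_layout (I, R) 22 (prepared R)"
proof -
  define J where "J = I(vL := int (64 * QS))"
  have J: "J vM = int m" "J vN = int n" "J vG = int g" "J vH = int h" "J vZero = 0" "J vOne = 1"
    "J vHN = int (h * n)" "J vGHN = int (g * (h * n))" "J vQS = int QS" "J vMG = int (m * g)"
    "J vL = int (64 * QS)" "\<forall>x\<ge>64. J x = 0"
    using assms by (simp_all add: J_def)
  let ?y = "[IAdd vP vN vZero, IAdd vQ vH vZero, IAdd vSA vOne vZero, IAdd vSB vN vZero,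
          IAdd vCA vOne vZero, IAdd vCJ vN vZero, IAdd vDB vL vQS, IAdd vR vM vZero, IAdd vS vG vZero,
          IAdd vSC vGHN vZero, IAdd vSD vHN vZero, IAdd vDS vG vZero, IAdd vDV vOne vZero, IAdd vCB vDB vMG]"
  let ?x = "[IAdd vP vM vZero, IAdd vQ vG vZero, IAdd vSA vGHN vZero, IAdd vSB vHN vZero,
          IAdd vCA vG vZero, IAdd vCJ vOne vZero, IAdd vCB vL vQS, IAdd vR vN vZero, IAdd vS vH vZero,
          IAdd vSC vOne vZero, IAdd vSD vN vZero, IAdd vDS vOne vZero, IAdd vDV vN vZero, IAdd vDB vCB vMG]"
  have eq: "fold eff [IAdd vL vQS vQS, IAdd vL vL vL, IAdd vL vL vL, IAdd vL vL vL, IAdd vL vL vL, IAdd vL vL vL] (I, R)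
      = (J, R)"
    using I(9) by (simp add: J_def)
  define JY where "JY = J(vP := int n, vQ := int h, vSA := 1, vSB := int n, vCA := 1, vCJ := int n,
     vDB := int (64 * QS + QS), vR := int m, vS := int g, vSC := int (g * (h * n)), vSD := int (h * n),
     vDS := int g, vDV := 1, vCB := int (64 * QS + QS + m * g))"
  define JX where "JX = J(vP := int m, vQ := int g, vSA := int (g * (h * n)), vSB := int (h * n), vCA := int g,
     vCJ := 1, vCB := int (64 * QS + QS), vR := int n, vS := int h, vSC := 1, vSD := int n,
     vDS := 1, vDV := int n, vDB := int (64 * QS + QS + m * g))"
  have "fold eff ?y (J, R) = (JY, R)" "fold eff ?x (J, R) = (JX, R)"
    unfolding JX_def JY_def using J(1-11) by simp_all
  moreover have "Y.regs JY" "JY vQS = int QS"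
    unfolding Y.regs_def JY_def using J(1-11) by simp_all
  moreover have "X.regs JX" "JX vQS = int QS"
    unfolding X.regs_def JX_def using J(1-11) by simp_all
  moreover have "\<forall>x\<ge>64. JY x = 0" "\<forall>x\<ge>64. JX x = 0"
    using J(12) by (simp_all add: JX_def JY_def)
  ultimately have "n \<le> m \<Longrightarrow> prepared R (fold eff ?y (J, R))" "\<not> n \<le> m \<Longrightarrow> prepared R (fold eff ?x (J, R))"
    by (simp_all only: prepared_def prod.case if_True if_False simp_thms)
  note post = this
  have main: "ht (IfI vN vM (Block ?y) (Block ?x)) (J, R) 16 (prepared R)"
  proof (rule ht_IfI[where T = 14])
    assume "fst (J, R) vN \<le> fst (J, R) vM"
    then have "n \<le> m" using J(1,2) by simp
    then show "ht (Block ?y) (J, R) 14 (prepared R)" using post(1) by (intro ht_Block) simp_all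
  next
    assume "\<not> fst (J, R) vN \<le> fst (J, R) vM"
    then have "\<not> n \<le> m" using J(1,2) by simp
    then show "ht (Block ?x) (J, R) 14 (prepared R)" using post(2) by (intro ht_Block) simp_all
  qed simp
  show ?thesis
    unfolding choose_layout_def
    by (rule ht_Block_Seq[OF _ main[folded eq]]) simp_all
qed

lemma prepare_correct: "ht prepare (dims_mem m g h n, R) (4 * n + 8 * g + 4 * m + 35) (prepared R)"
  unfolding prepare_def
proof (rule ht_Block_Seq)
  define I1 where "I1 = (dims_mem m g h n)(vOne := 1)"
  define I2 where "I2 = I1(vHN := int (h * n), vA := int n)"
  define I3 where "I3 = I2(vGHN := int (h * n * g), vA := int g)"
  define I4 where "I4 = I3(vQS := int (h * n * g * m), vA := int m)"
  define I5 where "I5 = I4(vMG := int (m * g), vA := int g)"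
  have I1: "I1 vM = int m" "I1 vN = int n" "I1 vG = int g" "I1 vH = int h" "I1 vOne = 1" "I1 vZero = 0"
    "\<forall>x\<ge>64. I1 x = 0"
    by (simp_all add: I1_def dims_mem_def)
  have I2: "I2 vM = int m" "I2 vN = int n" "I2 vG = int g" "I2 vH = int h" "I2 vOne = 1" "I2 vZero = 0"
    "\<forall>x\<ge>64. I2 x = 0" "I2 vHN = int (h * n)"
    using I1 by (simp_all add: I2_def)
  have I3: "I3 vM = int m" "I3 vN = int n" "I3 vG = int g" "I3 vH = int h" "I3 vOne = 1" "I3 vZero = 0"
    "\<forall>x\<ge>64. I3 x = 0" "I3 vHN = int (h * n)" "I3 vGHN = int (h * n * g)"
    using I2 by (simp_all add: I3_def)
  have I4: "I4 vM = int m" "I4 vN = int n" "I4 vG = int g" "I4 vH = int h" "I4 vOne = 1" "I4 vZero = 0"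
    "\<forall>x\<ge>64. I4 x = 0" "I4 vHN = int (h * n)" "I4 vGHN = int (h * n * g)" "I4 vQS = int (h * n * g * m)"
    using I3 by (simp_all add: I4_def)
  have prods: "h * n * g = g * (h * n)" "h * n * g * m = QS" by (simp_all add: QS_def)
  have 5: "ht choose_layout (I5, R) 22 (prepared R)"
    by (rule choose_layout_correct) (use I4 in \<open>simp_all add: I5_def flip: prods\<close>)
  have 4: "ht (multiply vMG vM vG ;; choose_layout) (I4, R) (4 * g + 3 + 22) (prepared R)"
    by (rule ht_multiply_Seq[where x = m and y = g, OF _ _ _ _ _ _ _ _ _ 5[unfolded I5_def]])
      (use I4 in simp_all)
  have 3: "ht (multiply vQS vGHN vM ;; multiply vMG vM vG ;; choose_layout) (I3, R)
      (4 * m + 3 + (4 * g + 3 + 22)) (prepared R)"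
    by (rule ht_multiply_Seq[where x = "h * n * g" and y = m, OF _ _ _ _ _ _ _ _ _ 4[unfolded I4_def]])
      (use I3 in simp_all)
  have 2: "ht (multiply vGHN vHN vG ;; multiply vQS vGHN vM ;; multiply vMG vM vG ;; choose_layout) (I2, R)
      (4 * g + 3 + (4 * m + 3 + (4 * g + 3 + 22))) (prepared R)"
    by (rule ht_multiply_Seq[where x = "h * n" and y = g, OF _ _ _ _ _ _ _ _ _ 3[unfolded I3_def]])
      (use I2 in simp_all)
  have "ht (multiply vHN vH vN ;; multiply vGHN vHN vG ;; multiply vQS vGHN vM ;; multiply vMG vM vG ;;
      choose_layout) (I1, R) (4 * n + 3 + (4 * g + 3 + (4 * m + 3 + (4 * g + 3 + 22)))) (prepared R)"
    by (rule ht_multiply_Seq[where x = h and y = n, OF _ _ _ _ _ _ _ _ _ 2[unfolded I2_def]])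
      (use I1 in simp_all)
  moreover have "4 * n + 3 + (4 * g + 3 + (4 * m + 3 + (4 * g + 3 + 22))) = 4 * n + 8 * g + 4 * m + 34" by simp
  moreover have "fold eff [IConst vOne 1] (dims_mem m g h n, R) = (I1, R)" by (simp add: I1_def)
  ultimately
  show "ht (multiply vHN vH vN ;; multiply vGHN vHN vG ;; multiply vQS vGHN vM ;; multiply vMG vM vG ;;
      choose_layout) (fold eff [IConst vOne 1] (dims_mem m g h n, R)) (4 * n + 8 * g + 4 * m + 34) (prepared R)"
    by (simp only:)
qed simp_all

section \<open>The objective as a function of the input memory\<close>

definition G :: "(nat \<Rightarrow> real) \<Rightarrow> (nat \<Rightarrow> nat) \<Rightarrow> (nat \<Rightarrow> nat) \<Rightarrow> real" where
  "G D = Fobj m n (\<lambda>a j l k. D (((a * g + j) * h + k) * n + l)) (\<lambda>a j. D (QS + (a * g + j)))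
     (\<lambda>l k. D (QS + m * g + (k * n + l)))"

lemma index_less:
  assumes "a < m" "j < g" "k < h" "l < n"
  shows "((a * g + j) * h + k) * n + l < 64 * QS" "QS + (a * g + j) < 64 * QS"
    "QS + m * g + (k * n + l) < 64 * QS"
proof -
  have "((a * g + j) * h + k) * n + l < m * g * h * n"
    using assms by (intro pair_index_less)
  then show "((a * g + j) * h + k) * n + l < 64 * QS" by (simp add: QS_def)
  have "a * g + j < m * g" "k * n + l < h * n" using assms by (auto intro: pair_index_less)
  then show "QS + (a * g + j) < 64 * QS" "QS + m * g + (k * n + l) < 64 * QS"
    using QS_ge by linarith+
qed

lemma obj_eq_G:
  assumes R: "\<forall>x<64 * QS. R1 (64 * QS + x) = R x" and u: "u \<in> {..<m} \<rightarrow> {..<g}" and v: "v \<in> {..<n} \<rightarrow> {..<h}"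
  shows "X.obj R1 u v = G R u v" "Y.obj R1 v u = G R u v"
proof -
  have 1: "R1 (64 * QS + a * (g * (h * n)) + u a * (h * n) + l * 1 + v l * n)
      = R (((a * g + u a) * h + v l) * n + l)" if "a < m" "l < n" for a l
  proof -
    have "64 * QS + a * (g * (h * n)) + u a * (h * n) + l * 1 + v l * n
      = 64 * QS + (((a * g + u a) * h + v l) * n + l)" by (simp add: algebra_simps)
    moreover have "R1 (64 * QS + (((a * g + u a) * h + v l) * n + l)) = R (((a * g + u a) * h + v l) * n + l)"
      using that u v by (intro R[rule_format] index_less(1)) auto
    ultimately show ?thesis by metis
  qed
  have 2: "R1 (64 * QS + QS + a * g + u a * 1) = R (QS + (a * g + u a))" if "a < m" for a
  proof -
    have "64 * QS + QS + a * g + u a * 1 = 64 * QS + (QS + (a * g + u a))" by simp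
    moreover have "R1 (64 * QS + (QS + (a * g + u a))) = R (QS + (a * g + u a))"
      using that u dims by (intro R[rule_format] index_less(2)[of a "u a" 0 0]) auto
    ultimately show ?thesis by metis
  qed
  have 3: "R1 (64 * QS + QS + m * g + l * 1 + v l * n) = R (QS + m * g + (v l * n + l))" if "l < n" for l
  proof -
    have "64 * QS + QS + m * g + l * 1 + v l * n = 64 * QS + (QS + m * g + (v l * n + l))" by simp
    moreover have "R1 (64 * QS + (QS + m * g + (v l * n + l))) = R (QS + m * g + (v l * n + l))"
      using that v dims by (intro R[rule_format] index_less(3)[of 0 0 "v l" l]) auto
    ultimately show ?thesis by metis
  qed
  show X: "X.obj R1 u v = G R u v"
    unfolding X.obj_def G_def by (rule Fobj_cong) (rule 1 2 3; assumption)+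
  have "Y.obj R1 v u = Fobj n m (\<lambda>l k a j. R1 (64 * QS + a * (g * (h * n)) + j * (h * n) + l * 1 + k * n))
     (\<lambda>l k. R1 (64 * QS + QS + m * g + l * 1 + k * n)) (\<lambda>a j. R1 (64 * QS + QS + a * g + j * 1)) v u"
    unfolding Y.obj_def by (rule Fobj_cong) (simp_all add: ac_simps)
  also have "\<dots> = X.obj R1 u v" unfolding X.obj_def by (rule Fobj_swap)
  finally show "Y.obj R1 v u = G R u v" using X by simp
qed

text \<open>What the search guarantees, freed of the layout: minimality against the pairs with a
  step function in the outer position, which is held by \<open>y\<close> when
  \<open>n \<le> m\<close>.\<close>

definition optimal_pair :: "(nat \<Rightarrow> real) \<Rightarrow> (nat \<Rightarrow> nat) \<Rightarrow> (nat \<Rightarrow> nat) \<Rightarrow> bool" where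
  "optimal_pair D u v \<longleftrightarrow> u \<in> {..<m} \<rightarrow> {..<g} \<and> v \<in> {..<n} \<rightarrow> {..<h} \<and>
     (if n \<le> m then \<forall>i\<in>{1..n}. \<forall>t<h. \<forall>u'\<in>{..<m} \<rightarrow> {..<g}. G D u v \<le> G D u' (step_fun i t)
      else \<forall>i\<in>{1..m}. \<forall>t<g. \<forall>v'\<in>{..<n} \<rightarrow> {..<h}. G D u v \<le> G D (step_fun i t) v')"

definition output_of :: "(nat \<Rightarrow> nat) \<Rightarrow> (nat \<Rightarrow> nat) \<Rightarrow> (nat \<Rightarrow> int) \<Rightarrow> bool" where
  "output_of u v I \<longleftrightarrow> (\<forall>x<m * g + h * n. I (x + 2) =
     (if (\<exists>a<m. x = a * g + u a) \<or> (\<exists>l<n. x = m * g + (v l * n + l)) then 1 else 0))"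

text \<open>Each of \<open>m\<close>, \<open>n\<close>, \<open>g\<close> and \<open>QS\<close> is at
  most \<open>m * n * QS\<close>. The constant is 4 + 8 + 4 + 35 for the preparation, 141 for the
  search, \<open>12 * 64\<close> for moving \<open>L = 64 * QS\<close> cells up and the output down,
  and 144.\<close>

lemma solver_correct:
  "ht (prepare ;; solve_layout) (dims_mem m g h n, R) (1104 * (m * n * QS))
     (\<lambda>(I', R'). \<exists>u v. optimal_pair R u v \<and> output_of u v I')"
proof (rule ht_Seq[OF prepare_correct])
  have mn: "1 \<le> m * n" "m \<le> m * n" "n \<le> m * n" using dims by simp_all
  have le: "QS \<le> m * n * QS" "m * QS \<le> m * n * QS" "n * QS \<le> m * n * QS"
    using mult_le_mono1[OF mn(1), of QS] mult_le_mono1[OF mn(2), of QS] mult_le_mono1[OF mn(3), of QS]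
    by simp_all
  have "m * (m * g * n * h) = m * QS" "n * (n * h * m * g) = n * QS"
    by (simp_all add: QS_def)
  then have pq: "X.search_time \<le> 141 * (m * QS)" "Y.search_time \<le> 141 * (n * QS)"
    using X.search_time_le Y.search_time_le by (simp_all only:)
  with pq le(2,3) have time: "max X.search_time Y.search_time \<le> 141 * (m * n * QS)" by linarith
  show "4 * n + 8 * g + 4 * m + 35 + (max X.search_time Y.search_time + 12 * (64 * QS) + 144) \<le> 1104 * (m * n * QS)"
    using time le QS_ge by linarith
  fix s1 assume post: "prepared R s1"
  then obtain I1 where s1: "s1 = (I1, R)" and
    1: "if n \<le> m then Y.regs I1 else X.regs I1" "I1 vQS = int QS" "\<forall>x\<ge>64. I1 x = 0"
    by (cases s1) (simp only: prepared_def prod.case, blast)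
  have QS0: "0 < QS" using QS_ge(1) by simp
  have range: "x + 2 < 64 * QS" if "x < m * g + h * n" for x using that QS_ge by linarith
  have step_in: "step_fun i t \<in> {..<p} \<rightarrow> {..<q}" if "t < q" for i t p q
    using that by (auto simp: step_fun_def)
  show "ht solve_layout s1 (max X.search_time Y.search_time + 12 * (64 * QS) + 144)
     (\<lambda>(I', R'). \<exists>u v. optimal_pair R u v \<and> output_of u v I')"
  proof (cases "n \<le> m")
    case True
    then have regs: "Y.regs I1" using 1(1) by simp
    show ?thesis
      unfolding s1
    proof (rule ht_conseq[OF Y.solve_layout_correct[OF regs 1(2) QS0 1(3)]])
      fix st assume "Y.solve_post QS R st"
      then obtain I2 R2 R1 v u where st: "st = (I2, R2)" and
        R1: "\<forall>x<64 * QS. R1 (64 * QS + x) = R x" and v: "\<forall>a<n. v a < h" and u: "\<forall>b<m. u b < g" and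
        best: "\<forall>i\<in>{1..n}. \<forall>t<h. \<forall>u'\<in>{..<m} \<rightarrow> {..<g}. Y.obj R1 v u \<le> Y.obj R1 (step_fun i t) u'" and
        mem: "\<forall>x. x + 2 < 64 * QS \<longrightarrow> I2 (x + 2) =
          (if (\<exists>a<n. 64 * QS + QS + x = 64 * QS + QS + m * g + a * 1 + v a * n) \<or>
              (\<exists>b<m. 64 * QS + QS + x = 64 * QS + QS + b * g + u b * 1) then 1 else 0)"
        by (cases st) (simp only: Y.solve_post_def prod.case, blast)
      have uv: "u \<in> {..<m} \<rightarrow> {..<g}" "v \<in> {..<n} \<rightarrow> {..<h}" using u v by auto
      have "optimal_pair R u v"
        unfolding optimal_pair_def using uv best True obj_eq_G(2)[OF R1] step_in by simp
      moreover have "output_of u v I2"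
        unfolding output_of_def
      proof (intro allI impI)
        fix x assume "x < m * g + h * n"
        have "(\<exists>a<n. 64 * QS + QS + x = 64 * QS + QS + m * g + a * 1 + v a * n) \<longleftrightarrow> (\<exists>l<n. x = m * g + (v l * n + l))"
          "(\<exists>b<m. 64 * QS + QS + x = 64 * QS + QS + b * g + u b * 1) \<longleftrightarrow> (\<exists>a<m. x = a * g + u a)"
          by (auto simp: ac_simps)
        then show "I2 (x + 2) = (if (\<exists>a<m. x = a * g + u a) \<or> (\<exists>l<n. x = m * g + (v l * n + l)) then 1 else 0)"
          using mem range[OF \<open>x < m * g + h * n\<close>] by (simp only: disj_commute)
      qed
      ultimately show "case st of (I', R') \<Rightarrow> \<exists>u v. optimal_pair R u v \<and> output_of u v I'" using st by blast
    qed simp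
  next
    case False
    then have regs: "X.regs I1" using 1(1) by simp
    show ?thesis
      unfolding s1
    proof (rule ht_conseq[OF X.solve_layout_correct[OF regs 1(2) QS0 1(3)]])
      fix st assume "X.solve_post QS R st"
      then obtain I2 R2 R1 u v where st: "st = (I2, R2)" and
        R1: "\<forall>x<64 * QS. R1 (64 * QS + x) = R x" and u: "\<forall>a<m. u a < g" and v: "\<forall>b<n. v b < h" and
        best: "\<forall>i\<in>{1..m}. \<forall>t<g. \<forall>v'\<in>{..<n} \<rightarrow> {..<h}. X.obj R1 u v \<le> X.obj R1 (step_fun i t) v'" and
        mem: "\<forall>x. x + 2 < 64 * QS \<longrightarrow> I2 (x + 2) =
          (if (\<exists>a<m. 64 * QS + QS + x = 64 * QS + QS + a * g + u a * 1) \<or>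
              (\<exists>b<n. 64 * QS + QS + x = 64 * QS + QS + m * g + b * 1 + v b * n) then 1 else 0)"
        by (cases st) (simp only: X.solve_post_def prod.case, blast)
      have uv: "u \<in> {..<m} \<rightarrow> {..<g}" "v \<in> {..<n} \<rightarrow> {..<h}" using u v by auto
      have "optimal_pair R u v"
        unfolding optimal_pair_def using uv best False obj_eq_G(1)[OF R1] step_in by simp
      moreover have "output_of u v I2"
        unfolding output_of_def
      proof (intro allI impI)
        fix x assume "x < m * g + h * n"
        have "(\<exists>b<n. 64 * QS + QS + x = 64 * QS + QS + m * g + b * 1 + v b * n) \<longleftrightarrow> (\<exists>l<n. x = m * g + (v l * n + l))"
          "(\<exists>a<m. 64 * QS + QS + x = 64 * QS + QS + a * g + u a * 1) \<longleftrightarrow> (\<exists>a<m. x = a * g + u a)"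
          by (auto simp: ac_simps)
        then show "I2 (x + 2) = (if (\<exists>a<m. x = a * g + u a) \<or> (\<exists>l<n. x = m * g + (v l * n + l)) then 1 else 0)"
          using mem range[OF \<open>x < m * g + h * n\<close>] by (simp only: disj_commute)
      qed
      ultimately show "case st of (I', R') \<Rightarrow> \<exists>u v. optimal_pair R u v \<and> output_of u v I'" using st by blast
    qed simp
  qed
qed

text \<open>\<open>domination_count\<close> puts the outer function first. For
  \<open>n \<le> m\<close> this is \<open>y\<close>, so the pairs it counts have to be swapped;
  otherwise it applies directly.\<close>

lemma optimal_pair_count:
  assumes "optimal_pair D u v"
  defines "A \<equiv> {(u', v'). u' \<in> funs m g \<and> v' \<in> funs n h \<and> G D u v \<le> G D u' v'}"
  shows "g ^ (m - 1) * h ^ (n - 1) \<le> card A"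
    "n \<le> m \<Longrightarrow> n * (h - 1) * g ^ m \<le> card A" "m < n \<Longrightarrow> m * (g - 1) * h ^ n \<le> card A"
proof -
  let ?w = "\<lambda>a j l k. D (((a * g + j) * h + k) * n + l)"
  let ?c = "\<lambda>a j. D (QS + (a * g + j))"
  let ?d = "\<lambda>l k. D (QS + m * g + (k * n + l))"
  let ?B = "{(v', u'). v' \<in> funs n h \<and> u' \<in> funs m g \<and> G D u v \<le> Fobj n m (\<lambda>l k a j. ?w a j l k) ?d ?c v' u'}"
  have swap: "Fobj n m (\<lambda>l k a j. ?w a j l k) ?d ?c v' u' = G D u' v'" for u' v'
    unfolding G_def by (rule Fobj_swap)
  have B: "card ?B = card A"
  proof (rule bij_betw_same_card)
    show "bij_betw prod.swap ?B A"
      unfolding swap A_def by (rule bij_betwI[where g = prod.swap]) auto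
  qed
  have y: "n * (h - 1) * g ^ m \<le> card A" "h ^ (n - 1) * g ^ (m - 1) \<le> card A" if "n \<le> m"
    unfolding B[symmetric]
    by (rule domination_count[of h g n m];
      use dims assms(1) that swap in \<open>simp add: optimal_pair_def\<close>)+
  have x: "m * (g - 1) * h ^ n \<le> card A" "g ^ (m - 1) * h ^ (n - 1) \<le> card A" if "\<not> n \<le> m"
    unfolding A_def G_def
    by (rule domination_count[of g h m n];
      use dims assms(1) that in \<open>simp add: optimal_pair_def G_def\<close>)+
  show "n \<le> m \<Longrightarrow> n * (h - 1) * g ^ m \<le> card A" "m < n \<Longrightarrow> m * (g - 1) * h ^ n \<le> card A"
    using x y by auto
  show "g ^ (m - 1) * h ^ (n - 1) \<le> card A"
    using x(2) y(2) by (cases "n \<le> m") (simp_all add: mult.commute)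
qed

end

subsection \<open>Matrices, encodings and the final bounds\<close>

text \<open>Functions are 0-based and matrices 1-based, whence the shifts by 1; entries outside the
  range are 0, as feasibility demands.\<close>

definition row_mat :: "nat \<Rightarrow> nat \<Rightarrow> (nat \<Rightarrow> nat) \<Rightarrow> nat \<Rightarrow> nat \<Rightarrow> int" where
  "row_mat m g u = (\<lambda>i j. if i \<in> {1..m} \<and> j \<in> {1..g} \<and> u (i - 1) = j - 1 then 1 else 0)"

definition col_mat :: "nat \<Rightarrow> nat \<Rightarrow> (nat \<Rightarrow> nat) \<Rightarrow> nat \<Rightarrow> nat \<Rightarrow> int" where
  "col_mat h n v = (\<lambda>k l. row_mat n h v l k)"

lemma sum_row_mat_row:
  fixes F :: "nat \<Rightarrow> real"
  assumes "a < m" "u a < g"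
  shows "(\<Sum>j\<in>{1..g}. F j * of_int (row_mat m g u (Suc a) j)) = F (Suc (u a))"
proof -
  have "F j * of_int (row_mat m g u (Suc a) j) = (if j = Suc (u a) then F (Suc (u a)) else 0)"
    if "j \<in> {1..g}" for j
    using that assms by (auto simp: row_mat_def)
  then have "(\<Sum>j\<in>{1..g}. F j * of_int (row_mat m g u (Suc a) j))
      = (\<Sum>j\<in>{1..g}. if j = Suc (u a) then F (Suc (u a)) else 0)" by (intro sum.cong) auto
  also have "\<dots> = F (Suc (u a))" using assms(2) by simp
  finally show ?thesis .
qed

lemma sum_row_mat:
  fixes F :: "nat \<Rightarrow> nat \<Rightarrow> real"
  assumes "u \<in> {..<m} \<rightarrow> {..<g}"
  shows "(\<Sum>i\<in>{1..m}. \<Sum>j\<in>{1..g}. F i j * of_int (row_mat m g u i j)) = (\<Sum>a<m. F (Suc a) (Suc (u a)))"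
proof -
  have "(\<Sum>i\<in>{1..m}. \<Sum>j\<in>{1..g}. F i j * of_int (row_mat m g u i j))
      = (\<Sum>a<m. \<Sum>j\<in>{1..g}. F (Suc a) j * of_int (row_mat m g u (Suc a) j))"
    by (simp only: One_nat_def sum.atLeast1_atMost_eq)
  also have "\<dots> = (\<Sum>a<m. F (Suc a) (Suc (u a)))"
    using assms by (intro sum.cong refl sum_row_mat_row) auto
  finally show ?thesis .
qed

lemma sum_col_mat:
  fixes F :: "nat \<Rightarrow> nat \<Rightarrow> real"
  assumes "v \<in> {..<n} \<rightarrow> {..<h}"
  shows "(\<Sum>k\<in>{1..h}. \<Sum>l\<in>{1..n}. F k l * of_int (col_mat h n v k l)) = (\<Sum>b<n. F (Suc (v b)) (Suc b))"
  unfolding col_mat_def by (subst sum.swap, subst sum_row_mat[OF assms]) simp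

lemma row_mat_sum:
  assumes "u \<in> {..<m} \<rightarrow> {..<g}" "i \<in> {1..m}"
  shows "(\<Sum>j\<in>{1..g}. row_mat m g u i j) = 1"
proof -
  obtain a where a: "i = Suc a" "a < m" using assms(2) by (cases i) auto
  \<comment> \<open>Cast to the reals to reuse the weighted row sum with all weights 1.\<close>
  have "real_of_int (\<Sum>j\<in>{1..g}. row_mat m g u i j) = (\<Sum>j\<in>{1..g}. 1 * of_int (row_mat m g u (Suc a) j))"
    by (simp add: a)
  also have "\<dots> = 1" by (rule sum_row_mat_row[where F = "\<lambda>_. 1"]) (use a assms in auto)
  finally show ?thesis by linarith
qed

definition feasible :: "nat \<Rightarrow> nat \<Rightarrow> nat \<Rightarrow> nat \<Rightarrow> (nat \<Rightarrow> nat \<Rightarrow> int) \<Rightarrow> (nat \<Rightarrow> nat \<Rightarrow> int) \<Rightarrow> bool" where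
  "feasible m g h n x y \<longleftrightarrow>
     (\<forall>i j. x i j \<in> {0,1} \<and> y i j \<in> {0,1}) \<and>
     (\<forall>i j. \<not> (i \<in> {1..m} \<and> j \<in> {1..g}) \<longrightarrow> x i j = 0) \<and>
     (\<forall>i j. \<not> (i \<in> {1..h} \<and> j \<in> {1..n}) \<longrightarrow> y i j = 0) \<and>
     (\<forall>i\<in>{1..m}. (\<Sum>j\<in>{1..g}. x i j) = 1) \<and>
     (\<forall>j\<in>{1..n}. (\<Sum>i\<in>{1..h}. y i j) = 1)"

lemma feasible_mats:
  assumes "u \<in> {..<m} \<rightarrow> {..<g}" "v \<in> {..<n} \<rightarrow> {..<h}"
  shows "feasible m g h n (row_mat m g u) (col_mat h n v)"
  unfolding feasible_def col_mat_def
  using row_mat_sum[OF assms(1)] row_mat_sum[OF assms(2)] by (auto simp: row_mat_def)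

text \<open>A 0-1 matrix vanishing outside the grid is determined by its set of ones. Finiteness
  matters because \<open>card\<close> of an infinite set is 0, so that an injection alone would not
  bound the domination number from below.\<close>

lemma finite_zero_one_matrices:
  "finite {x :: nat \<Rightarrow> nat \<Rightarrow> int. (\<forall>i j. x i j \<in> {0,1}) \<and> (\<forall>i j. \<not> (i \<in> {1..m} \<and> j \<in> {1..g}) \<longrightarrow> x i j = 0)}"
proof (rule finite_subset)
  show "{x :: nat \<Rightarrow> nat \<Rightarrow> int. (\<forall>i j. x i j \<in> {0,1}) \<and> (\<forall>i j. \<not> (i \<in> {1..m} \<and> j \<in> {1..g}) \<longrightarrow> x i j = 0)}
      \<subseteq> (\<lambda>S i j. if (i, j) \<in> S then 1 else 0) ` Pow ({1..m} \<times> {1..g})"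
  proof
    fix x :: "nat \<Rightarrow> nat \<Rightarrow> int"
    assume "x \<in> {x. (\<forall>i j. x i j \<in> {0,1}) \<and> (\<forall>i j. \<not> (i \<in> {1..m} \<and> j \<in> {1..g}) \<longrightarrow> x i j = 0)}"
    then have x: "x i j \<in> {0,1}" "\<not> (i \<in> {1..m} \<and> j \<in> {1..g}) \<Longrightarrow> x i j = 0" for i j by blast+
    let ?S = "{(i, j). x i j = 1}"
    have "(if (i, j) \<in> ?S then 1 else 0) = x i j" for i j using x(1)[of i j] by auto
    then have "x = (\<lambda>i j. if (i, j) \<in> ?S then 1 else 0)" by (intro ext) simp
    moreover have "(i, j) \<in> {1..m} \<times> {1..g}" if "x i j = 1" for i j
      using x(2)[of i j] that by (cases "i \<in> {1..m} \<and> j \<in> {1..g}") simp_all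
    then have "?S \<in> Pow ({1..m} \<times> {1..g})" by blast
    ultimately show "x \<in> (\<lambda>S i j. if (i, j) \<in> S then 1 else 0) ` Pow ({1..m} \<times> {1..g})" by (rule image_eqI)
  qed
  show "finite ((\<lambda>S i j. if (i, j) \<in> S then 1 else 0 :: int) ` Pow ({1..m} \<times> {1..g}))"
    by (intro finite_imageI) simp
qed

lemma finite_feasible: "finite {(x, y). feasible m g h n x y}"
  by (rule finite_subset[OF _ finite_cartesian_product[OF finite_zero_one_matrices[of m g] finite_zero_one_matrices[of h n]]])
    (auto simp: feasible_def)

lemma inj_on_row_mat: "inj_on (row_mat m g) (funs m g)"
proof (rule inj_onI)
  fix u v assume u: "u \<in> funs m g" and v: "v \<in> funs m g" and eq: "row_mat m g u = row_mat m g v"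
  show "u = v"
  proof (rule PiE_ext)
    show "u \<in> {..<m} \<rightarrow>\<^sub>E {..<g}" "v \<in> {..<m} \<rightarrow>\<^sub>E {..<g}" using u v unfolding funs_def by blast+
    fix a assume a: "a \<in> {..<m}"
    have "u a < g" using u a unfolding funs_def by blast
    then have "row_mat m g u (Suc a) (Suc (u a)) = 1" using a by (simp add: row_mat_def)
    then have "row_mat m g v (Suc a) (Suc (u a)) = 1" by (simp add: eq)
    then show "u a = v a" by (auto simp: row_mat_def split: if_splits)
  qed
qed

lemma inj_on_col_mat: "inj_on (col_mat h n) (funs n h)"
proof (rule inj_onI)
  fix u v assume uv: "u \<in> funs n h" "v \<in> funs n h" and eq: "col_mat h n u = col_mat h n v"
  have "row_mat n h u l k = row_mat n h v l k" for l k
    using fun_cong[OF fun_cong[OF eq, of k], of l] by (simp add: col_mat_def)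
  then have "row_mat n h u = row_mat n h v" by (intro ext)
  then show "u = v" by (rule inj_onD[OF inj_on_row_mat _ uv])
qed

section \<open>Objective and memory encodings\<close>

definition objective :: "nat \<Rightarrow> nat \<Rightarrow> nat \<Rightarrow> nat \<Rightarrow> (nat \<Rightarrow> nat \<Rightarrow> nat \<Rightarrow> nat \<Rightarrow> real) \<Rightarrow> (nat \<Rightarrow> nat \<Rightarrow> real)
   \<Rightarrow> (nat \<Rightarrow> nat \<Rightarrow> real) \<Rightarrow> (nat \<Rightarrow> nat \<Rightarrow> int) \<Rightarrow> (nat \<Rightarrow> nat \<Rightarrow> int) \<Rightarrow> real" where
  "objective m g h n Q c d x y =
     (\<Sum>i\<in>{1..m}. \<Sum>j\<in>{1..g}. \<Sum>k\<in>{1..h}. \<Sum>l\<in>{1..n}. Q i j k l * of_int (x i j) * of_int (y k l))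
     + (\<Sum>i\<in>{1..m}. \<Sum>j\<in>{1..g}. c i j * of_int (x i j))
     + (\<Sum>k\<in>{1..h}. \<Sum>l\<in>{1..n}. d k l * of_int (y k l))"

text \<open>A single 1 per row of \<open>x\<close> and per column of \<open>y\<close> collapses the
  fourfold sum to a double one. The value of \<open>v\<close> is the third index of
  \<open>Q\<close>, its argument the fourth.\<close>

lemma objective_mats:
  assumes u: "u \<in> {..<m} \<rightarrow> {..<g}" and v: "v \<in> {..<n} \<rightarrow> {..<h}"
  shows "objective m g h n Q c d (row_mat m g u) (col_mat h n v) =
    Fobj m n (\<lambda>a j b k. Q (Suc a) (Suc j) (Suc k) (Suc b)) (\<lambda>a j. c (Suc a) (Suc j))
      (\<lambda>b k. d (Suc k) (Suc b)) u v"
proof -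
  let ?x = "row_mat m g u" and ?y = "col_mat h n v"
  have "(\<Sum>k\<in>{1..h}. \<Sum>l\<in>{1..n}. Q i j k l * of_int (?x i j) * of_int (?y k l))
      = (\<Sum>b<n. Q i j (Suc (v b)) (Suc b)) * of_int (?x i j)" for i j
    using sum_col_mat[OF v, of "\<lambda>k l. Q i j k l * of_int (?x i j)"] by (simp add: sum_distrib_right)
  then have "(\<Sum>i\<in>{1..m}. \<Sum>j\<in>{1..g}. \<Sum>k\<in>{1..h}. \<Sum>l\<in>{1..n}. Q i j k l * of_int (?x i j) * of_int (?y k l))
      = (\<Sum>a<m. \<Sum>b<n. Q (Suc a) (Suc (u a)) (Suc (v b)) (Suc b))"
    using sum_row_mat[OF u, of "\<lambda>i j. \<Sum>b<n. Q i j (Suc (v b)) (Suc b)"] by simp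
  then show ?thesis
    unfolding objective_def Fobj_def sum_row_mat[OF u] sum_col_mat[OF v] by simp
qed

definition input_data :: "nat \<Rightarrow> nat \<Rightarrow> nat \<Rightarrow> nat \<Rightarrow> (nat \<Rightarrow> nat \<Rightarrow> nat \<Rightarrow> nat \<Rightarrow> real) \<Rightarrow> (nat \<Rightarrow> nat \<Rightarrow> real)
   \<Rightarrow> (nat \<Rightarrow> nat \<Rightarrow> real) \<Rightarrow> nat \<Rightarrow> real" where
  "input_data m g h n Q c d = (\<lambda>a. if a < m*g*h*n then
       Q (a div (g*h*n) + 1) (a div (h*n) mod g + 1) (a div n mod h + 1) (a mod n + 1)
     else if a < m*g*h*n + m*g then c ((a - m*g*h*n) div g + 1) ((a - m*g*h*n) mod g + 1)
     else if a < m*g*h*n + m*g + h*n then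
       d ((a - m*g*h*n - m*g) div n + 1) ((a - m*g*h*n - m*g) mod n + 1)
     else 0)"

definition decode :: "nat \<Rightarrow> nat \<Rightarrow> nat \<Rightarrow> nat \<Rightarrow> (nat \<Rightarrow> int) \<Rightarrow> (nat \<Rightarrow> nat \<Rightarrow> int) \<times> (nat \<Rightarrow> nat \<Rightarrow> int)" where
  "decode m g h n I =
    ((\<lambda>i j. if i \<in> {1..m} \<and> j \<in> {1..g} then I (2 + (i-1)*g + (j-1)) else 0),
     (\<lambda>i j. if i \<in> {1..h} \<and> j \<in> {1..n} then I (2 + m*g + (i-1)*n + (j-1)) else 0))"

context instance_dims begin

text \<open>The address of a quadratic cost is a mixed-radix numeral with digits \<open>a\<close>,
  \<open>u a\<close>, \<open>v b\<close>, \<open>b\<close>, and the quotients and remainders in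
  \<open>input_data\<close> extract these digits.\<close>

lemma G_input_data:
  assumes u: "u \<in> {..<m} \<rightarrow> {..<g}" and v: "v \<in> {..<n} \<rightarrow> {..<h}"
  shows "G (input_data m g h n Q c d) u v = objective m g h n Q c d (row_mat m g u) (col_mat h n v)"
  unfolding objective_mats[OF u v] G_def
proof (rule Fobj_cong)
  fix a b assume a: "a < m" and b: "b < n"
  have ua: "u a < g" and vb: "v b < h" using u v a b by auto
  let ?x = "((a * g + u a) * h + v b) * n + b"
  have lt: "?x < m * g * h * n" using a b ua vb by (intro pair_index_less)
  have 1: "?x div n = (a * g + u a) * h + v b" "?x mod n = b" using b by simp_all
  have "?x div (h * n) = ?x div n div h" by (simp only: mult.commute[of h n] div_mult2_eq)
  then have 2: "?x div (h * n) = a * g + u a" unfolding 1 using vb by simp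
  have "g * h * n = h * n * g" by (simp add: ac_simps)
  then have "?x div (g * h * n) = ?x div (h * n) div g" by (simp only: div_mult2_eq)
  then have 3: "?x div (g * h * n) = a" unfolding 2 using ua by simp
  have "input_data m g h n Q c d ?x
      = Q (?x div (g * h * n) + 1) (?x div (h * n) mod g + 1) (?x div n mod h + 1) (?x mod n + 1)"
    using lt by (simp only: input_data_def if_True)
  then show "input_data m g h n Q c d ?x = Q (Suc a) (Suc (u a)) (Suc (v b)) (Suc b)"
    unfolding 1 2 3 using ua vb by simp
next
  fix a assume a: "a < m"
  have ua: "u a < g" using u a by auto
  have "a * g + u a < m * g" using a ua by (rule pair_index_less)
  then show "input_data m g h n Q c d (QS + (a * g + u a)) = c (Suc a) (Suc (u a))"
    using ua by (simp add: input_data_def QS_def)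
next
  fix b assume b: "b < n"
  have vb: "v b < h" using v b by auto
  have "v b * n + b < h * n" using vb b by (rule pair_index_less)
  then show "input_data m g h n Q c d (QS + m * g + (v b * n + b)) = d (Suc (v b)) (Suc b)"
    using b by (simp add: input_data_def QS_def)
qed

text \<open>Output offsets below \<open>m * g\<close> belong to \<open>x\<close>, the others to
  \<open>y\<close>, so the two conditions of \<open>output_of\<close> never interfere; within each
  block the row-major index determines row and column.\<close>

lemma decode_output:
  assumes u: "u \<in> {..<m} \<rightarrow> {..<g}" and v: "v \<in> {..<n} \<rightarrow> {..<h}" and out: "output_of u v I"
  shows "decode m g h n I = (row_mat m g u, col_mat h n v)"
proof -
  have mem: "I (2 + x) = (if (\<exists>a<m. x = a * g + u a) \<or> (\<exists>l<n. x = m * g + (v l * n + l)) then 1 else 0)"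
    if "x < m * g + h * n" for x
    using out that unfolding output_of_def by (simp only: add.commute[of 2])
  have ul: "a * g + u a < m * g" if "a < m" for a using u that by (intro pair_index_less) auto
  have "I (2 + i * g + j) = row_mat m g u (Suc i) (Suc j)" if i: "i < m" and j: "j < g" for i j
  proof -
    have lt: "i * g + j < m * g" using i j by (rule pair_index_less)
    have "(\<exists>a<m. i * g + j = a * g + u a) \<longleftrightarrow> u i = j"
    proof
      assume "\<exists>a<m. i * g + j = a * g + u a"
      then obtain a where a: "a < m" "i * g + j = a * g + u a" by blast
      then have "u a < g" using u by auto
      from pair_index_inj[OF j this a(2)] show "u i = j" by simp
    qed (use i in auto)
    moreover have "\<not> (\<exists>l<n. i * g + j = m * g + (v l * n + l))" using lt by auto
    ultimately show ?thesis using mem[of "i * g + j"] lt i j by (simp add: row_mat_def add.assoc)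
  qed
  then have "(if i \<in> {1..m} \<and> j \<in> {1..g} then I (2 + (i-1)*g + (j-1)) else 0) = row_mat m g u i j" for i j
    by (cases i; cases j) (auto simp: row_mat_def)
  moreover have "I (2 + m * g + k * n + l) = row_mat n h v (Suc l) (Suc k)" if k: "k < h" and l: "l < n" for k l
  proof -
    have lt: "k * n + l < h * n" using k l by (rule pair_index_less)
    have "(\<exists>b<n. m * g + (k * n + l) = m * g + (v b * n + b)) \<longleftrightarrow> v l = k"
    proof
      assume "\<exists>b<n. m * g + (k * n + l) = m * g + (v b * n + b)"
      then obtain b where b: "b < n" "k * n + l = v b * n + b" by auto
      from pair_index_inj[OF l b] show "v l = k" by simp
    qed (use l in auto)
    moreover have "\<not> (\<exists>a<m. m * g + (k * n + l) = a * g + u a)" using ul by fastforce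
    ultimately have "I (2 + (m * g + (k * n + l))) = (if v l = k then 1 else 0)"
      using mem[of "m * g + (k * n + l)"] lt by (simp only: nat_add_left_cancel_less simp_thms)
    then show ?thesis using k l by (simp add: row_mat_def add.assoc)
  qed
  then have "(if k \<in> {1..h} \<and> l \<in> {1..n} then I (2 + m * g + (k-1)*n + (l-1)) else 0) = col_mat h n v k l" for k l
    by (cases k; cases l) (auto simp: row_mat_def col_mat_def)
  ultimately show ?thesis by (simp add: decode_def)
qed

text \<open>\<open>pre\<close> is the part specific to a problem: it computes \<open>g\<close> and
  \<open>h\<close> from \<open>m\<close> and \<open>n\<close>. All the code after it is
  shared.\<close>

lemma program_correct:
  assumes pre: "list_all straight pre" "fold eff pre (I0, input_data m g h n Q c d) = (dims_mem m g h n, input_data m g h n Q c d)"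
  defines "P \<equiv> compile 0 (Block pre ;; prepare ;; solve_layout)"
    and "s \<equiv> at_pc 0 (I0, input_data m g h n Q c d)"
  shows "halts P s" "run_time P s \<le> length pre + 1104 * (m * n * QS)"
    "\<exists>u v. optimal_pair (input_data m g h n Q c d) u v \<and>
       decode m g h n (imem (final P s)) = (row_mat m g u, col_mat h n v)"
proof -
  let ?D = "input_data m g h n Q c d"
  have "ht (Block pre ;; prepare ;; solve_layout) (I0, ?D) (length pre + 1104 * (m * n * QS))
     (\<lambda>(I', R'). \<exists>u v. optimal_pair ?D u v \<and> output_of u v I')"
    by (rule ht_Block_Seq[OF pre(1)], unfold pre(2), rule solver_correct, simp)
  note prog = ht_program[OF this, folded P_def s_def]
  show "halts P s" "run_time P s \<le> length pre + 1104 * (m * n * QS)" by (rule prog)+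
  obtain I R u v where "imem (final P s) = I" "optimal_pair ?D u v" "output_of u v I"
    using prog(3) by auto
  then show "\<exists>u v. optimal_pair ?D u v \<and> decode m g h n (imem (final P s)) = (row_mat m g u, col_mat h n v)"
    using decode_output unfolding optimal_pair_def by blast
qed

text \<open>Pairs of functions embed injectively into the feasible solutions with the same
  objective, so the count of functions bounds that of matrices from below.\<close>

lemma domination_lower_bounds:
  assumes "optimal_pair (input_data m g h n Q c d) u v"
  defines "N \<equiv> card {(x, y). feasible m g h n x y \<and>
     objective m g h n Q c d (row_mat m g u) (col_mat h n v) \<le> objective m g h n Q c d x y}"
  shows "g ^ (m - 1) * h ^ (n - 1) \<le> N"
    "n \<le> m \<Longrightarrow> n * (h - 1) * g ^ m \<le> N" "m < n \<Longrightarrow> m * (g - 1) * h ^ n \<le> N"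
proof -
  let ?D = "input_data m g h n Q c d"
  let ?A = "{(u', v'). u' \<in> funs m g \<and> v' \<in> funs n h \<and> G ?D u v \<le> G ?D u' v'}"
  let ?B = "{(x, y). feasible m g h n x y \<and>
     objective m g h n Q c d (row_mat m g u) (col_mat h n v) \<le> objective m g h n Q c d x y}"
  have uv: "u \<in> {..<m} \<rightarrow> {..<g}" "v \<in> {..<n} \<rightarrow> {..<h}" using assms(1) by (auto simp: optimal_pair_def)
  have funs_Pi: "u' \<in> {..<p} \<rightarrow> {..<q}" if "u' \<in> funs p q" for u' p q using that by (auto simp: funs_def)
  have "card ?A \<le> N"
    unfolding N_def
  proof (rule card_inj_on_le)
    show "inj_on (map_prod (row_mat m g) (col_mat h n)) ?A"
      by (rule inj_on_subset[OF map_prod_inj_on[OF inj_on_row_mat inj_on_col_mat]]) auto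
    show "map_prod (row_mat m g) (col_mat h n) ` ?A \<subseteq> ?B"
      using funs_Pi by (auto simp: feasible_mats G_input_data uv)
    show "finite ?B" by (rule finite_subset[OF _ finite_feasible[of m g h n]]) auto
  qed
  then show "g ^ (m - 1) * h ^ (n - 1) \<le> N"
    "n \<le> m \<Longrightarrow> n * (h - 1) * g ^ m \<le> N" "m < n \<Longrightarrow> m * (g - 1) * h ^ n \<le> N"
    using optimal_pair_count[OF assms(1)] by (meson le_trans)+
qed

end

section \<open>The two problems as special cases\<close>

lemma feasible1_eq: "feasible1 m n = feasible m n m n"
  by (intro ext) (auto simp: feasible1_def feasible_def)

lemma feasible2_eq: "feasible2 m n = feasible m m n n"
  by (intro ext) (auto simp: feasible2_def feasible_def)

lemma f1_eq: "f1 m n = objective m n m n"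
proof (intro ext)
  fix Q :: "nat \<Rightarrow> nat \<Rightarrow> nat \<Rightarrow> nat \<Rightarrow> real" and c d x y
  \<comment> \<open>\<open>f1\<close> sums over \<open>k\<close> before \<open>j\<close>, the other
    way round than \<open>objective\<close>.\<close>
  have "(\<Sum>k\<in>{1..m}. \<Sum>j\<in>{1..n}. \<Sum>l\<in>{1..n}. Q i j k l * real_of_int (x i j) * real_of_int (y k l))
    = (\<Sum>j\<in>{1..n}. \<Sum>k\<in>{1..m}. \<Sum>l\<in>{1..n}. Q i j k l * real_of_int (x i j) * real_of_int (y k l))" for i
    by (rule sum.swap)
  then show "f1 m n Q c d x y = objective m n m n Q c d x y"
    by (simp only: f1_def objective_def)
qed

lemma f2_eq: "f2 m n = objective m m n n"
  by (intro ext) (simp add: f2_def objective_def)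

definition size_mem :: "nat \<Rightarrow> nat \<Rightarrow> nat \<Rightarrow> int" where
  "size_mem m n = (\<lambda>a. if a = 0 then int m else if a = 1 then int n else 0)"

lemma init1_eq: "init1 m n Q c d = at_pc 0 (size_mem m n, input_data m n m n Q c d)"
  by (simp add: init1_def at_pc_def size_mem_def input_data_def mult_2 add_mult_distrib add.assoc fun_eq_iff)

lemma init2_eq: "init2 m n Q c d = at_pc 0 (size_mem m n, input_data m m n n Q c d)"
  by (simp add: init2_def at_pc_def size_mem_def input_data_def fun_eq_iff)

lemma decode1_eq: "decode1 m n s = decode m n m n (imem s)"
  by (simp add: decode1_def decode_def)

lemma decode2_eq: "decode2 m n s = decode m m n n (imem s)"
  by (simp add: decode2_def decode_def)

section \<open>From the counts to the stated bounds\<close>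

lemma le_twice_pred: "2 \<le> k \<Longrightarrow> real k \<le> 2 * real (k - 1)"
  by (simp add: of_nat_diff)

text \<open>As \<open>m\<close> and \<open>n\<close> are at least 2, the factor \<open>q - 1\<close>
  of the count is at least \<open>q / 2\<close>, so the one of the last two terms that the search
  counts is at most \<open>2 * N\<close>. By \<open>power_swap_le\<close> the other is at most 9/8
  of this bound, and 1 + 2 + 9/4 is below 6.\<close>

lemma bqap1_bound:
  fixes N :: nat
  assumes mn: "2 \<le> m" "2 \<le> n" and N: "n ^ (m - 1) * m ^ (n - 1) \<le> N"
    "n \<le> m \<Longrightarrow> n * (m - 1) * n ^ m \<le> N" "m < n \<Longrightarrow> m * (n - 1) * m ^ n \<le> N"
  shows "1 / 6 * (real m ^ (n - 1) * real n ^ (m - 1) + real m ^ (n + 1) * real n + real m * real n ^ (m + 1)) \<le> real N"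
proof -
  have 1: "real m ^ (n - 1) * real n ^ (m - 1) \<le> real N"
    using of_nat_mono[OF N(1), where 'a = real] by (simp add: mult.commute)
  have 2: "real a * real b * (real b ^ a) \<le> 2 * real N" "8 * (real a * real b * real a ^ b) \<le> 18 * real N"
    if "2 \<le> a" "2 \<le> b" "b \<le> a" "b * (a - 1) * b ^ a \<le> N" for a b
  proof -
    have "real b * real (a - 1) * real b ^ a \<le> real N"
      using of_nat_mono[OF that(4), where 'a = real] by simp
    moreover have "real a * (real b * real b ^ a) \<le> 2 * real (a - 1) * (real b * real b ^ a)"
      by (rule mult_right_mono[OF le_twice_pred]) (use that in auto)
    ultimately show le: "real a * real b * (real b ^ a) \<le> 2 * real N" by (simp add: algebra_simps)
    have "(real a * real b) * (8 * real a ^ b) \<le> (real a * real b) * (9 * real b ^ a)"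
      by (rule mult_left_mono[OF power_swap_le]) (use that in auto)
    then show "8 * (real a * real b * real a ^ b) \<le> 18 * real N" using le by (simp add: algebra_simps)
  qed
  define A B where "A = real m ^ (n + 1) * real n" and "B = real m * real n ^ (m + 1)"
  have "A + B \<le> 5 * real N"
  proof (cases "n \<le> m")
    case True
    have "A = real m * real n * real m ^ n" "B = real m * real n * real n ^ m"
      by (simp_all add: A_def B_def)
    then show ?thesis using 2[OF mn True N(2)[OF True]] by simp
  next
    case False
    then have "m \<le> n" "m < n" by auto
    moreover have "A = real n * real m * real m ^ n" "B = real n * real m * real n ^ m"
      by (simp_all add: A_def B_def)
    ultimately show ?thesis using 2[OF mn(2,1) _ N(3)] by (simp add: mult.commute mult.left_commute)
  qed
  then show ?thesis using 1 unfolding A_def[symmetric] B_def[symmetric] by simp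
qed

text \<open>Again the counted term is at most \<open>2 * N\<close>. Here it dominates the other one
  outright: for \<open>2 \<le> b \<le> a\<close>, cancelling squares reduces
  \<open>a^2 * b^b \<le> b^2 * a^a\<close> to \<open>b^(b-2) \<le> a^(a-2)\<close>.\<close>

lemma bqap2_bound:
  fixes N :: nat
  assumes mn: "2 \<le> m" "2 \<le> n" and N: "m ^ (m - 1) * n ^ (n - 1) \<le> N"
    "n \<le> m \<Longrightarrow> n * (n - 1) * m ^ m \<le> N" "m < n \<Longrightarrow> m * (m - 1) * n ^ n \<le> N"
  shows "1 / 6 * (real m ^ (m - 1) * real n ^ (n - 1) + real m ^ 2 * real n ^ n + real m ^ m * real n ^ 2) \<le> real N"
proof -
  have 1: "real m ^ (m - 1) * real n ^ (n - 1) \<le> real N"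
    using of_nat_mono[OF N(1), where 'a = real] by simp
  have 2: "real b ^ 2 * real a ^ a \<le> 2 * real N" "real a ^ 2 * real b ^ b \<le> 2 * real N"
    if "2 \<le> b" "b \<le> a" "b * (b - 1) * a ^ a \<le> N" for a b
  proof -
    have "real b * real (b - 1) * real a ^ a \<le> real N"
      using of_nat_mono[OF that(3), where 'a = real] by simp
    moreover have "real b * (real b * real a ^ a) \<le> 2 * real (b - 1) * (real b * real a ^ a)"
      by (rule mult_right_mono[OF le_twice_pred]) (use that in auto)
    ultimately show le: "real b ^ 2 * real a ^ a \<le> 2 * real N"
      by (simp add: algebra_simps power2_eq_square)
    have split: "real k ^ k = real k ^ 2 * real k ^ (k - 2)" if "2 \<le> k" for k
      using that by (metis power_add le_add_diff_inverse)
    have "real b ^ (b - 2) \<le> real a ^ (b - 2)" using that by (intro power_mono) auto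
    also have "\<dots> \<le> real a ^ (a - 2)" using that by (intro power_increasing) auto
    finally have "(real a ^ 2 * real b ^ 2) * real b ^ (b - 2) \<le> (real a ^ 2 * real b ^ 2) * real a ^ (a - 2)"
      by (intro mult_left_mono) auto
    then have "real a ^ 2 * real b ^ b \<le> real b ^ 2 * real a ^ a"
      using split[of a] split[of b] that by (simp add: ac_simps)
    then show "real a ^ 2 * real b ^ b \<le> 2 * real N" using le by linarith
  qed
  show ?thesis
    using 1 2[of n m] 2[of m n] mn N(2,3) by (cases "n \<le> m") (simp_all add: ac_simps)
qed

text \<open>The infimum of a nonempty set of naturals is attained, so a bound for every instance
  bounds the domination number.\<close>

lemma Inf_nat_ge:
  fixes S :: "nat set"
  assumes "S \<noteq> {}" "\<And>x. x \<in> S \<Longrightarrow> K \<le> real x"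
  shows "K \<le> real (Inf S)"
  using assms Inf_nat_def1 by blast

section \<open>The two programs\<close>

definition program :: "instr list \<Rightarrow> instr list" where
  "program pre = compile 0 (Block pre ;; prepare ;; solve_layout)"

definition bqap1_program :: "instr list" where
  "bqap1_program = program [IAdd vG vN vZero, IAdd vH vM vZero]"

definition bqap2_program :: "instr list" where
  "bqap2_program = program [IAdd vG vM vZero, IAdd vH vN vZero]"

text \<open>In both problems \<open>QS = (m * n)^2\<close>. The summand 2, the length of the prefix
  specific to the problem, is absorbed because \<open>(m * n)^3 \<ge> 1\<close>; hence 1106.\<close>

lemma time_bound:
  assumes "1 \<le> m" "1 \<le> n" "T \<le> 2 + 1104 * (m * n * (m * n * m * n))"
  shows "real T \<le> 1106 * real m ^ 3 * real n ^ 3"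
proof -
  have "1 \<le> (m * n) ^ 3" using assms by simp
  moreover have "m * n * (m * n * m * n) = (m * n) ^ 3" by (simp add: power3_eq_cube)
  ultimately have "T \<le> 1106 * (m * n) ^ 3" using assms(3) by linarith
  then have "real T \<le> real (1106 * (m * n) ^ 3)" by (rule of_nat_mono)
  then show ?thesis by (simp add: power_mult_distrib)
qed

lemma bqap1_solution:
  fixes m n :: nat
  assumes "1 \<le> m" "1 \<le> n"
  shows "halts bqap1_program (init1 m n Q c d)"
    "real (run_time bqap1_program (init1 m n Q c d)) \<le> 1106 * real m ^ 3 * real n ^ 3"
    "\<exists>u v. instance_dims.optimal_pair m n m n (input_data m n m n Q c d) u v \<and>
       out1 bqap1_program m n Q c d = (row_mat m n u, col_mat m n v)"
proof -
  interpret instance_dims m n m n using assms by unfold_locales auto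
  let ?pre = "[IAdd vG vN vZero, IAdd vH vM vZero]"
  have "fold eff ?pre (size_mem m n, D) = (dims_mem m n m n, D)" for D
    by (auto simp: size_mem_def dims_mem_def)
  note prog = program_correct[of ?pre "size_mem m n", OF _ this]
  have prog:
    "halts bqap1_program (init1 m n Q c d)"
    "run_time bqap1_program (init1 m n Q c d) \<le> length ?pre + 1104 * (m * n * QS)"
    "\<exists>u v. optimal_pair (input_data m n m n Q c d) u v \<and>
       decode m n m n (imem (final bqap1_program (init1 m n Q c d))) = (row_mat m n u, col_mat m n v)"
    unfolding bqap1_program_def program_def init1_eq by (rule prog; simp)+
  show "halts bqap1_program (init1 m n Q c d)" by (rule prog(1))
  have "run_time bqap1_program (init1 m n Q c d) \<le> 2 + 1104 * (m * n * (m * n * m * n))"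
    using prog(2) by (simp add: QS_def)
  then show "real (run_time bqap1_program (init1 m n Q c d)) \<le> 1106 * real m ^ 3 * real n ^ 3"
    by (rule time_bound[OF assms])
  show "\<exists>u v. optimal_pair (input_data m n m n Q c d) u v \<and>
       out1 bqap1_program m n Q c d = (row_mat m n u, col_mat m n v)"
    unfolding out1_def decode1_eq by (rule prog(3))
qed

lemma bqap2_solution:
  fixes m n :: nat
  assumes "1 \<le> m" "1 \<le> n"
  shows "halts bqap2_program (init2 m n Q c d)"
    "real (run_time bqap2_program (init2 m n Q c d)) \<le> 1106 * real m ^ 3 * real n ^ 3"
    "\<exists>u v. instance_dims.optimal_pair m m n n (input_data m m n n Q c d) u v \<and>
       out2 bqap2_program m n Q c d = (row_mat m m u, col_mat n n v)"
proof -
  interpret instance_dims m m n n using assms by unfold_locales auto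
  let ?pre = "[IAdd vG vM vZero, IAdd vH vN vZero]"
  have "fold eff ?pre (size_mem m n, D) = (dims_mem m m n n, D)" for D
    by (auto simp: size_mem_def dims_mem_def)
  note prog = program_correct[of ?pre "size_mem m n", OF _ this]
  have prog:
    "halts bqap2_program (init2 m n Q c d)"
    "run_time bqap2_program (init2 m n Q c d) \<le> length ?pre + 1104 * (m * n * QS)"
    "\<exists>u v. optimal_pair (input_data m m n n Q c d) u v \<and>
       decode m m n n (imem (final bqap2_program (init2 m n Q c d))) = (row_mat m m u, col_mat n n v)"
    unfolding bqap2_program_def program_def init2_eq by (rule prog; simp)+
  show "halts bqap2_program (init2 m n Q c d)" by (rule prog(1))
  have "run_time bqap2_program (init2 m n Q c d) \<le> 2 + 1104 * (m * n * (m * n * m * n))"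
    using prog(2) by (simp add: QS_def ac_simps)
  then show "real (run_time bqap2_program (init2 m n Q c d)) \<le> 1106 * real m ^ 3 * real n ^ 3"
    by (rule time_bound[OF assms])
  show "\<exists>u v. optimal_pair (input_data m m n n Q c d) u v \<and>
       out2 bqap2_program m n Q c d = (row_mat m m u, col_mat n n v)"
    unfolding out2_def decode2_eq by (rule prog(3))
qed

theorem theorem6:
  shows "(\<exists>P :: instr list. \<exists>C :: real. \<exists>K :: real. K > 0 \<and>
            (\<forall>m n Q c d. m \<ge> 1 \<and> n \<ge> 1 \<longrightarrow>
               halts P (init1 m n Q c d) \<and>
               real (run_time P (init1 m n Q c d)) \<le> C * real m ^ 3 * real n ^ 3 \<and>
               feasible1 m n (fst (out1 P m n Q c d)) (snd (out1 P m n Q c d))) \<and>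
            (\<forall>m n. m \<ge> 2 \<and> n \<ge> 2 \<longrightarrow>
               real (dom_number1 P m n) \<ge>
                 K * (real m ^ (n - 1) * real n ^ (m - 1) + real m ^ (n + 1) * real n
                      + real m * real n ^ (m + 1))))
       \<and> (\<exists>P :: instr list. \<exists>C :: real. \<exists>K :: real. K > 0 \<and>
            (\<forall>m n Q c d. m \<ge> 1 \<and> n \<ge> 1 \<longrightarrow>
               halts P (init2 m n Q c d) \<and>
               real (run_time P (init2 m n Q c d)) \<le> C * real m ^ 3 * real n ^ 3 \<and>
               feasible2 m n (fst (out2 P m n Q c d)) (snd (out2 P m n Q c d))) \<and>
            (\<forall>m n. m \<ge> 2 \<and> n \<ge> 2 \<longrightarrow>
               real (dom_number2 P m n) \<ge>
                 K * (real m ^ (m - 1) * real n ^ (n - 1) + real m ^ 2 * real n ^ n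
                      + real m ^ m * real n ^ 2)))"
proof (intro conjI)
  show "\<exists>P :: instr list. \<exists>C :: real. \<exists>K :: real. K > 0 \<and>
            (\<forall>m n Q c d. m \<ge> 1 \<and> n \<ge> 1 \<longrightarrow>
               halts P (init1 m n Q c d) \<and>
               real (run_time P (init1 m n Q c d)) \<le> C * real m ^ 3 * real n ^ 3 \<and>
               feasible1 m n (fst (out1 P m n Q c d)) (snd (out1 P m n Q c d))) \<and>
            (\<forall>m n. m \<ge> 2 \<and> n \<ge> 2 \<longrightarrow>
               real (dom_number1 P m n) \<ge>
                 K * (real m ^ (n - 1) * real n ^ (m - 1) + real m ^ (n + 1) * real n
                      + real m * real n ^ (m + 1)))"
  proof (rule exI[of _ bqap1_program], rule exI[of _ 1106], rule exI[of _ "1 / 6"], intro conjI allI impI; (elim conjE)?)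
    fix m n :: nat and Q c d
    assume mn: "1 \<le> m" "1 \<le> n"
    note sol = bqap1_solution[OF mn, of Q c d]
    show "halts bqap1_program (init1 m n Q c d)"
      "real (run_time bqap1_program (init1 m n Q c d)) \<le> 1106 * real m ^ 3 * real n ^ 3"
      by (rule sol)+
    interpret instance_dims m n m n using mn by unfold_locales auto
    show "feasible1 m n (fst (out1 bqap1_program m n Q c d)) (snd (out1 bqap1_program m n Q c d))"
      using sol(3) feasible_mats by (auto simp: feasible1_eq optimal_pair_def)
  next
    fix m n :: nat
    assume mn: "2 \<le> m" "2 \<le> n"
    interpret instance_dims m n m n using mn by unfold_locales auto
    show "1 / 6 * (real m ^ (n - 1) * real n ^ (m - 1) + real m ^ (n + 1) * real n
                      + real m * real n ^ (m + 1)) \<le> real (dom_number1 bqap1_program m n)"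
      unfolding dom_number1_def
    proof (rule Inf_nat_ge, blast, clarify)
      fix Q c d
      obtain u v where uv: "optimal_pair (input_data m n m n Q c d) u v"
        "out1 bqap1_program m n Q c d = (row_mat m n u, col_mat m n v)"
        using bqap1_solution(3)[of m n Q c d] mn by auto
      show "1 / 6 * (real m ^ (n - 1) * real n ^ (m - 1) + real m ^ (n + 1) * real n
          + real m * real n ^ (m + 1)) \<le> real (card {(x, y). feasible1 m n x y \<and>
          f1 m n Q c d (fst (out1 bqap1_program m n Q c d)) (snd (out1 bqap1_program m n Q c d)) \<le> f1 m n Q c d x y})"
        \<comment> \<open>In the common form of the two problems, the three counts are exactly the
          premises of the arithmetic bound.\<close>
        unfolding uv(2) fst_conv snd_conv feasible1_eq f1_eq
        by (rule bqap1_bound[OF mn domination_lower_bounds[OF uv(1)]])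
    qed
  qed simp
  show "\<exists>P :: instr list. \<exists>C :: real. \<exists>K :: real. K > 0 \<and>
            (\<forall>m n Q c d. m \<ge> 1 \<and> n \<ge> 1 \<longrightarrow>
               halts P (init2 m n Q c d) \<and>
               real (run_time P (init2 m n Q c d)) \<le> C * real m ^ 3 * real n ^ 3 \<and>
               feasible2 m n (fst (out2 P m n Q c d)) (snd (out2 P m n Q c d))) \<and>
            (\<forall>m n. m \<ge> 2 \<and> n \<ge> 2 \<longrightarrow>
               real (dom_number2 P m n) \<ge>
                 K * (real m ^ (m - 1) * real n ^ (n - 1) + real m ^ 2 * real n ^ n
                      + real m ^ m * real n ^ 2))"
  proof (rule exI[of _ bqap2_program], rule exI[of _ 1106], rule exI[of _ "1 / 6"], intro conjI allI impI; (elim conjE)?)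
    fix m n :: nat and Q c d
    assume mn: "1 \<le> m" "1 \<le> n"
    note sol = bqap2_solution[OF mn, of Q c d]
    show "halts bqap2_program (init2 m n Q c d)"
      "real (run_time bqap2_program (init2 m n Q c d)) \<le> 1106 * real m ^ 3 * real n ^ 3"
      by (rule sol)+
    interpret instance_dims m m n n using mn by unfold_locales auto
    show "feasible2 m n (fst (out2 bqap2_program m n Q c d)) (snd (out2 bqap2_program m n Q c d))"
      using sol(3) feasible_mats by (auto simp: feasible2_eq optimal_pair_def)
  next
    fix m n :: nat
    assume mn: "2 \<le> m" "2 \<le> n"
    interpret instance_dims m m n n using mn by unfold_locales auto
    show "1 / 6 * (real m ^ (m - 1) * real n ^ (n - 1) + real m ^ 2 * real n ^ n
                      + real m ^ m * real n ^ 2) \<le> real (dom_number2 bqap2_program m n)"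
      unfolding dom_number2_def
    proof (rule Inf_nat_ge, blast, clarify)
      fix Q c d
      obtain u v where uv: "optimal_pair (input_data m m n n Q c d) u v"
        "out2 bqap2_program m n Q c d = (row_mat m m u, col_mat n n v)"
        using bqap2_solution(3)[of m n Q c d] mn by auto
      show "1 / 6 * (real m ^ (m - 1) * real n ^ (n - 1) + real m ^ 2 * real n ^ n
          + real m ^ m * real n ^ 2) \<le> real (card {(x, y). feasible2 m n x y \<and>
          f2 m n Q c d (fst (out2 bqap2_program m n Q c d)) (snd (out2 bqap2_program m n Q c d)) \<le> f2 m n Q c d x y})"
        unfolding uv(2) fst_conv snd_conv feasible2_eq f2_eq
        by (rule bqap2_bound[OF mn domination_lower_bounds[OF uv(1)]])
    qed
  qed simp
qed

end
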